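(* Assume Assumption A-0 holds, let $T\ge0$ and let $\psi_0,\dots,\psi_T:\mathbb{R}^d\to\mathbb{R}$ be bounded measurable functions. Let $(b_N)$ be positive reals with $b_N\to\infty$ and $\sqrt N/b_N\to\infty$. Then $$\mathbf I_T(\mathbf x)=\sup_{\boldsymbol\lambda\in\mathbb{R}^{T+1}}\Big\{\langle\mathbf x,\boldsymbol\lambda\rangle-\tfrac12\langle\boldsymbol\lambda,\mathbf V_T(\psi_{0:T})\boldsymbol\lambda\rangle\Big\},\quad \mathbf x\in\mathbb{R}^{T+1},$$ is a good rate function, and the random vectors $\mathbf M_N^T(\psi_{0:T})=(M_N^0(\psi_0),\dots,M_N^T(\psi_T))$ satisfy under $\mathbb{P}_T$ the moderate deviation principle with speed $b_N^2$ and rate function $\mathbf I_T$: for every Borel $\Gamma\subset\mathbb{R}^{T+1}$, $$-\inf_{\mathrm{int}(\Gamma)}\mathbf I_T\le\liminf_{N\to\infty}\frac1{b_N^2}\log\mathbb{P}_T(\mathbf M_N^T\in\Gamma)\le\limsup_{N\to\infty}\frac1{b_N^2}\log\mathbb{P}_T(\mathbf M_N^T\in\Gamma)\le-\inf_{\overline\Gamma}\mathbf I_T.$$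
   Context: Hidden Markov model: $(X_t)_{t\ge0}$ is an $\mathbb{R}^d$-valued Markov chain with $\mathbb{P}(X_0\in A)=\int_A a_0\,d\mu$ and $\mathbb{P}(X_t\in A\mid X_{t-1}=x)=\int_A a_t(x,x')\,\mu(dx')$ ($t\ge1$), where $\mu$ is a reference measure on $\mathbb{R}^d$. Observations $(Y_t)_{t\ge1}$ are $\mathbb{R}^m$-valued, conditionally independent given $(X_t)$, with $\mathbb{P}(Y_t\in B\mid X_t=x)=\int_B b_t(x,y)\,\nu(dy)$. Observations $y_1,\dots,y_T$ are fixed, $\mathbb{P}_T=\mathbb{P}(\cdot\mid Y_1=y_1,\dots,Y_T=y_T)$. Filter density: $f_{0|0}=a_0$, $f_{t|t}(x)\propto b_t(x,y_t)\int f_{t-1|t-1}(u)a_t(u,x)\mu(du)$ (normalized to a probability density w.r.t. $\mu$). Particle filter: $(x_{i,0})_{i\le N}$ i.i.d. with law $a_0d\mu$; given generations up to $t-1$, $(x_{i,t})_{i\le N}$ are i.i.d. with law $f^N_{t|t}d\mu$, $f^N_{t|t}(x)\propto b_t(x,y_t)\frac1N\sum_i a_t(x_{i,t-1},x)$ (normalized). Notation: $m_t(\psi)=\int\psi f_{t|t}d\mu$; $L_t\psi(x)=\int a_t(x,u)b_t(u,y_t)\psi(u)\mu(du)$; $\mathbb{1}\equiv1$; $M_N^t(\psi)=\frac1{b_N\sqrt N}\sum_{i=1}^N(\psi(x_{i,t})-m_t(\psi))$. Assumption A-0: for every $t\ge1$, $\sup_xL_t\mathbb{1}(x)<\infty$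 and $L_t\mathbb{1}(x)>0$ for all $x$; then $\kappa_t:=\int L_t\mathbb{1}\,f_{t-1|t-1}d\mu>0$. Variance quantities: $\sigma_t^2(\psi)=\int(\psi-m_t(\psi))^2f_{t|t}d\mu$; $V_0(\psi)=\sigma_0^2(\psi)$ and $V_t(\psi)=\sigma_t^2(\psi)+\kappa_t^{-2}V_{t-1}(L_t\psi-m_t(\psi)L_t\mathbb{1})$ for $t\ge1$; $V_{t,t}(\psi,\phi)=\frac12(V_t(\psi+\phi)-V_t(\psi)-V_t(\phi))$; for $r<t$, $V_{r,t}(\psi_r,\psi_t)=\kappa_t^{-1}V_{r,t-1}(\psi_r,L_t(\psi_t-m_t(\psi_t)))$, and $V_{t,r}(\psi_t,\psi_r)=V_{r,t}(\psi_r,\psi_t)$. The covariance matrix is $\mathbf V_T(\psi_{0:T})=(V_{s,t}(\psi_s,\psi_t))_{0\le s,t\le T}$. *)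

theory Defs
  imports "HOL-Probability.Probability"
begin

(* Parameters of the hidden Markov model (passed explicitly):
   mu  :: reference measure on R^d            (real^'d)
   a0  :: initial density w.r.t. mu
   a   :: a t x x' transition density (t >= 1)
   b   :: b t x y  observation density w.r.t. nu
   y   :: y t fixed observations (t = 1..T)            *)

definition hmm_model ::
  "(real^'d) measure \<Rightarrow> (real^'m) measure \<Rightarrow> (real^'d \<Rightarrow> real)
   \<Rightarrow> (nat \<Rightarrow> real^'d \<Rightarrow> real^'d \<Rightarrow> real) \<Rightarrow> (nat \<Rightarrow> real^'d \<Rightarrow> real^'m \<Rightarrow> real) \<Rightarrow> bool" where
  "hmm_model mu nu a0 a b \<longleftrightarrow>
     sets mu = sets borel \<and> sigma_finite_measure mu \<and>
     sets nu = sets borel \<and> sigma_finite_measure nu \<and>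
     a0 \<in> borel_measurable borel \<and> (\<forall>x. 0 \<le> a0 x) \<and> (\<integral>\<^sup>+ x. ennreal (a0 x) \<partial>mu) = 1 \<and>
     (\<forall>t\<ge>1. (\<lambda>(x, x'). a t x x') \<in> borel_measurable borel \<and> (\<forall>x x'. 0 \<le> a t x x') \<and>
              (\<forall>x. (\<integral>\<^sup>+ x'. ennreal (a t x x') \<partial>mu) = 1)) \<and>
     (\<forall>t\<ge>1. (\<lambda>(x, w). b t x w) \<in> borel_measurable borel \<and> (\<forall>x w. 0 \<le> b t x w) \<and>
              (\<forall>x. (\<integral>\<^sup>+ w. ennreal (b t x w) \<partial>nu) = 1))"

primrec filt ::
  "(real^'d) measure \<Rightarrow> (real^'d \<Rightarrow> real) \<Rightarrow> (nat \<Rightarrow> real^'d \<Rightarrow> real^'d \<Rightarrow> real)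
   \<Rightarrow> (nat \<Rightarrow> real^'d \<Rightarrow> 'y \<Rightarrow> real) \<Rightarrow> (nat \<Rightarrow> 'y) \<Rightarrow> nat \<Rightarrow> real^'d \<Rightarrow> real" where
  "filt mu a0 a b y 0 = a0"
| "filt mu a0 a b y (Suc t) =
     (let p = (\<lambda>x. b (Suc t) x (y (Suc t)) * (\<integral>u. filt mu a0 a b y t u * a (Suc t) u x \<partial>mu))
      in (\<lambda>x. p x / (\<integral>z. p z \<partial>mu)))"

definition mt where
  "mt mu a0 a b y t \<psi> = (\<integral>x. \<psi> x * filt mu a0 a b y t x \<partial>mu)"

definition Lop ::
  "(real^'d) measure \<Rightarrow> (nat \<Rightarrow> real^'d \<Rightarrow> real^'d \<Rightarrow> real)
   \<Rightarrow> (nat \<Rightarrow> real^'d \<Rightarrow> 'y \<Rightarrow> real) \<Rightarrow> (nat \<Rightarrow> 'y) \<Rightarrow> nat \<Rightarrow> (real^'d \<Rightarrow> real) \<Rightarrow> real^'d \<Rightarrow> real" where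
  "Lop mu a b y t \<psi> x = (\<integral>u. a t x u * b t u (y t) * \<psi> u \<partial>mu)"

definition kappa where
  "kappa mu a0 a b y t = (\<integral>x. Lop mu a b y t (\<lambda>_. 1) x * filt mu a0 a b y (t - 1) x \<partial>mu)"

definition sigma2 where
  "sigma2 mu a0 a b y t \<psi> = (\<integral>x. (\<psi> x - mt mu a0 a b y t \<psi>)\<^sup>2 * filt mu a0 a b y t x \<partial>mu)"

primrec Vt ::
  "(real^'d) measure \<Rightarrow> (real^'d \<Rightarrow> real) \<Rightarrow> (nat \<Rightarrow> real^'d \<Rightarrow> real^'d \<Rightarrow> real)
   \<Rightarrow> (nat \<Rightarrow> real^'d \<Rightarrow> 'y \<Rightarrow> real) \<Rightarrow> (nat \<Rightarrow> 'y) \<Rightarrow> nat \<Rightarrow> (real^'d \<Rightarrow> real) \<Rightarrow> real" where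
  "Vt mu a0 a b y 0 \<psi> = sigma2 mu a0 a b y 0 \<psi>"
| "Vt mu a0 a b y (Suc t) \<psi> =
     sigma2 mu a0 a b y (Suc t) \<psi> +
     (kappa mu a0 a b y (Suc t))\<^sup>2 powi (-1) *
       Vt mu a0 a b y t (\<lambda>x. Lop mu a b y (Suc t) \<psi> x
                               - mt mu a0 a b y (Suc t) \<psi> * Lop mu a b y (Suc t) (\<lambda>_. 1) x)"

definition Vtt where
  "Vtt mu a0 a b y t \<psi> \<phi> =
     (Vt mu a0 a b y t (\<lambda>x. \<psi> x + \<phi> x) - Vt mu a0 a b y t \<psi> - Vt mu a0 a b y t \<phi>) / 2"

text \<open>Vcross r k psi_r psi_t = V_{r,r+k}(psi_r, psi_t)\<close>
primrec Vcross where
  "Vcross mu a0 a b y r 0 \<psi> \<phi> = Vtt mu a0 a b y r \<psi> \<phi>"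
| "Vcross mu a0 a b y r (Suc k) \<psi> \<phi> =
     inverse (kappa mu a0 a b y (r + Suc k)) *
       Vcross mu a0 a b y r k \<psi>
         (Lop mu a b y (r + Suc k) (\<lambda>x. \<phi> x - mt mu a0 a b y (r + Suc k) \<phi>))"

definition Vst where
  "Vst mu a0 a b y s t \<psi>s \<psi>t =
     (if s \<le> t then Vcross mu a0 a b y s (t - s) \<psi>s \<psi>t
      else Vcross mu a0 a b y t (s - t) \<psi>t \<psi>s)"

definition assumption_A0 where
  "assumption_A0 mu a b y T \<longleftrightarrow>
     (\<forall>t\<in>{1..T}.
        (\<exists>C::real. \<forall>x. (\<integral>\<^sup>+ u. ennreal (a t x u * b t u (y t)) \<partial>mu) \<le> ennreal C) \<and>
        (\<forall>x. 0 < (\<integral>\<^sup>+ u. ennreal (a t x u * b t u (y t)) \<partial>mu)))"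

definition pf_gen0 where
  "pf_gen0 mu a0 N = (\<Pi>\<^sub>M i\<in>{..<N}. density mu (\<lambda>x. ennreal (a0 x)))"

definition pf_next where
  "pf_next mu a b y N t xs =
     (let p = (\<lambda>x. ennreal (b t x (y t) * (\<Sum>i<N. a t (xs i) x) / real N))
      in (\<Pi>\<^sub>M i\<in>{..<N}. density mu (\<lambda>x. p x / (\<integral>\<^sup>+ z. p z \<partial>mu))))"

text \<open>Joint law of generations 0..t; a sample is X with X s i = x_{i,s}.\<close>
primrec pf_law where
  "pf_law mu a0 a b y N 0 =
     distr (pf_gen0 mu a0 N) (\<Pi>\<^sub>M s\<in>{..0::nat}. \<Pi>\<^sub>M i\<in>{..<N}. borel) (\<lambda>x. (\<lambda>s\<in>{..0}. x))"
| "pf_law mu a0 a b y N (Suc t) =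
     Giry_Monad.bind (pf_law mu a0 a b y N t)
       (\<lambda>X. distr (pf_next mu a b y N (Suc t) (X t))
                  (\<Pi>\<^sub>M s\<in>{..Suc t}. \<Pi>\<^sub>M i\<in>{..<N}. borel) (\<lambda>x. X(Suc t := x)))"

definition MN where
  "MN mu a0 a b y (bN :: nat \<Rightarrow> real) N t \<psi> X =
     (\<Sum>i<N. \<psi> (X t i) - mt mu a0 a b y t \<psi>) / (bN N * sqrt (real N))"

definition scaled_log :: "real \<Rightarrow> real \<Rightarrow> ereal" where
  "scaled_log s p = (if p = 0 then - \<infinity> else ereal (ln p / s))"

definition good_rate_function :: "('a::topological_space \<Rightarrow> ereal) \<Rightarrow> bool" where
  "good_rate_function I \<longleftrightarrow>
     (\<forall>x. 0 \<le> I x) \<and> (\<forall>c::real. closed {x. I x \<le> ereal c}) \<and>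
     (\<forall>c::real. compact {x. I x \<le> ereal c})"

end

theory Submission
  imports Defs
begin

text \<open>
  Conditionally on the first \<open>t\<close> generations the next one is i.i.d., and its law is a ratio of two
  empirical means.  Hence the scaled Laplace transform of the first \<open>t + 1\<close> fluctuations is that of
  the first \<open>t\<close> fluctuations times the \<open>N\<close>-th power of a ratio close to one.  A second-order
  expansion shows that this factor adds \<open>\<sigma>\<^sup>2 / 2\<close> to the limit and replaces the last test function
  \<open>\<psi>\<^sub>t\<close> by \<open>\<psi>\<^sub>t + L (\<psi>\<^sub>t\<^sub>+\<^sub>1 - m \<psi>\<^sub>t\<^sub>+\<^sub>1) / \<kappa>\<close>, which is exactly the recursion
  satisfied by the quadratic form of the covariance matrix.  The expansion is valid as long as finitely
  many empirical means are close to their limits; this fails with probability exponentially small in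
  \<open>N\<close>, which is negligible at speed \<open>b\<^sub>N\<^sup>2\<close>.  Convergence of all Laplace transforms to a finite
  quadratic form yields the moderate deviation principle, even if the form is degenerate.
\<close>

section \<open>Exponential rates and moderate deviations from quadratic Laplace limits\<close>

text \<open>On the good event the empirical means are within a fixed small constant of their limits,
  not within \<open>bN N / sqrt N\<close>. The remainder of the linearised ratio is therefore not
  small against the speed: it is a small multiple of the modulus of the linear term itself. Such a
  remainder amounts to a perturbation of the test function, and this dictates the form of the
  induction: the Laplace limit at time \<open>t\<close> is claimed for all families of bounded
  measurable functions at once, and the uniform bound in A-0 keeps \<open>L\<close> inside this
  class. A degenerate covariance rules out an argument through its inverse. The rate function is
  finite only on the range of \<open>S\<close>, and each point \<open>S l\<close> of that range is
  reached by tilting with \<open>l\<close>, so lower bounds are derived at such points only. Both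
  there and in the induction step the lower bound comes from cancellation: a quantity of known rate
  is split into the wanted part and parts of strictly smaller rate
  (\<open>rate_ge_cancel\<close>).\<close>

definition rate_le :: "(nat \<Rightarrow> real) \<Rightarrow> (nat \<Rightarrow> ennreal) \<Rightarrow> real \<Rightarrow> bool" where
  "rate_le s p c \<longleftrightarrow> (\<forall>e>0. \<forall>\<^sub>F N in sequentially. p N \<le> ennreal (exp (s N * (c + e))))"

text \<open>For \<open>s\<close> tending to infinity, \<open>rate_le\<close> and
  \<open>rate_ge\<close> bound the limsup from above and the liminf from below of
  \<open>ln (p N) / s N\<close>. The multiplicative form in \<open>ennreal\<close> needs no
  convention for the logarithm of 0 or \<infinity>, and sums and integrals can be compared
  directly.\<close>

definition rate_ge :: "(nat \<Rightarrow> real) \<Rightarrow> (nat \<Rightarrow> ennreal) \<Rightarrow> real \<Rightarrow> bool" where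
  "rate_ge s p c \<longleftrightarrow> (\<forall>e>0. \<forall>\<^sub>F N in sequentially. ennreal (exp (s N * (c - e))) \<le> p N)"

lemma rate_leD: "rate_le s p c \<Longrightarrow> e > 0 \<Longrightarrow> \<forall>\<^sub>F N in sequentially. p N \<le> ennreal (exp (s N * (c + e)))"
  by (simp add: rate_le_def)

lemma rate_geD: "rate_ge s p c \<Longrightarrow> e > 0 \<Longrightarrow> \<forall>\<^sub>F N in sequentially. ennreal (exp (s N * (c - e))) \<le> p N"
  by (simp add: rate_ge_def)

lemma eventually_speed_ge:
  assumes "filterlim s at_top sequentially" "(e::real) > 0"
  shows "\<forall>\<^sub>F N in sequentially. C \<le> s N * e"
proof -
  have "\<forall>\<^sub>F N in sequentially. C / e \<le> s N"
    using assms(1) by (simp add: filterlim_at_top)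
  then show ?thesis
    by eventually_elim (use assms(2) in \<open>simp add: field_simps\<close>)
qed

lemma two_exp_le:
  assumes "ln 2 \<le> s * (e::real)"
  shows "2 * exp (s * c) \<le> exp (s * (c + e))"
proof -
  have "2 = exp (ln (2::real))" by simp
  also have "\<dots> \<le> exp (s * e)" using assms by (simp only: exp_le_cancel_iff)
  finally have "2 \<le> exp (s * e)" .
  then show ?thesis by (simp add: distrib_left exp_add mult.commute)
qed

text \<open>The factor 2 costs \<open>ln 2\<close> in the exponent, which half of the slack
  \<open>e\<close> pays for as soon as \<open>s N * (e / 2)\<close> reaches
  \<open>ln 2\<close>.\<close>

lemma rate_le_add:
  assumes s: "filterlim s at_top sequentially" and p: "rate_le s p c" and q: "rate_le s q c"
  shows "rate_le s (\<lambda>N. p N + q N) c"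
  unfolding rate_le_def
proof (intro allI impI)
  fix e :: real assume "e > 0"
  then have "e/2 > 0" by simp
  show "\<forall>\<^sub>F N in sequentially. p N + q N \<le> ennreal (exp (s N * (c + e)))"
    using rate_leD[OF p \<open>e/2 > 0\<close>] rate_leD[OF q \<open>e/2 > 0\<close>] eventually_speed_ge[OF s \<open>e/2 > 0\<close>, of "ln 2"]
  proof eventually_elim
    case (elim N)
    have "p N + q N \<le> ennreal (exp (s N * (c + e/2))) + ennreal (exp (s N * (c + e/2)))"
      using elim by (intro add_mono)
    also have "\<dots> = ennreal (2 * exp (s N * (c + e/2)))"
      by (simp flip: ennreal_plus)
    also have "\<dots> \<le> ennreal (exp (s N * (c + e/2 + e/2)))"
      by (intro ennreal_leI two_exp_le elim)
    finally show ?case by (simp add: add.assoc)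
  qed
qed

lemma rate_le_mono:
  assumes s: "filterlim s at_top sequentially" and q: "rate_le s q c"
    and pq: "\<forall>\<^sub>F N in sequentially. p N \<le> q N" and "c \<le> d"
  shows "rate_le s p d"
  unfolding rate_le_def
proof (intro allI impI)
  fix e :: real assume "e > 0"
  have "\<forall>\<^sub>F N in sequentially. 0 \<le> s N" using s by (simp add: filterlim_at_top)
  then show "\<forall>\<^sub>F N in sequentially. p N \<le> ennreal (exp (s N * (d + e)))"
    using rate_leD[OF q \<open>e > 0\<close>] pq
  proof eventually_elim
    case (elim N)
    have "p N \<le> ennreal (exp (s N * (c + e)))" using elim by (meson order_trans)
    also have "\<dots> \<le> ennreal (exp (s N * (d + e)))"
      using elim(1) \<open>c \<le> d\<close> by (intro ennreal_leI) (simp add: mult_left_mono)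
    finally show ?case .
  qed
qed

lemma rate_ge_mono:
  assumes p: "rate_ge s p c" and pq: "\<forall>\<^sub>F N in sequentially. p N \<le> q N"
  shows "rate_ge s q c"
  unfolding rate_ge_def
proof (intro allI impI)
  fix e :: real assume "e > 0"
  from rate_geD[OF p this] pq show "\<forall>\<^sub>F N in sequentially. ennreal (exp (s N * (c - e))) \<le> q N"
    by eventually_elim (rule order_trans)
qed

lemma rate_ge_weaken:
  assumes s: "filterlim s at_top sequentially" and p: "rate_ge s p c" and "d \<le> c"
  shows "rate_ge s p d"
  unfolding rate_ge_def
proof (intro allI impI)
  fix e :: real assume "e > 0"
  from rate_geD[OF p this] eventually_speed_ge[OF s zero_less_one, of 0]
  show "\<forall>\<^sub>F N in sequentially. ennreal (exp (s N * (d - e))) \<le> p N"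
  proof eventually_elim
    case (elim N)
    have "exp (s N * (d - e)) \<le> exp (s N * (c - e))"
      using elim \<open>d \<le> c\<close> by (simp add: mult_left_mono)
    then show ?case using elim(1) by (meson ennreal_leI order_trans)
  qed
qed

lemma rate_le_sum:
  assumes s: "filterlim s at_top sequentially" and "finite J" and "\<And>j. j \<in> J \<Longrightarrow> rate_le s (p j) c"
  shows "rate_le s (\<lambda>N. \<Sum>j\<in>J. p j N) c"
  using assms(2,3)
proof (induction J rule: finite_induct)
  case empty
  then show ?case by (simp add: rate_le_def)
next
  case (insert x F)
  then show ?case by (simp add: rate_le_add[OF s])
qed

lemma rate_le_closed:
  assumes "\<And>e. e > 0 \<Longrightarrow> rate_le s p (c + e)"
  shows "rate_le s p c"
  unfolding rate_le_def
proof (intro allI impI)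
  fix e :: real assume "e > 0"
  then have "e/2 > 0" by simp
  from rate_leD[OF assms[OF this] this]
  show "\<forall>\<^sub>F N in sequentially. p N \<le> ennreal (exp (s N * (c + e)))" by (simp add: add.assoc)
qed

lemma rate_ge_closed:
  assumes "\<And>e. e > 0 \<Longrightarrow> rate_ge s p (c - e)"
  shows "rate_ge s p c"
  unfolding rate_ge_def
proof (intro allI impI)
  fix e :: real assume "e > 0"
  then have "e/2 > 0" by simp
  from rate_geD[OF assms[OF this] this]
  show "\<forall>\<^sub>F N in sequentially. ennreal (exp (s N * (c - e))) \<le> p N" by (simp add: algebra_simps)
qed

lemma rate_le_cmult:
  assumes "rate_le s p c"
  shows "rate_le s (\<lambda>N. ennreal (exp (s N * d)) * p N) (c + d)"
  unfolding rate_le_def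
proof (intro allI impI)
  fix e :: real assume "e > 0"
  from rate_leD[OF assms this]
  show "\<forall>\<^sub>F N in sequentially. ennreal (exp (s N * d)) * p N \<le> ennreal (exp (s N * (c + d + e)))"
  proof eventually_elim
    case (elim N)
    have "ennreal (exp (s N * d)) * p N \<le> ennreal (exp (s N * d)) * ennreal (exp (s N * (c + e)))"
      by (intro mult_left_mono elim) simp
    also have "\<dots> = ennreal (exp (s N * (c + d + e)))"
      by (simp add: algebra_simps flip: ennreal_mult exp_add)
    finally show ?case .
  qed
qed

lemma rate_ge_cmult:
  assumes "rate_ge s p c"
  shows "rate_ge s (\<lambda>N. ennreal (exp (s N * d)) * p N) (c + d)"
  unfolding rate_ge_def
proof (intro allI impI)
  fix e :: real assume "e > 0"
  from rate_geD[OF assms this]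
  show "\<forall>\<^sub>F N in sequentially. ennreal (exp (s N * (c + d - e))) \<le> ennreal (exp (s N * d)) * p N"
  proof eventually_elim
    case (elim N)
    have "ennreal (exp (s N * (c + d - e))) = ennreal (exp (s N * d)) * ennreal (exp (s N * (c - e)))"
      by (simp add: algebra_simps flip: ennreal_mult exp_add)
    also have "\<dots> \<le> ennreal (exp (s N * d)) * p N"
      by (intro mult_left_mono elim) simp
    finally show ?case .
  qed
qed

text \<open>If the claim failed at a large \<open>N\<close>, both summands would be at most
  \<open>exp (s N * (c - 2 * f))\<close>, and their sum would stay below
  \<open>exp (s N * (c - f))\<close>, against the rate of \<open>p\<close>. This turns upper bounds
  on an unwanted part into a lower bound on the wanted one.\<close>

lemma rate_ge_cancel:
  assumes s: "filterlim s at_top sequentially" and p: "rate_ge s p c"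
    and pqr: "\<forall>\<^sub>F N in sequentially. p N \<le> q N + r N" and r: "rate_le s r d" and "d < c"
  shows "rate_ge s q c"
  unfolding rate_ge_def
proof (intro allI impI)
  fix e :: real assume "e > 0"
  \<comment> \<open>One half of \<open>e\<close> turns a failure of the claim into an upper bound at
    level \<open>c - 2 * f\<close>; one quarter of the gap \<open>c - d\<close> puts
    \<open>r\<close> below the same level.\<close>
  define f where "f = min (e/2) ((c - d)/4)"
  have f: "f > 0" "2 * f \<le> e" "d + f \<le> c - 2 * f" "d \<le> c - 4 * f"
    using \<open>e > 0\<close> \<open>d < c\<close> unfolding f_def min_def by (auto simp: field_simps)
  show "\<forall>\<^sub>F N in sequentially. ennreal (exp (s N * (c - e))) \<le> q N"
    using rate_geD[OF p f(1)] rate_leD[OF r f(1)] pqr eventually_speed_ge[OF s f(1), of "ln 2 + 1"]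
      eventually_speed_ge[OF s zero_less_one, of 0]
  proof eventually_elim
    case (elim N)
    have sN: "s N \<ge> 0" using elim by simp
    show ?case
    proof (rule ccontr)
      assume "\<not> ?case"
      then have "q N \<le> ennreal (exp (s N * (c - e)))" by simp
      also have "\<dots> \<le> ennreal (exp (s N * (c - 2 * f)))"
        using f sN by (intro ennreal_leI) (simp add: mult_left_mono)
      finally have q: "q N \<le> ennreal (exp (s N * (c - 2 * f)))" .
      have "r N \<le> ennreal (exp (s N * (c - 2 * f)))"
        using elim(2) by (rule order_trans) (use f sN in \<open>simp add: mult_left_mono\<close>)
      then have "ennreal (exp (s N * (c - f))) \<le> ennreal (exp (s N * (c - 2 * f))) + ennreal (exp (s N * (c - 2 * f)))"
        using q elim by (meson add_mono order_trans)
      then have "exp (s N * (c - f)) \<le> 2 * exp (s N * (c - 2 * f))"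
        by (simp flip: ennreal_plus)
      \<comment> \<open>The extra 1 makes the comparison with the factor 2 strict, as the
        contradiction requires.\<close>
      also have "\<dots> < exp (ln 2 + 1) * exp (s N * (c - 2 * f))"
        by (simp add: exp_add)
      also have "\<dots> \<le> exp (s N * f) * exp (s N * (c - 2 * f))"
        using elim by simp
      also have "\<dots> = exp (s N * (c - f))"
        by (simp add: algebra_simps flip: exp_add)
      finally show False by simp
    qed
  qed
qed

lemma rate_le_limsup:
  assumes s: "filterlim s at_top sequentially" and r: "rate_le s (\<lambda>N. ennreal (p N)) c"
    and p0: "\<And>N. 0 \<le> p N"
  shows "limsup (\<lambda>N. scaled_log (s N) (p N)) \<le> ereal c"
proof (rule ereal_le_epsilon2)
  fix e :: real assume "e > 0"
  have "\<forall>\<^sub>F N in sequentially. 1 \<le> s N" using s by (simp add: filterlim_at_top)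
  then have "\<forall>\<^sub>F N in sequentially. scaled_log (s N) (p N) \<le> ereal c + ereal e"
    using rate_leD[OF r \<open>e > 0\<close>]
  proof eventually_elim
    case (elim N)
    show ?case
    proof (cases "p N = 0")
      case False
      with p0[of N] have "p N > 0" by simp
      have "p N \<le> exp (s N * (c + e))" using elim by simp
      then have "ln (p N) \<le> ln (exp (s N * (c + e)))" using \<open>p N > 0\<close> by (simp only: ln_le_cancel_iff exp_gt_zero)
      then have "ln (p N) \<le> s N * (c + e)" by simp
      then have "ln (p N) / s N \<le> c + e" using elim by (simp add: field_simps)
      then show ?thesis using False by (simp add: scaled_log_def)
    qed (simp add: scaled_log_def)
  qed
  then show "limsup (\<lambda>N. scaled_log (s N) (p N)) \<le> ereal c + ereal e"
    by (rule Limsup_bounded)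
qed

lemma rate_ge_liminf:
  assumes s: "filterlim s at_top sequentially" and r: "rate_ge s (\<lambda>N. ennreal (p N)) c"
  shows "ereal c \<le> liminf (\<lambda>N. scaled_log (s N) (p N))"
proof (rule ereal_le_epsilon2)
  fix e :: real assume "e > 0"
  have "\<forall>\<^sub>F N in sequentially. 1 \<le> s N" using s by (simp add: filterlim_at_top)
  then have "\<forall>\<^sub>F N in sequentially. ereal (c - e) \<le> scaled_log (s N) (p N)"
    using rate_geD[OF r \<open>e > 0\<close>]
  proof eventually_elim
    case (elim N)
    \<comment> \<open>The lower bound is a positive number, so \<open>scaled_log\<close> is not at
      its default value for probability 0.\<close>
    have "p N > 0" using elim(2)
      by (metis ennreal_eq_0_iff exp_gt_zero le_zero_eq linorder_not_le)
    then have "exp (s N * (c - e)) \<le> p N" using elim by simp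
    then have "s N * (c - e) \<le> ln (p N)" using \<open>p N > 0\<close> by (simp add: ln_ge_iff)
    then have "c - e \<le> ln (p N) / s N" using elim by (simp add: field_simps)
    then show ?case using \<open>p N > 0\<close> by (simp add: scaled_log_def)
  qed
  then have "ereal (c - e) \<le> liminf (\<lambda>N. scaled_log (s N) (p N))"
    by (rule Liminf_bounded)
  then have "ereal (c - e) + ereal e \<le> liminf (\<lambda>N. scaled_log (s N) (p N)) + ereal e"
    by (rule add_right_mono)
  then show "ereal c \<le> liminf (\<lambda>N. scaled_log (s N) (p N)) + ereal e" by simp
qed

section \<open>From Laplace limits with a quadratic form to the deviation principle\<close>

lemma bounded_coordinates:
  fixes A :: "'a::euclidean_space set" and B :: "'a \<Rightarrow> real"
  assumes "\<And>x i. x \<in> A \<Longrightarrow> i \<in> Basis \<Longrightarrow> \<bar>x \<bullet> i\<bar> \<le> B i"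
  shows "bounded A"
proof (rule bounded_subset[OF bounded_cbox])
  show "A \<subseteq> cbox (\<Sum>i\<in>Basis. - B i *\<^sub>R i) (\<Sum>i\<in>Basis. B i *\<^sub>R i)"
  proof
    fix x assume "x \<in> A"
    show "x \<in> cbox (\<Sum>i\<in>Basis. - B i *\<^sub>R i) (\<Sum>i\<in>Basis. B i *\<^sub>R i)"
      unfolding mem_box
    proof
      fix i :: 'a assume "i \<in> Basis"
      then show "(\<Sum>i\<in>Basis. - B i *\<^sub>R i) \<bullet> i \<le> x \<bullet> i \<and> x \<bullet> i \<le> (\<Sum>i\<in>Basis. B i *\<^sub>R i) \<bullet> i"
        using assms[OF \<open>x \<in> A\<close> \<open>i \<in> Basis\<close>] by (simp only: inner_sum_left_Basis) auto
    qed
  qed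
qed

text \<open>\<open>S\<close> plays the role of the limiting covariance operator and may be singular.
  All that is known asymptotically about the laws \<open>P N\<close> is that their scaled
  log-Laplace transforms converge to \<open>l \<bullet> S l / 2\<close> for every \<open>l\<close>.
  Total mass 1 is asked only for large \<open>N\<close>, since the particle system is analysed for
  \<open>N > 0\<close>.\<close>

locale quadratic_rate =
  fixes P :: "nat \<Rightarrow> 'a::euclidean_space measure" and s :: "nat \<Rightarrow> real" and S :: "'a \<Rightarrow> 'a"
  assumes sets_P: "\<And>N. sets (P N) = sets borel"
    and prob_P: "\<forall>\<^sub>F N in sequentially. prob_space (P N)"
    and s: "filterlim s at_top sequentially"
    and linear_S: "linear S"
    and sym_S: "\<And>x y. S x \<bullet> y = x \<bullet> S y"
    and laplace_le: "\<And>l. rate_le s (\<lambda>N. \<integral>\<^sup>+x. ennreal (exp (s N * (x \<bullet> l))) \<partial>P N) (l \<bullet> S l / 2)"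
    and laplace_ge: "\<And>l. rate_ge s (\<lambda>N. \<integral>\<^sup>+x. ennreal (exp (s N * (x \<bullet> l))) \<partial>P N) (l \<bullet> S l / 2)"
begin

definition rate_function :: "'a \<Rightarrow> ereal" where
  "rate_function x = (SUP l. ereal (x \<bullet> l - l \<bullet> S l / 2))"

lemma rate_function_ge: "ereal (x \<bullet> l - l \<bullet> S l / 2) \<le> rate_function x"
  unfolding rate_function_def by (rule SUP_upper) simp

text \<open>A supremum of affine functions of \<open>x\<close>: its sublevel sets are intersections
  of closed half-spaces.\<close>

lemma closed_sublevel: "closed {x. rate_function x \<le> ereal c}"
proof -
  have "{x. rate_function x \<le> ereal c} = (\<Inter>l. {x. x \<bullet> l - l \<bullet> S l / 2 \<le> c})"
    by (auto simp: rate_function_def SUP_le_iff)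
  also have "closed \<dots>"
    by (intro closed_INT ballI closed_Collect_le continuous_intros)
  finally show ?thesis .
qed

lemma S_minus: "S (- x) = - S x"
  using linear_S by (rule linear_neg)

text \<open>The choice \<open>l = 0\<close> gives nonnegativity. The choices \<open>l = i\<close>
  and \<open>l = - i\<close> for a basis vector \<open>i\<close> bound the corresponding coordinate
  on a sublevel set, which makes it bounded and hence compact.\<close>

lemma good_rate: "good_rate_function rate_function"
  unfolding good_rate_function_def
proof (intro conjI allI)
  fix x show "0 \<le> rate_function x" using rate_function_ge[of x 0] by (simp add: zero_ereal_def)
next
  fix c show "closed {x. rate_function x \<le> ereal c}" by (rule closed_sublevel)
next
  fix c
  have "bounded {x. rate_function x \<le> ereal c}"
  proof (rule bounded_coordinates)
    fix x i :: 'a assume x: "x \<in> {x. rate_function x \<le> ereal c}" and "i \<in> Basis"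
    from x have "ereal (x \<bullet> l - l \<bullet> S l / 2) \<le> ereal c" for l
      using rate_function_ge[of x l] order_trans by blast
    from this[of i] this[of "-i"] show "\<bar>x \<bullet> i\<bar> \<le> c + i \<bullet> S i / 2"
      by (simp add: S_minus)
  qed
  then show "compact {x. rate_function x \<le> ereal c}"
    using closed_sublevel by (simp add: compact_eq_bounded_closed)
qed

text \<open>Chernoff's bound on the half-spaces that make up the superlevel sets of \<^term>\<open>rate_function\<close>.\<close>

lemma half_space_upper:
  "rate_le s (\<lambda>N. emeasure (P N) {x. c \<le> x \<bullet> l - l \<bullet> S l / 2}) (- c)"
proof -
  have "rate_le s (\<lambda>N. ennreal (exp (s N * (- c - l \<bullet> S l / 2))) * (\<integral>\<^sup>+x. ennreal (exp (s N * (x \<bullet> l))) \<partial>P N))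
     (l \<bullet> S l / 2 + (- c - l \<bullet> S l / 2))"
    by (rule rate_le_cmult[OF laplace_le])
  moreover have "\<forall>\<^sub>F N in sequentially. emeasure (P N) {x. c \<le> x \<bullet> l - l \<bullet> S l / 2}
     \<le> ennreal (exp (s N * (- c - l \<bullet> S l / 2))) * (\<integral>\<^sup>+x. ennreal (exp (s N * (x \<bullet> l))) \<partial>P N)"
    using eventually_speed_ge[OF s zero_less_one, of 0]
  proof eventually_elim
    case (elim N)
    note [measurable_cong] = sets_P[of N]
    have [measurable]: "{x. c \<le> x \<bullet> l - l \<bullet> S l / 2} \<in> sets borel" by measurable
    have "emeasure (P N) {x. c \<le> x \<bullet> l - l \<bullet> S l / 2} =
        (\<integral>\<^sup>+x. indicator {x. c \<le> x \<bullet> l - l \<bullet> S l / 2} x \<partial>P N)"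
      by (subst nn_integral_indicator) (auto simp: sets_P)
    also have "\<dots> \<le> (\<integral>\<^sup>+x. ennreal (exp (s N * (- c - l \<bullet> S l / 2))) * ennreal (exp (s N * (x \<bullet> l))) \<partial>P N)"
    proof (rule nn_integral_mono)
      fix x
      show "indicator {x. c \<le> x \<bullet> l - l \<bullet> S l / 2} x \<le>
        ennreal (exp (s N * (- c - l \<bullet> S l / 2))) * ennreal (exp (s N * (x \<bullet> l)))"
      proof (cases "c \<le> x \<bullet> l - l \<bullet> S l / 2")
        case True
        have "0 \<le> s N * (x \<bullet> l - l \<bullet> S l / 2 - c)" using True elim by simp
        then have "1 \<le> ennreal (exp (s N * (x \<bullet> l - l \<bullet> S l / 2 - c)))" by simp
        then show ?thesis using True
          by (simp add: algebra_simps flip: ennreal_mult exp_add)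
      qed simp
    qed
    also have "\<dots> = ennreal (exp (s N * (- c - l \<bullet> S l / 2))) * (\<integral>\<^sup>+x. ennreal (exp (s N * (x \<bullet> l))) \<partial>P N)"
      by (rule nn_integral_cmult) measurable
    finally show ?case .
  qed
  ultimately show ?thesis by (rule rate_le_mono[OF s]) simp
qed

text \<open>Every point of \<open>F\<close> lies in a half-space on which some affine minorant of
  the rate exceeds \<open>c\<close>. Outside a box the half-spaces of the vectors \<open>i\<close>
  and \<open>- i\<close> with \<open>i\<close> in \<open>Basis\<close> suffice; inside it
  compactness leaves finitely many. A finite sum of Chernoff bounds keeps the rate.\<close>

lemma closed_upper:
  assumes F: "closed F" and c: "\<And>x. x \<in> F \<Longrightarrow> ereal c < rate_function x"
  shows "rate_le s (\<lambda>N. emeasure (P N) F) (- c)"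
proof -
  \<comment> \<open>The closed half-spaces \<open>H\<close> are those of Chernoff's bound; their
    open versions \<open>H'\<close> serve for the extraction of a finite cover.\<close>
  define H where "H l = {x. c \<le> x \<bullet> l - l \<bullet> S l / 2}" for l
  define H' where "H' l = {x. c < x \<bullet> l - l \<bullet> S l / 2}" for l
  have HH: "H' l \<subseteq> H l" for l by (auto simp: H_def H'_def)
  have oH: "open (H' l)" for l
    unfolding H'_def by (intro open_Collect_less continuous_intros)
  define K where "K = F \<inter> {x. \<forall>i\<in>Basis. \<bar>x \<bullet> i\<bar> \<le> c + i \<bullet> S i / 2}"
  have "closed (\<Inter>i\<in>Basis. {x::'a. \<bar>x \<bullet> i\<bar> \<le> c + i \<bullet> S i / 2})"
    by (intro closed_INT ballI closed_Collect_le continuous_intros)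
  also have "(\<Inter>i\<in>Basis. {x::'a. \<bar>x \<bullet> i\<bar> \<le> c + i \<bullet> S i / 2}) =
      {x. \<forall>i\<in>Basis. \<bar>x \<bullet> i\<bar> \<le> c + i \<bullet> S i / 2}" by blast
  finally have "closed {x::'a. \<forall>i\<in>Basis. \<bar>x \<bullet> i\<bar> \<le> c + i \<bullet> S i / 2}" .
  then have "closed K" unfolding K_def using F by blast
  moreover have "bounded K"
    by (rule bounded_coordinates[of _ "\<lambda>i. c + i \<bullet> S i / 2"]) (auto simp: K_def)
  ultimately have "compact K" by (simp add: compact_eq_bounded_closed)
  moreover have "K \<subseteq> (\<Union>l\<in>UNIV. H' l)"
  proof
    fix x assume "x \<in> K"
    then have "ereal c < rate_function x" using c by (simp add: K_def)
    then obtain l where "ereal c < ereal (x \<bullet> l - l \<bullet> S l / 2)"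
      unfolding rate_function_def less_SUP_iff by blast
    then show "x \<in> (\<Union>l\<in>UNIV. H' l)" by (auto simp: H'_def)
  qed
  ultimately obtain C where C: "finite C" "K \<subseteq> (\<Union>l\<in>C. H' l)"
    using oH by (meson compactE_image)
  define D where "D = C \<union> Basis \<union> uminus ` Basis"
  have "finite D" using C by (simp add: D_def)
  have FH: "F \<subseteq> (\<Union>l\<in>D. H l)"
  proof
    fix x assume "x \<in> F"
    show "x \<in> (\<Union>l\<in>D. H l)"
    proof (cases "x \<in> K")
      case True
      then show ?thesis using C HH by (force simp: D_def)
    next
      case False
      then obtain i where i: "i \<in> Basis" "\<bar>x \<bullet> i\<bar> > c + i \<bullet> S i / 2"
        using \<open>x \<in> F\<close> by (auto simp: K_def not_le)
      then have "x \<in> H i \<or> x \<in> H (- i)" by (auto simp: H_def S_minus)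
      then show ?thesis using i by (auto simp: D_def)
    qed
  qed
  have Hb: "H l \<in> sets (P N)" for l N
    unfolding sets_P H_def by measurable
  have sub: "emeasure (P N) F \<le> (\<Sum>l\<in>D. emeasure (P N) (H l))" for N
  proof -
    have "emeasure (P N) F \<le> emeasure (P N) (\<Union>l\<in>D. H l)"
      using FH Hb \<open>finite D\<close> by (intro emeasure_mono sets.finite_UN) auto
    also have "\<dots> \<le> (\<Sum>l\<in>D. emeasure (P N) (H l))"
      using Hb by (intro emeasure_subadditive_finite[OF \<open>finite D\<close>]) auto
    finally show ?thesis .
  qed
  have "rate_le s (\<lambda>N. \<Sum>l\<in>D. emeasure (P N) (H l)) (- c)"
    unfolding H_def by (intro rate_le_sum[OF s \<open>finite D\<close>] half_space_upper)
  then show ?thesis by (rule rate_le_mono[OF s]) (simp_all add: sub)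
qed

text \<open>Let \<open>z\<close> be the component of \<open>x\<close> orthogonal to the range of
  \<open>S\<close>. Along the multiples of \<open>z\<close> the quadratic term vanishes and the
  affine functions grow linearly with slope \<open>z \<bullet> z\<close>, so the supremum is
  infinite unless \<open>z = 0\<close>. This is what makes a degenerate covariance harmless:
  elsewhere the lower bound is trivial.\<close>

lemma rate_function_finite_range:
  assumes "rate_function x < \<infinity>"
  obtains l where "x = S l"
proof -
  have sub: "subspace (range S)" using linear_S by (simp add: linear_subspace_image)
  obtain w z where wz: "w \<in> span (range S)" "\<And>v. v \<in> span (range S) \<Longrightarrow> orthogonal z v" "x = w + z"
    using orthogonal_subspace_decomp_exists[of "range S" x] by blast
  have sp: "span (range S) = range S" using sub by (simp add: span_eq_iff)
  have zS: "z \<bullet> S v = 0" for v using wz(2)[of "S v"] sp by (auto simp: orthogonal_def)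
  have "x \<bullet> z = z \<bullet> z" using wz(2)[OF wz(1)] wz(3)
    by (simp add: inner_add_left inner_add_right orthogonal_def inner_commute)
  have "z = 0"
  proof (rule ccontr)
    assume "z \<noteq> 0"
    then have zz: "z \<bullet> z > 0" by simp
    have "ereal k \<le> rate_function x" for k :: real
    proof -
      have "S ((k / (z \<bullet> z)) *\<^sub>R z) = (k / (z \<bullet> z)) *\<^sub>R S z"
        using linear_S by (rule linear_scale)
      then show ?thesis
        using rate_function_ge[of x "(k / (z \<bullet> z)) *\<^sub>R z"] zz zS \<open>x \<bullet> z = z \<bullet> z\<close> by simp
    qed
    then have "rate_function x = \<infinity>" by (rule ereal_top)
    then show False using assms by simp
  qed
  then show ?thesis using wz sp that by auto
qed

text \<open>The exponential tilt by \<^term>\<open>l\<close> concentrates at \<^term>\<open>S l\<close>; no tilted measure is formed, since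
  the mass of the tilted integrand outside a box around \<^term>\<open>S l\<close> has a strictly smaller rate.\<close>

lemma open_lower:
  assumes G: "open G" and x: "S l \<in> G"
  shows "rate_ge s (\<lambda>N. emeasure (P N) G) (- (S l \<bullet> l - l \<bullet> S l / 2))"
proof (rule rate_ge_closed)
  fix e :: real assume "e > 0"
  define L where "L k = k \<bullet> S k / 2" for k
  define x where "x = S l"
  obtain r where r: "r > 0" "ball x r \<subseteq> G" using G x unfolding x_def openE by (meson openE)
  define n where "n = real DIM('a)"
  have n: "n > 0" by (simp add: n_def)
  \<comment> \<open>The box of half-width \<open>d\<close> around \<open>S l\<close> has to lie in
    the ball of radius \<open>r\<close>, which follows from \<open>n * d < r\<close>, and the tilt
    may vary on it by at most \<open>n * d * norm l \<le> e\<close>. The \<open>+ 1\<close> avoids a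
    division by zero for \<open>l = 0\<close>.\<close>
  define d where "d = min (r / (2 * n)) (e / (n * (norm l + 1)))"
  have d: "d > 0" using r n \<open>e > 0\<close> by (simp add: d_def add_nonneg_pos)
  have dr: "n * d < r"
  proof -
    have "d \<le> r / (2 * n)" by (simp add: d_def)
    then have "n * d \<le> r / 2" using n by (simp add: field_simps)
    then show ?thesis using r by simp
  qed
  have de: "n * d * norm l \<le> e"
  proof -
    have "d \<le> e / (n * (norm l + 1))" by (simp add: d_def)
    then have "n * d * (norm l + 1) \<le> e" using n 
      by (simp add: pos_le_divide_eq add_nonneg_pos mult.assoc mult.left_commute)
    moreover have "n * d * norm l \<le> n * d * (norm l + 1)" using n d by simp
    ultimately show ?thesis by linarith
  qed
  define E :: "'a set" where "E = Basis \<union> uminus ` Basis"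
  have "finite E" by (simp add: E_def)
  \<comment> \<open>Dominates \<open>v \<bullet> S v\<close> on all of \<open>E\<close>; the
    \<open>+ 1\<close> keeps it positive even if \<open>S\<close> vanishes.\<close>
  define m where "m = Max ((\<lambda>v. \<bar>v \<bullet> S v\<bar>) ` Basis) + 1"
  have mB: "v \<bullet> S v \<le> m" if "v \<in> E" for v
  proof -
    have *: "w \<bullet> S w \<le> m" if "w \<in> Basis" for w
    proof -
      have "\<bar>w \<bullet> S w\<bar> \<le> Max ((\<lambda>v. \<bar>v \<bullet> S v\<bar>) ` Basis)" using that by (intro Max_ge) auto
      then show ?thesis by (simp add: m_def)
    qed
    show ?thesis using that * by (auto simp: E_def S_minus)
  qed
  have m: "m > 0"
  proof -
    obtain w :: 'a where "w \<in> Basis" using nonempty_Basis by blast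
    then have "\<bar>w \<bullet> S w\<bar> \<le> Max ((\<lambda>v. \<bar>v \<bullet> S v\<bar>) ` Basis)" by (intro Max_ge) auto
    then show ?thesis by (simp add: m_def)
  qed
  \<comment> \<open>Tilting by \<open>l + t *\<^sub>R v\<close> instead of \<open>l\<close> gains
    \<open>t * d\<close> on \<open>A v\<close> and costs
    \<open>t * t * (v \<bullet> S v) / 2\<close>, plus a centring term that cancels. With this
    \<open>t\<close> the cost is at most \<open>t * d / 2\<close>, so half of the gain is
    left.\<close>
  define t where "t = d / m"
  have t: "t > 0" using d m by (simp add: t_def)
  define A where "A v = {y. d \<le> (y - x) \<bullet> v}" for v
  define W where "W N y = ennreal (exp (s N * (y \<bullet> l)))" for N y
  have Abor: "A v \<in> sets borel" for v unfolding A_def by measurable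
  have Wm: "W N \<in> borel_measurable borel" for N unfolding W_def by measurable
  have out: "rate_le s (\<lambda>N. \<integral>\<^sup>+y. W N y * indicator (A v) y \<partial>P N) (L l - t * d / 2)" if v: "v \<in> E" for v
  proof (rule rate_le_mono[OF s])
    show "rate_le s (\<lambda>N. ennreal (exp (s N * (- t * (d + x \<bullet> v)))) * (\<integral>\<^sup>+y. ennreal (exp (s N * (y \<bullet> (l + t *\<^sub>R v)))) \<partial>P N))
       (L (l + t *\<^sub>R v) + (- t * (d + x \<bullet> v)))"
      unfolding L_def by (rule rate_le_cmult[OF laplace_le])
    show "L (l + t *\<^sub>R v) + (- t * (d + x \<bullet> v)) \<le> L l - t * d / 2"
    proof -
      have "S (l + t *\<^sub>R v) = S l + t *\<^sub>R S v"
        using linear_S by (simp add: linear_add linear_scale)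
      then have "L (l + t *\<^sub>R v) = L l + t * (x \<bullet> v) + t * t * (v \<bullet> S v) / 2"
        using sym_S[of l v]
        by (simp add: L_def x_def inner_add_left inner_add_right inner_commute field_simps)
      moreover have "t * (t * (v \<bullet> S v)) \<le> t * d"
      proof -
        have "t * (v \<bullet> S v) \<le> t * m" using mB[OF v] t by simp
        also have "\<dots> = d" using m by (simp add: t_def)
        finally show ?thesis using t by simp
      qed
      ultimately show ?thesis by (simp add: algebra_simps)
    qed
    show "\<forall>\<^sub>F N in sequentially. (\<integral>\<^sup>+y. W N y * indicator (A v) y \<partial>P N) \<le>
       ennreal (exp (s N * (- t * (d + x \<bullet> v)))) * (\<integral>\<^sup>+y. ennreal (exp (s N * (y \<bullet> (l + t *\<^sub>R v)))) \<partial>P N)"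
      using eventually_speed_ge[OF s zero_less_one, of 0]
    proof eventually_elim
      case (elim N)
      note [measurable_cong] = sets_P[of N]
      have "(\<integral>\<^sup>+y. W N y * indicator (A v) y \<partial>P N) \<le>
         (\<integral>\<^sup>+y. ennreal (exp (s N * (- t * (d + x \<bullet> v)))) * ennreal (exp (s N * (y \<bullet> (l + t *\<^sub>R v)))) \<partial>P N)"
      proof (rule nn_integral_mono)
        fix y
        show "W N y * indicator (A v) y \<le> ennreal (exp (s N * (- t * (d + x \<bullet> v)))) * ennreal (exp (s N * (y \<bullet> (l + t *\<^sub>R v))))"
        proof (cases "y \<in> A v")
          case True
          then have "0 \<le> s N * (t * ((y - x) \<bullet> v - d))" using elim t by (simp add: A_def)
          then have "W N y \<le> ennreal (exp (s N * (y \<bullet> l) + s N * (t * ((y - x) \<bullet> v - d))))"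
            by (simp add: W_def)
          also have "s N * (y \<bullet> l) + s N * (t * ((y - x) \<bullet> v - d)) = s N * (- t * (d + x \<bullet> v)) + s N * (y \<bullet> (l + t *\<^sub>R v))"
            by (simp add: algebra_simps inner_simps)
          finally show ?thesis using True by (simp only: exp_add indicator_simps mult_1_right) (simp flip: ennreal_mult)
        qed simp
      qed
      also have "\<dots> = ennreal (exp (s N * (- t * (d + x \<bullet> v)))) * (\<integral>\<^sup>+y. ennreal (exp (s N * (y \<bullet> (l + t *\<^sub>R v)))) \<partial>P N)"
        by (rule nn_integral_cmult) measurable
      finally show ?case .
    qed
  qed
  \<comment> \<open>A point outside every \<open>A v\<close> has all coordinates within
    \<open>d\<close> of those of \<open>S l\<close>. It thus lies in \<open>G\<close>, and its
    weight is at most \<open>exp (s N * (x \<bullet> l + e))\<close>.\<close>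
  have *: "\<forall>\<^sub>F N in sequentially. (\<integral>\<^sup>+y. W N y \<partial>P N) \<le>
      ennreal (exp (s N * (x \<bullet> l + e))) * emeasure (P N) G + (\<Sum>v\<in>E. \<integral>\<^sup>+y. W N y * indicator (A v) y \<partial>P N)"
    using eventually_speed_ge[OF s zero_less_one, of 0]
  proof eventually_elim
    case (elim N)
    note [measurable_cong] = sets_P[of N]
    note Abor[measurable] Wm[measurable]
    have [measurable]: "G \<in> sets borel" using G by simp
    have "(\<integral>\<^sup>+y. W N y \<partial>P N) \<le> (\<integral>\<^sup>+y. ennreal (exp (s N * (x \<bullet> l + e))) * indicator G y + (\<Sum>v\<in>E. W N y * indicator (A v) y) \<partial>P N)"
    proof (rule nn_integral_mono)
      fix y
      show "W N y \<le> ennreal (exp (s N * (x \<bullet> l + e))) * indicator G y + (\<Sum>v\<in>E. W N y * indicator (A v) y)"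
      proof (cases "\<exists>v\<in>E. y \<in> A v")
        case True
        then obtain v where v: "v \<in> E" "y \<in> A v" by blast
        have "W N y = W N y * indicator (A v) y" using v by simp
        also have "\<dots> \<le> (\<Sum>v\<in>E. W N y * indicator (A v) y)"
          using v \<open>finite E\<close> by (intro member_le_sum) auto
        finally show ?thesis by (simp add: add_increasing)
      next
        case False
        have "\<bar>(y - x) \<bullet> i\<bar> \<le> d" if "i \<in> Basis" for i
        proof -
          have "y \<notin> A i" "y \<notin> A (- i)" using False that by (auto simp: E_def)
          then show ?thesis by (auto simp: A_def)
        qed
        then have "(\<Sum>i\<in>Basis. \<bar>(y - x) \<bullet> i\<bar>) \<le> (\<Sum>i\<in>(Basis::'a set). d)" by (intro sum_mono)
        then have nd: "norm (y - x) \<le> n * d"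
          using norm_le_l1[of "y - x"] by (simp add: n_def)
        then have "y \<in> G" using r dr by (auto simp: dist_norm norm_minus_commute)
        have "(y - x) \<bullet> l \<le> norm (y - x) * norm l" by (rule norm_cauchy_schwarz)
        also have "\<dots> \<le> n * d * norm l" using nd by (rule mult_right_mono) simp
        also have "\<dots> \<le> e" by (rule de)
        finally have "y \<bullet> l \<le> x \<bullet> l + e" by (simp add: inner_diff_left)
        then have "W N y \<le> ennreal (exp (s N * (x \<bullet> l + e)))"
          unfolding W_def using elim by (intro ennreal_leI) (simp add: mult_left_mono)
        then show ?thesis using \<open>y \<in> G\<close> by (simp add: add_increasing2)
      qed
    qed
    also have "\<dots> = (\<integral>\<^sup>+y. ennreal (exp (s N * (x \<bullet> l + e))) * indicator G y \<partial>P N) + (\<integral>\<^sup>+y. (\<Sum>v\<in>E. W N y * indicator (A v) y) \<partial>P N)"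
      by (rule nn_integral_add) measurable
    also have "(\<integral>\<^sup>+y. ennreal (exp (s N * (x \<bullet> l + e))) * indicator G y \<partial>P N) = ennreal (exp (s N * (x \<bullet> l + e))) * emeasure (P N) G"
      by (rule nn_integral_cmult_indicator) (simp add: sets_P)
    also have "(\<integral>\<^sup>+y. (\<Sum>v\<in>E. W N y * indicator (A v) y) \<partial>P N) = (\<Sum>v\<in>E. \<integral>\<^sup>+y. W N y * indicator (A v) y \<partial>P N)"
      by (rule nn_integral_sum) measurable
    finally show ?case .
  qed
  have "rate_ge s (\<lambda>N. ennreal (exp (s N * (x \<bullet> l + e))) * emeasure (P N) G) (L l)"
  proof (rule rate_ge_cancel[OF s _ *])
    show "rate_ge s (\<lambda>N. \<integral>\<^sup>+y. W N y \<partial>P N) (L l)" unfolding W_def L_def by (rule laplace_ge)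
    show "rate_le s (\<lambda>N. \<Sum>v\<in>E. \<integral>\<^sup>+y. W N y * indicator (A v) y \<partial>P N) (L l - t * d / 2)"
      by (intro rate_le_sum[OF s \<open>finite E\<close>] out)
    show "L l - t * d / 2 < L l" using t d by simp
  qed
  from rate_ge_cmult[OF this, of "- (x \<bullet> l + e)"]
  have "rate_ge s (\<lambda>N. ennreal (exp (s N * - (x \<bullet> l + e))) * (ennreal (exp (s N * (x \<bullet> l + e))) * emeasure (P N) G)) (L l - (x \<bullet> l + e))"
    by (simp only: add_uminus_conv_diff)
  also have "(\<lambda>N. ennreal (exp (s N * - (x \<bullet> l + e))) * (ennreal (exp (s N * (x \<bullet> l + e))) * emeasure (P N) G)) = (\<lambda>N. emeasure (P N) G)"
    by (simp add: mult.assoc[symmetric] flip: ennreal_mult exp_add distrib_left)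
  finally show "rate_ge s (\<lambda>N. emeasure (P N) G) (- (S l \<bullet> l - l \<bullet> S l / 2) - e)"
    by (simp add: L_def x_def algebra_simps)
qed

text \<open>Lower bound: a point of finite rate is \<open>S l\<close> for some \<open>l\<close>, and
  the exponent obtained by tilting with \<open>l\<close> is one member of the supremum that defines
  the rate. Upper bound: every real \<open>c\<close> below the infimum is tested, which also covers
  an infinite infimum.\<close>

theorem deviation_principle:
  assumes [measurable]: "\<Gamma> \<in> sets borel"
  shows "- (INF x\<in>interior \<Gamma>. rate_function x) \<le> liminf (\<lambda>N. scaled_log (s N) (measure (P N) \<Gamma>))" (is ?lower)
    and "limsup (\<lambda>N. scaled_log (s N) (measure (P N) \<Gamma>)) \<le> - (INF x\<in>closure \<Gamma>. rate_function x)" (is ?upper)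
proof -
  have em: "\<forall>\<^sub>F N in sequentially. emeasure (P N) \<Gamma> = ennreal (measure (P N) \<Gamma>)"
    using prob_P
  proof eventually_elim
    case (elim N)
    interpret prob_space "P N" by fact
    show ?case by (rule emeasure_eq_measure)
  qed
  show ?lower
  proof -
    have "- liminf (\<lambda>N. scaled_log (s N) (measure (P N) \<Gamma>)) \<le> (INF x\<in>interior \<Gamma>. rate_function x)"
    proof (rule INF_greatest)
      fix x assume x: "x \<in> interior \<Gamma>"
      show "- liminf (\<lambda>N. scaled_log (s N) (measure (P N) \<Gamma>)) \<le> rate_function x"
      proof (cases "rate_function x < \<infinity>")
        case True
        then obtain l where l: "x = S l" using rate_function_finite_range by blast
        have "rate_ge s (\<lambda>N. emeasure (P N) (interior \<Gamma>)) (- (S l \<bullet> l - l \<bullet> S l / 2))"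
          using x l by (intro open_lower) auto
        moreover have "\<forall>\<^sub>F N in sequentially. emeasure (P N) (interior \<Gamma>) \<le> ennreal (measure (P N) \<Gamma>)"
          using em
        proof eventually_elim
          case (elim N)
          have "emeasure (P N) (interior \<Gamma>) \<le> emeasure (P N) \<Gamma>"
            by (rule emeasure_mono) (auto simp: sets_P interior_subset)
          with elim show ?case by simp
        qed
        ultimately have "rate_ge s (\<lambda>N. ennreal (measure (P N) \<Gamma>)) (- (S l \<bullet> l - l \<bullet> S l / 2))"
          by (rule rate_ge_mono)
        from rate_ge_liminf[OF s this] have "- liminf (\<lambda>N. scaled_log (s N) (measure (P N) \<Gamma>)) \<le> ereal (x \<bullet> l - l \<bullet> S l / 2)"
          unfolding l by (subst ereal_uminus_le_reorder) simp
        also have "\<dots> \<le> rate_function x" by (rule rate_function_ge)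
        finally show ?thesis .
      qed auto
    qed
    then show ?thesis by (subst ereal_uminus_le_reorder)
  qed
  show ?upper
  proof -
    have "(INF x\<in>closure \<Gamma>. rate_function x) \<le> - limsup (\<lambda>N. scaled_log (s N) (measure (P N) \<Gamma>))"
    proof (rule dense_le)
      fix z assume z: "z < (INF x\<in>closure \<Gamma>. rate_function x)"
      show "z \<le> - limsup (\<lambda>N. scaled_log (s N) (measure (P N) \<Gamma>))"
      proof (cases z)
        case (real c)
        have "rate_le s (\<lambda>N. emeasure (P N) (closure \<Gamma>)) (- c)"
          using z real by (intro closed_upper) (auto dest: less_INF_D)
        moreover have "\<forall>\<^sub>F N in sequentially. ennreal (measure (P N) \<Gamma>) \<le> emeasure (P N) (closure \<Gamma>)"
          using em
        proof eventually_elim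
          case (elim N)
          have "emeasure (P N) \<Gamma> \<le> emeasure (P N) (closure \<Gamma>)"
            by (rule emeasure_mono) (auto simp: sets_P closure_subset)
          with elim show ?case by simp
        qed
        ultimately have "rate_le s (\<lambda>N. ennreal (measure (P N) \<Gamma>)) (- c)"
          by (rule rate_le_mono[OF s]) simp
        from rate_le_limsup[OF s this]
        have "limsup (\<lambda>N. scaled_log (s N) (measure (P N) \<Gamma>)) \<le> ereal (- c)" by simp
        then have "- ereal (- c) \<le> - limsup (\<lambda>N. scaled_log (s N) (measure (P N) \<Gamma>))"
          by (simp only: ereal_minus_le_minus)
        then show ?thesis unfolding real by simp
      qed (use z in auto)
    qed
    then have "- (- limsup (\<lambda>N. scaled_log (s N) (measure (P N) \<Gamma>))) \<le> - (INF x\<in>closure \<Gamma>. rate_function x)"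
      by (simp only: ereal_minus_le_minus)
    then show ?thesis by simp
  qed
qed

end

section \<open>The filter recursion and the limiting covariance\<close>

definition bounded_measurable :: "('a::topological_space \<Rightarrow> real) \<Rightarrow> bool" where
  "bounded_measurable f \<longleftrightarrow> f \<in> borel_measurable borel \<and> bounded (range f)"

lemma bounded_measurableI:
  assumes "f \<in> borel_measurable borel" "\<And>x. \<bar>f x\<bar> \<le> C"
  shows "bounded_measurable f"
  using assms by (auto simp: bounded_measurable_def bounded_iff)

lemma bounded_measurableD:
  assumes "bounded_measurable f"
  shows "f \<in> borel_measurable borel"
  using assms by (simp add: bounded_measurable_def)

lemma bounded_measurableE:
  assumes "bounded_measurable f"
  obtains C where "C > 0" "\<And>x. \<bar>f x\<bar> \<le> C"
proof -
  from assms obtain B where B: "\<And>x. \<bar>f x\<bar> \<le> B" by (auto simp: bounded_measurable_def bounded_iff)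
  have "0 \<le> B" using B[of undefined] by linarith
  then show ?thesis using B by (intro that[of "B + 1"]) (auto intro: add_increasing2)
qed

lemma bounded_measurable_const [simp]: "bounded_measurable (\<lambda>_. c)"
  by (simp add: bounded_measurable_def)

lemma bounded_measurable_add:
  assumes "bounded_measurable f" "bounded_measurable g"
  shows "bounded_measurable (\<lambda>x. f x + g x)"
proof -
  note [measurable] = assms[THEN bounded_measurableD]
  obtain C D where "\<And>x. \<bar>f x\<bar> \<le> C" "\<And>x. \<bar>g x\<bar> \<le> D" using assms by (metis bounded_measurableE)
  then have "\<bar>f x + g x\<bar> \<le> C + D" for x by (intro order_trans[OF abs_triangle_ineq] add_mono)
  then show ?thesis by (intro bounded_measurableI[where C = "C + D"]) measurable
qed

lemma bounded_measurable_mult: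
  assumes "bounded_measurable f" "bounded_measurable g"
  shows "bounded_measurable (\<lambda>x. f x * g x)"
proof -
  note [measurable] = assms[THEN bounded_measurableD]
  obtain C D where "C > 0" "\<And>x. \<bar>f x\<bar> \<le> C" "\<And>x. \<bar>g x\<bar> \<le> D" using assms by (metis bounded_measurableE)
  then have "\<bar>f x * g x\<bar> \<le> C * D" for x unfolding abs_mult by (intro mult_mono) (auto intro: less_imp_le)
  then show ?thesis by (intro bounded_measurableI[where C = "C * D"]) measurable
qed

lemma bounded_measurable_diff:
  assumes "bounded_measurable f" "bounded_measurable g"
  shows "bounded_measurable (\<lambda>x. f x - g x)"
  using bounded_measurable_add[OF assms(1) bounded_measurable_mult[OF bounded_measurable_const[of "-1"] assms(2)]]
  by simp

lemma bounded_measurable_exp: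
  assumes "bounded_measurable f"
  shows "bounded_measurable (\<lambda>x. exp (f x))"
proof -
  note [measurable] = assms[THEN bounded_measurableD]
  obtain C where "\<And>x. \<bar>f x\<bar> \<le> C" using assms by (metis bounded_measurableE)
  then have "\<bar>exp (f x)\<bar> \<le> exp C" for x using abs_le_D1 by auto
  then show ?thesis by (intro bounded_measurableI[where C = "exp C"]) measurable
qed

lemma bounded_measurable_power:
  assumes "bounded_measurable f"
  shows "bounded_measurable (\<lambda>x. f x ^ n)"
  by (induction n) (simp_all add: bounded_measurable_mult assms)

lemmas bounded_measurable_intros =
  bounded_measurable_const bounded_measurable_add bounded_measurable_mult bounded_measurable_diff
  bounded_measurable_exp bounded_measurable_power

lemma integrable_density_mult:
  assumes "integrable M f" "sets M = sets borel" "bounded_measurable g"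
  shows "integrable M (\<lambda>x. g x * f x :: real)"
proof -
  note [measurable_cong] = assms(2)
  note [measurable] = bounded_measurableD[OF assms(3)] borel_measurable_integrable[OF assms(1)]
  obtain C where "C > 0" "\<And>x. \<bar>g x\<bar> \<le> C" using assms(3) by (metis bounded_measurableE)
  then have "norm (g x * f x) \<le> norm (C * f x)" for x
    by (simp add: abs_mult mult_right_mono)
  then show ?thesis
    by (intro Bochner_Integration.integrable_bound[OF integrable_mult_right[OF assms(1), of C]]) auto
qed

section \<open>The operators \<open>L\<close> and the filter densities\<close>

locale hidden_markov_filter =
  fixes mu :: "(real^'d) measure" and nu :: "(real^'m) measure"
    and a0 :: "real^'d \<Rightarrow> real"
    and a :: "nat \<Rightarrow> real^'d \<Rightarrow> real^'d \<Rightarrow> real"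
    and b :: "nat \<Rightarrow> real^'d \<Rightarrow> real^'m \<Rightarrow> real"
    and y :: "nat \<Rightarrow> real^'m"
    and T :: nat
  assumes model: "hmm_model mu nu a0 a b"
    and A0: "assumption_A0 mu a b y T"
begin

abbreviation L where "L t \<equiv> Lop mu a b y t"
abbreviation m where "m t \<equiv> mt mu a0 a b y t"
abbreviation f where "f t \<equiv> filt mu a0 a b y t"
abbreviation \<kappa> where "\<kappa> t \<equiv> kappa mu a0 a b y t"

lemma sets_mu [measurable_cong]: "sets mu = sets borel"
  using model by (simp add: hmm_model_def)

lemma space_mu [simp]: "space mu = UNIV"
  using sets_eq_imp_space_eq[OF sets_mu] by simp

sublocale mu: sigma_finite_measure mu
  using model by (simp add: hmm_model_def)

sublocale mu2: pair_sigma_finite mu mu ..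

lemma a_meas: "t \<ge> 1 \<Longrightarrow> (\<lambda>(x, x'). a t x x') \<in> borel_measurable (borel \<Otimes>\<^sub>M borel)"
  using model by (simp add: hmm_model_def borel_prod)

lemma b_meas:
  assumes "t \<ge> 1"
  shows "(\<lambda>x. b t x w) \<in> borel_measurable borel"
proof -
  have [measurable]: "(\<lambda>(x, w). b t x w) \<in> borel_measurable (borel \<Otimes>\<^sub>M borel)"
    using model assms by (simp add: hmm_model_def borel_prod)
  have "(\<lambda>x. case_prod (b t) (x, w)) \<in> borel_measurable borel" by measurable
  then show ?thesis by simp
qed

lemma a_nonneg: "t \<ge> 1 \<Longrightarrow> 0 \<le> a t x x'"
  using model by (simp add: hmm_model_def)

lemma b_nonneg: "t \<ge> 1 \<Longrightarrow> 0 \<le> b t x w"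
  using model by (simp add: hmm_model_def)

definition w where "w t x u = a t x u * b t u (y t)"

lemma w_nonneg: "t \<ge> 1 \<Longrightarrow> 0 \<le> w t x u"
  by (simp add: w_def a_nonneg b_nonneg)

lemma w_meas:
  assumes "t \<ge> 1"
  shows "(\<lambda>(x, u). w t x u) \<in> borel_measurable (borel \<Otimes>\<^sub>M borel)"
proof -
  note [measurable] = a_meas[OF assms] b_meas[OF assms]
  show ?thesis unfolding w_def by measurable
qed

lemma w_meas2:
  assumes "t \<ge> 1"
  shows "w t x \<in> borel_measurable borel"
proof -
  note [measurable] = w_meas[OF assms]
  have "(\<lambda>u. case_prod (w t) (x, u)) \<in> borel_measurable borel" by measurable
  then show ?thesis by simp
qed

lemma w_bound:
  assumes "t \<in> {1..T}"
  obtains C where "C > 0" "\<And>x. (\<integral>\<^sup>+u. ennreal (w t x u) \<partial>mu) \<le> ennreal C"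
proof -
  obtain C where C: "\<And>x. (\<integral>\<^sup>+u. ennreal (w t x u) \<partial>mu) \<le> ennreal C"
    using A0 assms unfolding assumption_A0_def w_def by blast
  have "(\<integral>\<^sup>+u. ennreal (w t x u) \<partial>mu) \<le> ennreal (max C 1)" for x
    using C[of x] by (rule order_trans) simp
  then show ?thesis by (intro that[of "max C 1"]) auto
qed

lemma w_pos: "t \<in> {1..T} \<Longrightarrow> 0 < (\<integral>\<^sup>+u. ennreal (w t x u) \<partial>mu)"
  using A0 unfolding assumption_A0_def w_def by blast

lemma w_integrable:
  assumes "t \<in> {1..T}"
  shows "integrable mu (w t x)"
proof (rule integrableI_nonneg)
  obtain C where "(\<integral>\<^sup>+u. ennreal (w t x u) \<partial>mu) \<le> ennreal C"
    using w_bound[OF assms] by metis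
  then show "(\<integral>\<^sup>+u. ennreal (w t x u) \<partial>mu) < \<infinity>"
    using ennreal_less_top order_le_less_trans by fastforce
qed (use assms w_nonneg w_meas2 in \<open>auto simp: measurable_cong_sets[OF sets_mu refl]\<close>)

lemma L_eq: "L t \<psi> x = (\<integral>u. \<psi> u * w t x u \<partial>mu)"
  by (simp add: Lop_def w_def mult_ac)

lemma w_mult_integrable:
  assumes "t \<in> {1..T}" "bounded_measurable \<psi>"
  shows "integrable mu (\<lambda>u. \<psi> u * w t x u)"
  using integrable_density_mult[OF w_integrable[OF assms(1)] sets_mu assms(2)] .

lemma L_nn_integral:
  assumes "t \<in> {1..T}" "bounded_measurable \<psi>" "\<And>u. 0 \<le> \<psi> u"
  shows "(\<integral>\<^sup>+u. ennreal (\<psi> u * w t x u) \<partial>mu) = ennreal (L t \<psi> x)"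
  unfolding L_eq using assms w_nonneg
  by (intro nn_integral_eq_integral w_mult_integrable) auto

lemma L_add:
  assumes "t \<in> {1..T}" "bounded_measurable \<psi>" "bounded_measurable \<phi>"
  shows "L t (\<lambda>u. \<psi> u + \<phi> u) x = L t \<psi> x + L t \<phi> x"
  unfolding L_eq using assms by (simp add: distrib_right w_mult_integrable)

lemma L_diff:
  assumes "t \<in> {1..T}" "bounded_measurable \<psi>" "bounded_measurable \<phi>"
  shows "L t (\<lambda>u. \<psi> u - \<phi> u) x = L t \<psi> x - L t \<phi> x"
  unfolding L_eq using assms by (simp add: left_diff_distrib w_mult_integrable)

lemma L_cmult: "L t (\<lambda>u. c * \<psi> u) x = c * L t \<psi> x"
  unfolding L_eq by (simp add: mult.assoc)

lemma L_const: "L t (\<lambda>u. c) x = c * L t (\<lambda>_. 1) x"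
  using L_cmult[of t c "\<lambda>_. 1"] by simp

lemma L_mono:
  assumes "t \<in> {1..T}" "bounded_measurable \<psi>" "bounded_measurable \<phi>" "\<And>u. \<psi> u \<le> \<phi> u"
  shows "L t \<psi> x \<le> L t \<phi> x"
  unfolding L_eq using assms w_nonneg
  by (intro integral_mono w_mult_integrable mult_right_mono) auto

lemma L1_pos:
  assumes "t \<in> {1..T}"
  shows "0 < L t (\<lambda>_. 1) x"
  using w_pos[OF assms, of x] L_nn_integral[OF assms, of "\<lambda>_. 1" x] by simp

text \<open>If \<psi> is bounded by \<open>D\<close>, positivity of the kernel gives the bound
  \<open>D * L t (\<lambda>_. 1) x\<close>, and A-0 bounds the second factor uniformly in
  \<open>x\<close>. Hence neither the covariance recursion nor the induction over time ever leaves
  the bounded measurable functions.\<close>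

lemma L_bounded_measurable:
  assumes t: "t \<in> {1..T}" and \<psi>: "bounded_measurable \<psi>"
  shows "bounded_measurable (L t \<psi>)"
proof -
  note [measurable] = bounded_measurableD[OF \<psi>]
  from t have [measurable]: "(\<lambda>(x, u). w t x u) \<in> borel_measurable (borel \<Otimes>\<^sub>M borel)"
    by (intro w_meas) simp
  have m: "L t \<psi> \<in> borel_measurable borel"
    unfolding L_eq by measurable
  obtain D where D: "\<And>u. \<bar>\<psi> u\<bar> \<le> D" "D > 0" using \<psi> by (metis bounded_measurableE)
  obtain C where C: "C > 0" "\<And>x. (\<integral>\<^sup>+u. ennreal (w t x u) \<partial>mu) \<le> ennreal C"
    using w_bound[OF t] by metis
  have "L t (\<lambda>_. 1) x \<le> C" for x
    using C(2)[of x] C(1) L_nn_integral[OF t, of "\<lambda>_. 1" x] by simp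
  then have DC: "D * L t (\<lambda>_. 1) x \<le> D * C" for x using D by simp
  have "L t \<psi> x \<le> D * C" for x
    using L_mono[OF t \<psi> bounded_measurable_const[of D], of x] D(1) DC[of x]
    by (simp add: L_const[of t D]) (meson abs_le_D1 order_trans)
  moreover have "- (D * C) \<le> L t \<psi> x" for x
    using L_mono[OF t bounded_measurable_const[of "-D"] \<psi>, of x] D(1) DC[of x]
    by (simp add: L_const[of t "-D"]) (smt (verit))
  ultimately show ?thesis by (intro bounded_measurableI[OF m, of "D * C"]) (smt (verit))
qed

text \<open>
  The inner integral in \<open>p\<close> may diverge on a null set of points \<open>x\<close>, where it is 0 by convention.
\<close>

lemma filter_step:
  assumes "Suc t \<le> T" and f_meas: "f t \<in> borel_measurable borel" and f_nonneg: "\<And>x. 0 \<le> f t x"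
    and f_int: "integrable mu (f t)" and p_def: "p = (\<lambda>x. b (Suc t) x (y (Suc t)) * (\<integral>u. f t u * a (Suc t) u x \<partial>mu))"
    and \<psi>: "bounded_measurable \<psi>"
  shows "integrable mu (\<lambda>x. \<psi> x * p x)" "(\<integral>x. \<psi> x * p x \<partial>mu) = m t (L (Suc t) \<psi>)"
proof -
  have t: "Suc t \<in> {1..T}" using assms by simp
  have [measurable]: "(\<lambda>(x, u). w (Suc t) x u) \<in> borel_measurable (borel \<Otimes>\<^sub>M borel)"
    by (intro w_meas) simp
  note [measurable] = f_meas bounded_measurableD[OF \<psi>]
  define h where "h = (\<lambda>u x. f t u * (\<psi> x * w (Suc t) u x))"
  have eq: "(\<integral>u. h u x \<partial>mu) = \<psi> x * p x" for x
  proof -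
    have "h u x = (\<psi> x * b (Suc t) x (y (Suc t))) * (f t u * a (Suc t) u x)" for u
      by (simp add: h_def w_def mult_ac)
    then show ?thesis by (simp add: p_def mult.assoc)
  qed
  have abs: "bounded_measurable (\<lambda>x. \<bar>\<psi> x\<bar>)"
    using \<psi> by (auto simp: bounded_measurable_def bounded_iff)
  \<comment> \<open>The integral of the modulus of \<open>h\<close> over \<open>x\<close> is
    \<open>L\<close> of the modulus of \<psi>, a bounded function, times the density
    \<open>f t\<close>; so Fubini's theorem applies.\<close>
  have int: "integrable (mu \<Otimes>\<^sub>M mu) (\<lambda>(u, x). h u x)"
  proof (rule mu2.Fubini_integrable)
    show "(\<lambda>(u, x). h u x) \<in> borel_measurable (mu \<Otimes>\<^sub>M mu)" unfolding h_def by measurable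
    have "(\<integral>x. norm (h u x) \<partial>mu) = L (Suc t) (\<lambda>x. \<bar>\<psi> x\<bar>) u * f t u" for u
    proof -
      have "norm (h u x) = f t u * (\<bar>\<psi> x\<bar> * w (Suc t) u x)" for x
        using f_nonneg w_nonneg[of "Suc t"] by (simp add: h_def abs_mult)
      then show ?thesis by (simp add: L_eq mult.commute)
    qed
    then show "integrable mu (\<lambda>u. \<integral>x. norm (case (u, x) of (u, x) \<Rightarrow> h u x) \<partial>mu)"
      using integrable_density_mult[OF f_int sets_mu L_bounded_measurable[OF t abs]] by simp
    show "AE u in mu. integrable mu (\<lambda>x. case (u, x) of (u, x) \<Rightarrow> h u x)"
      unfolding h_def using w_mult_integrable[OF t \<psi>] by simp
  qed
  show "integrable mu (\<lambda>x. \<psi> x * p x)"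
    using mu2.integrable_snd[OF int] by (simp add: eq)
  have "(\<integral>x. \<psi> x * p x \<partial>mu) = (\<integral>u. (\<integral>x. h u x \<partial>mu) \<partial>mu)"
    using mu2.Fubini_integral[OF int] by (simp add: eq)
  also have "\<dots> = m t (L (Suc t) \<psi>)"
    by (simp add: h_def mt_def L_eq mult.commute)
  finally show "(\<integral>x. \<psi> x * p x \<partial>mu) = m t (L (Suc t) \<psi>)" .
qed

text \<open>If the integral vanished, \<open>g * h\<close> and hence \<open>h\<close> would be 0
  almost everywhere, against total mass 1.\<close>

lemma integral_pos_density:
  assumes g: "bounded_measurable g" "\<And>x. 0 < g x"
    and h: "integrable mu h" "\<And>x. 0 \<le> h x" "(\<integral>x. h x \<partial>mu) = 1"
  shows "0 < (\<integral>x. g x * h x \<partial>mu)"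
proof -
  have int: "integrable mu (\<lambda>x. g x * h x)" using integrable_density_mult[OF h(1) sets_mu g(1)] .
  have "(\<integral>x. g x * h x \<partial>mu) \<noteq> 0"
  proof
    assume "(\<integral>x. g x * h x \<partial>mu) = 0"
    then have "AE x in mu. g x * h x = 0"
      using int g h by (subst (asm) integral_nonneg_eq_0_iff_AE) (auto intro!: AE_I2 mult_nonneg_nonneg intro: less_imp_le)
    then have "AE x in mu. h x = 0" using g(2) by (auto simp: less_imp_neq[symmetric])
    then have "(\<integral>x. h x \<partial>mu) = 0" by (simp add: integral_eq_zero_AE)
    then show False using h by simp
  qed
  moreover have "0 \<le> (\<integral>x. g x * h x \<partial>mu)" using g h by (intro Bochner_Integration.integral_nonneg mult_nonneg_nonneg) (auto intro: less_imp_le)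
  ultimately show ?thesis by simp
qed

text \<open>By \<open>filter_step\<close> the normaliser at time \<open>Suc t\<close> is the mean of
  \<open>L (Suc t) (\<lambda>_. 1)\<close> under \<open>f t\<close>. A-0 makes this function
  positive everywhere, so the division in \<open>filt\<close> is never by 0.\<close>

lemma filter_density:
  assumes "t \<le> T"
  shows "f t \<in> borel_measurable borel \<and> (\<forall>x. 0 \<le> f t x) \<and> integrable mu (f t) \<and> (\<integral>x. f t x \<partial>mu) = 1"
  using assms
proof (induction t)
  case 0
  have a0: "a0 \<in> borel_measurable borel" "\<forall>x. 0 \<le> a0 x" "(\<integral>\<^sup>+x. ennreal (a0 x) \<partial>mu) = 1"
    using model by (auto simp: hmm_model_def)
  then have i: "integrable mu a0"
    by (intro integrableI_nonneg) (auto simp: measurable_cong_sets[OF sets_mu refl])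
  then have "ennreal (\<integral>x. a0 x \<partial>mu) = 1" 
    using nn_integral_eq_integral[OF i] a0 by simp
  then have "(\<integral>x. a0 x \<partial>mu) = 1" by simp
  then show ?case using a0 i by simp
next
  case (Suc t)
  then have IH: "f t \<in> borel_measurable borel" "\<And>x. 0 \<le> f t x" "integrable mu (f t)" "(\<integral>x. f t x \<partial>mu) = 1"
    by auto
  define p where "p = (\<lambda>x. b (Suc t) x (y (Suc t)) * (\<integral>u. f t u * a (Suc t) u x \<partial>mu))"
  note step = filter_step[OF Suc.prems IH(1-3) p_def]
  have "(\<integral>x. p x \<partial>mu) = m t (L (Suc t) (\<lambda>_. 1))"
    using step(2)[of "\<lambda>_. 1"] by simp
  also have "\<dots> > 0" unfolding mt_def
    using Suc.prems by (intro integral_pos_density IH L1_pos L_bounded_measurable) auto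
  finally have pos: "(\<integral>x. p x \<partial>mu) > 0" .
  have "integrable mu p" using step(1)[of "\<lambda>_. 1"] by simp
  moreover have "f (Suc t) = (\<lambda>x. p x / (\<integral>z. p z \<partial>mu))" by (simp add: p_def Let_def)
  moreover have "0 \<le> p x" for x
    unfolding p_def using IH a_nonneg b_nonneg by (intro mult_nonneg_nonneg integral_nonneg) auto
  moreover have "p \<in> borel_measurable borel"
    using \<open>integrable mu p\<close> by (simp add: measurable_cong_sets[OF sets_mu refl, symmetric] borel_measurable_integrable)
  ultimately show ?case using pos by simp
qed

lemma m_integrable:
  assumes "t \<le> T" "bounded_measurable \<psi>"
  shows "integrable mu (\<lambda>x. \<psi> x * f t x)"
  using filter_density[OF assms(1)] assms(2) integrable_density_mult sets_mu by blast

lemma m_add: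
  assumes "t \<le> T" "bounded_measurable \<psi>" "bounded_measurable \<phi>"
  shows "m t (\<lambda>x. \<psi> x + \<phi> x) = m t \<psi> + m t \<phi>"
  unfolding mt_def using assms by (simp add: distrib_right m_integrable)

lemma m_diff:
  assumes "t \<le> T" "bounded_measurable \<psi>" "bounded_measurable \<phi>"
  shows "m t (\<lambda>x. \<psi> x - \<phi> x) = m t \<psi> - m t \<phi>"
  unfolding mt_def using assms by (simp add: left_diff_distrib m_integrable)

lemma m_cmult: "m t (\<lambda>x. c * \<psi> x) = c * m t \<psi>"
  unfolding mt_def by (simp add: mult.assoc)

lemma m_const: "t \<le> T \<Longrightarrow> m t (\<lambda>x. c) = c"
  unfolding mt_def using filter_density[of t] by simp

lemma m_mono:
  assumes "t \<le> T" "bounded_measurable \<psi>" "bounded_measurable \<phi>" "\<And>u. \<psi> u \<le> \<phi> u"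
  shows "m t \<psi> \<le> m t \<phi>"
  unfolding mt_def using assms filter_density[of t]
  by (intro integral_mono m_integrable mult_right_mono) auto

lemma m_centered: "t \<le> T \<Longrightarrow> bounded_measurable \<psi> \<Longrightarrow> m t (\<lambda>x. \<psi> x - m t \<psi>) = 0"
  by (simp add: m_diff m_const)

lemma kappa_eq: "\<kappa> (Suc t) = m t (L (Suc t) (\<lambda>_. 1))"
  by (simp add: kappa_def mt_def)

lemma kappa_pos:
  assumes "Suc t \<le> T"
  shows "\<kappa> (Suc t) > 0"
  unfolding kappa_eq mt_def using assms filter_density[of t]
  by (intro integral_pos_density L1_pos L_bounded_measurable) auto

text \<open>Bayes' formula: \<open>filter_step\<close> gives the numerator with \<psi> and the
  normaliser with the constant 1. In particular \<open>L (Suc t)\<close> sends functions centred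
  under \<open>f (Suc t)\<close> to functions centred under \<open>f t\<close>.\<close>

lemma m_Suc:
  assumes "Suc t \<le> T" "bounded_measurable \<psi>"
  shows "m t (L (Suc t) \<psi>) = \<kappa> (Suc t) * m (Suc t) \<psi>"
proof -
  define p where "p = (\<lambda>x. b (Suc t) x (y (Suc t)) * (\<integral>u. f t u * a (Suc t) u x \<partial>mu))"
  have ft: "f t \<in> borel_measurable borel" "\<And>x. 0 \<le> f t x" "integrable mu (f t)"
    using filter_density[of t] assms by auto
  note step = filter_step[OF assms(1) ft p_def]
  have "f (Suc t) = (\<lambda>x. p x / (\<integral>z. p z \<partial>mu))" by (simp add: p_def Let_def)
  moreover have "(\<integral>z. p z \<partial>mu) = \<kappa> (Suc t)"
    using step(2)[of "\<lambda>_. 1"] by (simp add: kappa_eq)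
  ultimately have "m (Suc t) \<psi> = m t (L (Suc t) \<psi>) / \<kappa> (Suc t)"
    using step(2)[OF assms(2)] by (simp add: mt_def)
  then show ?thesis using kappa_pos[OF assms(1)] by simp
qed

section \<open>The covariance as a bilinear form and its recursion in time\<close>

abbreviation ctr where "ctr t \<psi> \<equiv> (\<lambda>x. \<psi> x - m t \<psi>)"

text \<open>Polarised version of the recursion for \<open>Vt\<close>. Symmetry and bilinearity
  follow by induction from this form, whereas \<open>Vtt\<close> is given by differences of a
  quadratic form whose quadratic nature is not visible.\<close>

primrec cov where
  "cov 0 \<psi> \<phi> = m 0 (\<lambda>x. ctr 0 \<psi> x * ctr 0 \<phi> x)"
| "cov (Suc t) \<psi> \<phi> = m (Suc t) (\<lambda>x. ctr (Suc t) \<psi> x * ctr (Suc t) \<phi> x)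
     + cov t (L (Suc t) (ctr (Suc t) \<psi>)) (L (Suc t) (ctr (Suc t) \<phi>)) / (\<kappa> (Suc t))\<^sup>2"

lemma cov_sym: "cov t \<psi> \<phi> = cov t \<phi> \<psi>"
  by (induction t arbitrary: \<psi> \<phi>) (auto simp: mult.commute)

lemma ctr_bounded_measurable: "bounded_measurable \<psi> \<Longrightarrow> bounded_measurable (ctr t \<psi>)"
  by (intro bounded_measurable_intros)

lemma ctr_add:
  assumes "t \<le> T" "bounded_measurable \<psi>" "bounded_measurable \<phi>"
  shows "ctr t (\<lambda>x. \<psi> x + \<phi> x) = (\<lambda>x. ctr t \<psi> x + ctr t \<phi> x)"
  using assms by (simp add: m_add fun_eq_iff)

lemma ctr_cmult: "ctr t (\<lambda>x. c * \<psi> x) = (\<lambda>x. c * ctr t \<psi> x)"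
  by (simp add: m_cmult fun_eq_iff right_diff_distrib)

lemma L_ctr_add:
  assumes "Suc t \<le> T" "bounded_measurable \<psi>" "bounded_measurable \<phi>"
  shows "L (Suc t) (ctr (Suc t) (\<lambda>x. \<psi> x + \<phi> x)) = (\<lambda>x. L (Suc t) (ctr (Suc t) \<psi>) x + L (Suc t) (ctr (Suc t) \<phi>) x)"
  using assms unfolding ctr_add[OF assms] by (intro ext L_add ctr_bounded_measurable) auto

lemma L_ctr_cmult:
  "L (Suc t) (ctr (Suc t) (\<lambda>x. c * \<psi> x)) = (\<lambda>x. c * L (Suc t) (ctr (Suc t) \<psi>) x)"
  unfolding ctr_cmult by (intro ext L_cmult)

lemma L_ctr_bounded_measurable:
  "Suc t \<le> T \<Longrightarrow> bounded_measurable \<psi> \<Longrightarrow> bounded_measurable (L (Suc t) (ctr (Suc t) \<psi>))"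
  by (intro L_bounded_measurable ctr_bounded_measurable) auto

lemma m_ctr_add:
  assumes "t \<le> T" "bounded_measurable \<psi>" "bounded_measurable \<phi>" "bounded_measurable \<eta>"
  shows "m t (\<lambda>x. ctr t (\<lambda>x. \<psi> x + \<phi> x) x * ctr t \<eta> x) =
    m t (\<lambda>x. ctr t \<psi> x * ctr t \<eta> x) + m t (\<lambda>x. ctr t \<phi> x * ctr t \<eta> x)"
proof -
  have eq: "(\<lambda>x. ctr t (\<lambda>x. \<psi> x + \<phi> x) x * ctr t \<eta> x) = (\<lambda>x. ctr t \<psi> x * ctr t \<eta> x + ctr t \<phi> x * ctr t \<eta> x)"
    using assms by (simp add: m_add algebra_simps)
  show ?thesis unfolding eq
    by (rule m_add) (rule assms bounded_measurable_mult ctr_bounded_measurable)+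
qed

lemma m_ctr_cmult: "m t (\<lambda>x. ctr t (\<lambda>x. c * \<psi> x) x * ctr t \<eta> x) = c * m t (\<lambda>x. ctr t \<psi> x * ctr t \<eta> x)"
proof -
  have "(\<lambda>x. ctr t (\<lambda>x. c * \<psi> x) x * ctr t \<eta> x) = (\<lambda>x. c * (ctr t \<psi> x * ctr t \<eta> x))"
    by (simp add: m_cmult algebra_simps)
  then show ?thesis by (simp only: m_cmult)
qed

lemma cov_add:
  assumes "t \<le> T" "bounded_measurable \<psi>" "bounded_measurable \<phi>" "bounded_measurable \<eta>"
  shows "cov t (\<lambda>x. \<psi> x + \<phi> x) \<eta> = cov t \<psi> \<eta> + cov t \<phi> \<eta>"
  using assms
proof (induction t arbitrary: \<psi> \<phi> \<eta>)
  case 0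
  then show ?case using m_ctr_add[of 0 \<psi> \<phi> \<eta>] by simp
next
  case (Suc t)
  have "cov t (\<lambda>x. L (Suc t) (ctr (Suc t) \<psi>) x + L (Suc t) (ctr (Suc t) \<phi>) x) (L (Suc t) (ctr (Suc t) \<eta>)) =
     cov t (L (Suc t) (ctr (Suc t) \<psi>)) (L (Suc t) (ctr (Suc t) \<eta>)) + cov t (L (Suc t) (ctr (Suc t) \<phi>)) (L (Suc t) (ctr (Suc t) \<eta>))"
    using Suc.prems by (intro Suc.IH L_ctr_bounded_measurable) auto
  then show ?case
    unfolding cov.simps L_ctr_add[OF Suc.prems(1-3)] m_ctr_add[OF Suc.prems(1-4)]
    by (simp add: add_divide_distrib)
qed

lemma cov_cmult: "cov t (\<lambda>x. c * \<psi> x) \<eta> = c * cov t \<psi> \<eta>"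
proof (induction t arbitrary: \<psi> \<eta>)
  case 0
  then show ?case using m_ctr_cmult[of 0] by simp
next
  case (Suc t)
  show ?case
    unfolding cov.simps L_ctr_cmult m_ctr_cmult Suc.IH by (simp add: distrib_left)
qed

lemma cov_add_right:
  assumes "t \<le> T" "bounded_measurable \<psi>" "bounded_measurable \<phi>" "bounded_measurable \<eta>"
  shows "cov t \<eta> (\<lambda>x. \<psi> x + \<phi> x) = cov t \<eta> \<psi> + cov t \<eta> \<phi>"
  using cov_add[OF assms] by (simp only: cov_sym[of t \<eta>])

lemma cov_cmult_right: "cov t \<eta> (\<lambda>x. c * \<psi> x) = c * cov t \<eta> \<psi>"
  using cov_cmult[of t c \<psi> \<eta>] by (simp only: cov_sym[of t \<eta>])

lemma L_ctr: 
  assumes "Suc t \<le> T" "bounded_measurable \<psi>"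
  shows "L (Suc t) (ctr (Suc t) \<psi>) = (\<lambda>x. L (Suc t) \<psi> x - m (Suc t) \<psi> * L (Suc t) (\<lambda>_. 1) x)"
  using assms by (auto simp: fun_eq_iff L_diff L_const[of "Suc t" "m (Suc t) \<psi>"])

lemma sigma2_eq: "sigma2 mu a0 a b y t \<psi> = m t (\<lambda>x. ctr t \<psi> x * ctr t \<psi> x)"
  by (simp add: sigma2_def mt_def power2_eq_square)

lemma Vt_eq:
  assumes "t \<le> T" "bounded_measurable \<psi>"
  shows "Vt mu a0 a b y t \<psi> = cov t \<psi> \<psi>"
  using assms
proof (induction t arbitrary: \<psi>)
  case 0
  then show ?case by (simp add: sigma2_eq)
next
  case (Suc t)
  have "Vt mu a0 a b y t (L (Suc t) (ctr (Suc t) \<psi>)) = cov t (L (Suc t) (ctr (Suc t) \<psi>)) (L (Suc t) (ctr (Suc t) \<psi>))"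
    using Suc.prems by (intro Suc.IH L_ctr_bounded_measurable) auto
  then show ?case
    unfolding Vt.simps cov.simps sigma2_eq L_ctr[OF Suc.prems]
    by (simp add: power_int_minus divide_inverse mult.commute)
qed

lemma Vtt_eq:
  assumes "t \<le> T" "bounded_measurable \<psi>" "bounded_measurable \<phi>"
  shows "Vtt mu a0 a b y t \<psi> \<phi> = cov t \<psi> \<phi>"
proof -
  have b: "bounded_measurable (\<lambda>x. \<psi> x + \<phi> x)" using assms by (intro bounded_measurable_intros)
  show ?thesis using assms b unfolding Vtt_def
    by (simp add: Vt_eq cov_add cov_add_right cov_sym[of t \<phi> \<psi>])
qed

abbreviation Vc where "Vc \<equiv> Vcross mu a0 a b y"

lemma Vc_Suc:
  "Vc r (Suc k) \<eta> \<phi> = inverse (\<kappa> (Suc (r + k))) * Vc r k \<eta> (L (Suc (r + k)) (ctr (Suc (r + k)) \<phi>))"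
  by simp

lemma Vc_add:
  assumes "r + k \<le> T" "bounded_measurable \<psi>" "bounded_measurable \<phi>" "bounded_measurable \<eta>"
  shows "Vc r k \<eta> (\<lambda>x. \<psi> x + \<phi> x) = Vc r k \<eta> \<psi> + Vc r k \<eta> \<phi>"
  using assms
proof (induction k arbitrary: \<psi> \<phi>)
  case 0
  have b: "bounded_measurable (\<lambda>x. \<psi> x + \<phi> x)" using 0 by (intro bounded_measurable_intros)
  then show ?case using 0 by (simp add: Vtt_eq cov_add_right)
next
  case (Suc k)
  have "Suc (r + k) \<le> T" using Suc.prems by simp
  note * = L_ctr_add[OF this Suc.prems(2,3)]
  have "Vc r k \<eta> (\<lambda>x. L (Suc (r + k)) (ctr (Suc (r + k)) \<psi>) x + L (Suc (r + k)) (ctr (Suc (r + k)) \<phi>) x)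
     = Vc r k \<eta> (L (Suc (r + k)) (ctr (Suc (r + k)) \<psi>)) + Vc r k \<eta> (L (Suc (r + k)) (ctr (Suc (r + k)) \<phi>))"
    using Suc.prems by (intro Suc.IH L_ctr_bounded_measurable) auto
  then show ?case unfolding Vc_Suc * by (simp only: distrib_left)
qed

lemma Vc_cmult:
  assumes "r + k \<le> T" "bounded_measurable \<psi>" "bounded_measurable \<eta>"
  shows "Vc r k (\<lambda>x. d * \<eta> x) (\<lambda>x. c * \<psi> x) = d * c * Vc r k \<eta> \<psi>"
  using assms
proof (induction k arbitrary: \<psi>)
  case 0
  have b: "bounded_measurable (\<lambda>x. c * \<psi> x)" "bounded_measurable (\<lambda>x. d * \<eta> x)" 
    using 0 by (intro bounded_measurable_intros; simp)+
  then show ?case using 0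
    by (simp add: Vtt_eq cov_cmult cov_cmult_right)
next
  case (Suc k)
  have "Vc r k (\<lambda>x. d * \<eta> x) (\<lambda>x. c * L (Suc (r + k)) (ctr (Suc (r + k)) \<psi>) x)
     = d * c * Vc r k \<eta> (L (Suc (r + k)) (ctr (Suc (r + k)) \<psi>))"
    using Suc.prems by (intro Suc.IH L_ctr_bounded_measurable) auto
  then show ?case unfolding Vc_Suc L_ctr_cmult by (simp only: mult_ac)
qed

abbreviation V where "V \<equiv> Vst mu a0 a b y"

lemma V_same: "t \<le> T \<Longrightarrow> bounded_measurable \<psi> \<Longrightarrow> bounded_measurable \<phi> \<Longrightarrow> V t t \<psi> \<phi> = cov t \<psi> \<phi>"
  by (simp add: Vst_def Vtt_eq)

lemma V_sym:
  assumes "r \<le> T" "t \<le> T" "bounded_measurable \<psi>" "bounded_measurable \<phi>"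
  shows "V r t \<psi> \<phi> = V t r \<phi> \<psi>"
proof (cases r t rule: linorder_cases)
  case equal
  then show ?thesis using assms cov_sym[of t \<psi> \<phi>] by (simp add: V_same)
qed (auto simp: Vst_def)

lemma V_add:
  assumes "r \<le> t" "t \<le> T" "bounded_measurable \<psi>" "bounded_measurable \<phi>" "bounded_measurable \<eta>"
  shows "V r t \<eta> (\<lambda>x. \<psi> x + \<phi> x) = V r t \<eta> \<psi> + V r t \<eta> \<phi>"
  using assms by (simp add: Vst_def Vc_add)

lemma V_cmult:
  assumes "r \<le> T" "t \<le> T" "bounded_measurable \<psi>" "bounded_measurable \<eta>"
  shows "V r t (\<lambda>x. d * \<eta> x) (\<lambda>x. c * \<psi> x) = d * c * V r t \<eta> \<psi>"
  using assms by (auto simp: Vst_def Vc_cmult)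

text \<open>Linearisation of one step: given generation \<open>t\<close>, the mean of
  \<open>ctr (Suc t) \<phi>\<close> under the law of a new particle is to first order the empirical
  mean of \<open>pullback t \<phi>\<close>, a function centred under \<open>f t\<close>.\<close>

definition pullback where "pullback t \<phi> = (\<lambda>x. L (Suc t) (ctr (Suc t) \<phi>) x / \<kappa> (Suc t))"

lemma pullback_bounded_measurable:
  assumes "Suc t \<le> T" "bounded_measurable \<phi>"
  shows "bounded_measurable (pullback t \<phi>)"
  using bounded_measurable_mult[OF bounded_measurable_const[of "1 / \<kappa> (Suc t)"] L_ctr_bounded_measurable[OF assms]]
  by (simp add: pullback_def)

lemma V_Suc:
  assumes "r \<le> t" "Suc t \<le> T" "bounded_measurable \<psi>" "bounded_measurable \<phi>"
  shows "V r (Suc t) \<psi> \<phi> = V r t \<psi> (pullback t \<phi>)"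
proof -
  have "V r t (\<lambda>x. 1 * \<psi> x) (\<lambda>x. inverse (\<kappa> (Suc t)) * L (Suc t) (ctr (Suc t) \<phi>) x) =
     1 * inverse (\<kappa> (Suc t)) * V r t \<psi> (L (Suc t) (ctr (Suc t) \<phi>))"
    using assms by (intro V_cmult L_ctr_bounded_measurable) auto
  moreover have "(\<lambda>x. inverse (\<kappa> (Suc t)) * L (Suc t) (ctr (Suc t) \<phi>) x) = pullback t \<phi>"
    by (simp add: pullback_def fun_eq_iff divide_inverse mult.commute)
  moreover have "V r (Suc t) \<psi> \<phi> = inverse (\<kappa> (Suc t)) * V r t \<psi> (L (Suc t) (ctr (Suc t) \<phi>))"
    using assms(1) by (simp add: Vst_def Suc_diff_le)
  ultimately show ?thesis by simp
qed

lemma cov_Suc: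
  assumes "Suc t \<le> T" "bounded_measurable \<phi>"
  shows "cov (Suc t) \<phi> \<phi> = sigma2 mu a0 a b y (Suc t) \<phi> + cov t (pullback t \<phi>) (pullback t \<phi>)"
proof -
  have pullback: "pullback t \<phi> = (\<lambda>x. (1 / \<kappa> (Suc t)) * L (Suc t) (ctr (Suc t) \<phi>) x)" by (simp add: pullback_def)
  have "cov t (pullback t \<phi>) (pullback t \<phi>) = (1 / \<kappa> (Suc t)) * ((1 / \<kappa> (Suc t)) * cov t (L (Suc t) (ctr (Suc t) \<phi>)) (L (Suc t) (ctr (Suc t) \<phi>)))"
    unfolding pullback by (simp only: cov_cmult cov_cmult_right)
  then show ?thesis by (simp add: sigma2_eq power2_eq_square)
qed

text \<open>The quadratic form of the covariance matrix. The weights of a dual vector are absorbed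
  into the functions, since \<open>V\<close> is homogeneous in each argument.\<close>

definition Q where "Q t \<psi> = (\<Sum>i\<le>t. \<Sum>j\<le>t. V i j (\<psi> i) (\<psi> j))"

lemma Q_split:
  assumes "t \<le> T" "\<And>i. i \<le> t \<Longrightarrow> bounded_measurable (\<psi> i)"
  shows "Q t \<psi> = (\<Sum>i<t. \<Sum>j<t. V i j (\<psi> i) (\<psi> j)) + 2 * (\<Sum>r<t. V r t (\<psi> r) (\<psi> t)) + cov t (\<psi> t) (\<psi> t)"
proof -
  have sp: "(\<Sum>i\<le>t. g i) = (\<Sum>i<t. g i) + g t" for g :: "nat \<Rightarrow> real"
    by (simp add: lessThan_Suc_atMost[symmetric])
  have "(\<Sum>j<t. V t j (\<psi> t) (\<psi> j)) = (\<Sum>r<t. V r t (\<psi> r) (\<psi> t))"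
    using assms by (intro sum.cong refl V_sym) auto
  then show ?thesis using assms by (simp add: Q_def sp sum.distrib V_same)
qed

lemma Q_update:
  assumes "t \<le> T" "\<And>i. i \<le> t \<Longrightarrow> bounded_measurable (\<psi> i)" "bounded_measurable h"
  shows "Q t (\<psi>(t := \<lambda>x. \<psi> t x + h x)) = Q t \<psi> + 2 * (\<Sum>r\<le>t. V r t (\<psi> r) h) + cov t h h"
proof -
  let ?\<psi> = "\<psi>(t := \<lambda>x. \<psi> t x + h x)"
  have b: "bounded_measurable (\<lambda>x. \<psi> t x + h x)" using assms by (intro bounded_measurable_intros) auto
  then have b': "\<And>i. i \<le> t \<Longrightarrow> bounded_measurable (?\<psi> i)" using assms by auto
  have "(\<Sum>r<t. V r t (\<psi> r) (\<lambda>x. \<psi> t x + h x)) = (\<Sum>r<t. V r t (\<psi> r) (\<psi> t)) + (\<Sum>r<t. V r t (\<psi> r) h)"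
    unfolding sum.distrib[symmetric] using assms by (intro sum.cong refl V_add) auto
  moreover have "(\<Sum>r\<le>t. V r t (\<psi> r) h) = (\<Sum>r<t. V r t (\<psi> r) h) + cov t (\<psi> t) h"
    using assms by (simp add: lessThan_Suc_atMost[symmetric] V_same)
  moreover have "cov t (\<lambda>x. \<psi> t x + h x) (\<lambda>x. \<psi> t x + h x) = cov t (\<psi> t) (\<psi> t) + 2 * cov t (\<psi> t) h + cov t h h"
    using assms b by (simp add: cov_add cov_add_right cov_sym[of t h "\<psi> t"])
  ultimately show ?thesis using Q_split[of t ?\<psi>, OF assms(1) b'] Q_split[of t \<psi>, OF assms(1,2)] by simp
qed

lemma Q_Suc:
  assumes "Suc t \<le> T" "\<And>i. i \<le> Suc t \<Longrightarrow> bounded_measurable (\<psi> i)"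
  shows "Q (Suc t) \<psi> = sigma2 mu a0 a b y (Suc t) (\<psi> (Suc t)) +
     Q t (\<psi>(t := \<lambda>x. \<psi> t x + pullback t (\<psi> (Suc t)) x))"
proof -
  have "(\<Sum>i<Suc t. \<Sum>j<Suc t. V i j (\<psi> i) (\<psi> j)) = Q t \<psi>" by (simp add: Q_def lessThan_Suc_atMost)
  moreover have "(\<Sum>r<Suc t. V r (Suc t) (\<psi> r) (\<psi> (Suc t))) = (\<Sum>r\<le>t. V r t (\<psi> r) (pullback t (\<psi> (Suc t))))"
    unfolding lessThan_Suc_atMost using assms by (intro sum.cong refl V_Suc) auto
  moreover have "Q t (\<psi>(t := \<lambda>x. \<psi> t x + pullback t (\<psi> (Suc t)) x)) =
     Q t \<psi> + 2 * (\<Sum>r\<le>t. V r t (\<psi> r) (pullback t (\<psi> (Suc t)))) + cov t (pullback t (\<psi> (Suc t))) (pullback t (\<psi> (Suc t)))"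
    using assms by (intro Q_update pullback_bounded_measurable) auto
  ultimately show ?thesis using Q_split[of "Suc t" \<psi>, OF assms] cov_Suc[OF assms(1), of "\<psi> (Suc t)"] assms by simp
qed

subsection \<open>The law of the particle system\<close>

definition pweight where
  "pweight N t xs x = ennreal (b t x (y t) * (\<Sum>i<N. a t (xs i) x) / real N)"

definition particle_law where
  "particle_law N t xs = density mu (\<lambda>x. pweight N t xs x / (\<integral>\<^sup>+z. pweight N t xs z \<partial>mu))"

lemma pf_next_eq: "pf_next mu a b y N t xs = (\<Pi>\<^sub>M i\<in>{..<N}. particle_law N t xs)"
  by (simp only: pf_next_def particle_law_def pweight_def Let_def)

lemma pweight_eq: "pweight N t xs x = ennreal ((\<Sum>i<N. w t (xs i) x) / real N)"
  by (simp add: pweight_def w_def sum_distrib_left sum_divide_distrib mult.commute)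

lemma sets_particle_law [simp, measurable_cong]: "sets (particle_law N t xs) = sets borel"
  by (simp add: particle_law_def sets_mu)

lemma pweight_meas2:
  assumes "t \<ge> 1"
  shows "(\<lambda>(xs, x). pweight N t xs x) \<in> borel_measurable ((\<Pi>\<^sub>M i\<in>{..<N}. borel) \<Otimes>\<^sub>M borel)"
proof -
  have "(\<lambda>p. w t (fst p i) (snd p)) \<in> borel_measurable ((\<Pi>\<^sub>M i\<in>{..<N}. borel) \<Otimes>\<^sub>M borel)" if "i < N" for i
  proof -
    have "(\<lambda>p. (fst p i, snd p)) \<in> (\<Pi>\<^sub>M i\<in>{..<N}. borel) \<Otimes>\<^sub>M borel \<rightarrow>\<^sub>M borel \<Otimes>\<^sub>M borel"
      using that by (intro measurable_Pair measurable_snd measurable_compose[OF measurable_fst measurable_component_singleton]) auto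
    from measurable_compose[OF this w_meas[OF assms]] show ?thesis by simp
  qed
  then show ?thesis unfolding pweight_eq case_prod_beta 
    by (intro measurable_compose[OF _ measurable_ennreal] borel_measurable_divide borel_measurable_sum borel_measurable_const) auto
qed

lemma pweight_meas:
  assumes "t \<ge> 1"
  shows "pweight N t xs \<in> borel_measurable mu"
proof -
  note [measurable] = w_meas2[OF assms]
  show ?thesis unfolding pweight_eq by measurable
qed

lemma pweight_nn_integral:
  assumes t: "t \<in> {1..T}" and g: "bounded_measurable g" "\<And>x. 0 \<le> g x"
  shows "(\<integral>\<^sup>+x. pweight N t xs x * ennreal (g x) \<partial>mu) = ennreal ((\<Sum>i<N. L t g (xs i)) / real N)"
proof -
  have "pweight N t xs x * ennreal (g x) = ennreal ((\<Sum>i<N. g x * w t (xs i) x) / real N)" for x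
    using t g w_nonneg unfolding pweight_eq
    by (subst ennreal_mult[symmetric]) (auto simp: sum_distrib_left mult.commute intro!: sum_nonneg divide_nonneg_nonneg)
  then have "(\<integral>\<^sup>+x. pweight N t xs x * ennreal (g x) \<partial>mu) = (\<integral>\<^sup>+x. ennreal ((\<Sum>i<N. g x * w t (xs i) x) / real N) \<partial>mu)"
    by simp
  also have "\<dots> = ennreal (\<integral>x. (\<Sum>i<N. g x * w t (xs i) x) / real N \<partial>mu)"
    using t g w_nonneg
    by (intro nn_integral_eq_integral) (auto intro!: w_mult_integrable Bochner_Integration.integrable_sum integrable_divide sum_nonneg divide_nonneg_nonneg simp del: sum_divide_distrib)
  also have "(\<integral>x. (\<Sum>i<N. g x * w t (xs i) x) / real N \<partial>mu) = (\<Sum>i<N. L t g (xs i)) / real N"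
    unfolding L_eq using w_mult_integrable[OF t g(1)] by simp
  finally show ?thesis .
qed

lemma sum_L1_pos: "(N::nat) > 0 \<Longrightarrow> t \<in> {1..T} \<Longrightarrow> 0 < (\<Sum>i<N. L t (\<lambda>_. 1) (xs i))"
  using L1_pos by (intro sum_pos) auto

lemma L_nonneg:
  assumes "t \<in> {1..T}" "bounded_measurable g" "\<And>x. 0 \<le> g x"
  shows "0 \<le> L t g x"
  using L_mono[OF assms(1) bounded_measurable_const[of 0] assms(2,3), of x] L_const[of t 0 x] by simp

text \<open>\<open>L t (\<lambda>_. 1)\<close> is positive everywhere, so for \<open>N > 0\<close>
  the normaliser is positive at every configuration \<open>xs\<close> and the formula has no
  exceptional set. The two factors \<open>1 / N\<close> cancel.\<close>

lemma particle_nn_integral: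
  assumes t: "t \<in> {1..T}" and N: "N > 0" and g: "bounded_measurable g" "\<And>x. 0 \<le> g x"
  shows "(\<integral>\<^sup>+x. ennreal (g x) \<partial>particle_law N t xs) =
    ennreal ((\<Sum>i<N. L t g (xs i)) / (\<Sum>i<N. L t (\<lambda>_. 1) (xs i)))"
proof -
  note [measurable] = bounded_measurableD[OF g(1)]
  have [measurable]: "pweight N t xs \<in> borel_measurable mu" using t by (intro pweight_meas) auto
  let ?W = "\<integral>\<^sup>+z. pweight N t xs z \<partial>mu"
  have W: "?W = ennreal ((\<Sum>i<N. L t (\<lambda>_. 1) (xs i)) / real N)"
    using pweight_nn_integral[OF t, of "\<lambda>_. 1"] by simp
  have "(\<integral>\<^sup>+x. ennreal (g x) \<partial>particle_law N t xs) = (\<integral>\<^sup>+x. pweight N t xs x / ?W * ennreal (g x) \<partial>mu)"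
    unfolding particle_law_def by (intro nn_integral_density) measurable
  also have "\<dots> = (\<integral>\<^sup>+x. pweight N t xs x * ennreal (g x) / ?W \<partial>mu)"
    by (simp add: divide_ennreal_def mult_ac)
  also have "\<dots> = (\<integral>\<^sup>+x. pweight N t xs x * ennreal (g x) \<partial>mu) / ?W"
    by (intro nn_integral_divide) measurable
  also have "\<dots> = ennreal ((\<Sum>i<N. L t g (xs i)) / real N) / ennreal ((\<Sum>i<N. L t (\<lambda>_. 1) (xs i)) / real N)"
    unfolding W pweight_nn_integral[OF t g] ..
  also have "\<dots> = ennreal ((\<Sum>i<N. L t g (xs i)) / real N / ((\<Sum>i<N. L t (\<lambda>_. 1) (xs i)) / real N))"
    using N sum_L1_pos[OF N t] L_nonneg[OF t g]
    by (intro divide_ennreal divide_nonneg_nonneg sum_nonneg divide_pos_pos) auto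
  finally show ?thesis using N by simp
qed

lemma prob_particle_law:
  assumes t: "t \<in> {1..T}" and N: "N > 0"
  shows "prob_space (particle_law N t xs)"
proof (rule prob_spaceI)
  have "emeasure (particle_law N t xs) (space (particle_law N t xs)) = (\<integral>\<^sup>+x. ennreal 1 \<partial>particle_law N t xs)"
    by simp
  also have "\<dots> = 1"
    using particle_nn_integral[OF t N, of "\<lambda>_. 1" xs] sum_L1_pos[OF N t, of xs] by simp
  finally show "emeasure (particle_law N t xs) (space (particle_law N t xs)) = 1" .
qed

lemma particle_law_meas:
  assumes t: "t \<in> {1..T}" and A [measurable]: "A \<in> sets borel"
  shows "(\<lambda>xs. emeasure (particle_law N t xs) A) \<in> borel_measurable (\<Pi>\<^sub>M i\<in>{..<N}. borel)"
proof -
  have p1: "pweight N t xs \<in> borel_measurable mu" for xs using t by (intro pweight_meas) auto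
  have [measurable]: "(\<lambda>(xs, x). pweight N t xs x) \<in> borel_measurable ((\<Pi>\<^sub>M i\<in>{..<N}. borel) \<Otimes>\<^sub>M borel)"
    using t by (intro pweight_meas2) auto
  have "emeasure (particle_law N t xs) A = (\<integral>\<^sup>+x. pweight N t xs x / (\<integral>\<^sup>+z. pweight N t xs z \<partial>mu) * indicator A x \<partial>mu)" for xs
    unfolding particle_law_def using A p1 by (intro emeasure_density) (auto simp: sets_mu)
  then show ?thesis by simp measurable
qed

definition gen_space :: "nat \<Rightarrow> (nat \<Rightarrow> real^'d) measure" where
  "gen_space N = (\<Pi>\<^sub>M i\<in>{..<N}. borel)"

definition path_space :: "nat \<Rightarrow> nat \<Rightarrow> (nat \<Rightarrow> nat \<Rightarrow> real^'d) measure" where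
  "path_space N t = (\<Pi>\<^sub>M s\<in>{..t}. gen_space N)"

lemma product_particle_law:
  assumes "t \<in> {1..T}" "N > 0"
  shows "product_prob_space (\<lambda>i. particle_law N t xs)"
  by (rule product_prob_spaceI) (rule prob_particle_law[OF assms])

text \<open>Measurability is checked on rectangles, an intersection-stable generator. There the
  measure is a finite product of values of \<open>particle_law\<close>, each measurable in the
  configuration.\<close>

lemma pf_next_kernel:
  assumes t: "t \<in> {1..T}" and N: "N > 0"
  shows "pf_next mu a b y N t \<in> gen_space N \<rightarrow>\<^sub>M prob_algebra (gen_space N)"
proof (rule measurable_prob_algebra_generated[OF sets_PiM[of "{..<N}" "\<lambda>_. borel :: (real^'d) measure", folded gen_space_def]
      Int_stable_prod_algebra prod_algebra_sets_into_space])
  fix xs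
  show "prob_space (pf_next mu a b y N t xs)"
    unfolding pf_next_eq using assms by (intro prob_space_PiM prob_particle_law)
  show "sets (pf_next mu a b y N t xs) = sets (gen_space N)"
    unfolding pf_next_eq gen_space_def by (intro sets_PiM_cong) auto
next
  fix A :: "(nat \<Rightarrow> real^'d) set" assume "A \<in> prod_algebra {..<N} (\<lambda>_. borel)"
  then obtain E where E: "A = Pi\<^sub>E {..<N} E" "\<And>i. i < N \<Longrightarrow> E i \<in> sets borel"
    by (auto simp: prod_algebra_eq_finite)
  have "emeasure (pf_next mu a b y N t xs) A = (\<Prod>i<N. emeasure (particle_law N t xs) (E i))" for xs
  proof -
    interpret product_prob_space "\<lambda>i. particle_law N t xs" "{..<N}"
      by (rule product_particle_law[OF t N])
    show ?thesis unfolding pf_next_eq E(1) using E(2) by (intro emeasure_PiM) auto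
  qed
  then show "(\<lambda>xs. emeasure (pf_next mu a b y N t xs) A) \<in> borel_measurable (gen_space N)"
    unfolding gen_space_def using particle_law_meas[OF t E(2)] by simp
qed

abbreviation pf where "pf \<equiv> pf_law mu a0 a b y"

lemma component_meas: "s \<le> t \<Longrightarrow> (\<lambda>X. X s) \<in> path_space N t \<rightarrow>\<^sub>M gen_space N"
  unfolding path_space_def by (intro measurable_component_singleton) simp

lemma coordinate_meas: "s \<le> t \<Longrightarrow> i < N \<Longrightarrow> (\<lambda>X. X s i) \<in> borel_measurable (path_space N t)"
  using measurable_compose[OF component_meas[of s t N], of "\<lambda>x. x i" borel]
  by (simp add: gen_space_def)

definition pf_step where
  "pf_step N t X = distr (pf_next mu a b y N (Suc t) (X t)) (path_space N (Suc t)) (\<lambda>x. X(Suc t := x))"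

lemma fun_upd_meas:
  "(\<lambda>(X, x). X(Suc t := x)) \<in> path_space N t \<Otimes>\<^sub>M gen_space N \<rightarrow>\<^sub>M path_space N (Suc t)"
  unfolding path_space_def case_prod_beta
  by (rule measurable_fun_upd[where J = "{..t}"]) auto

lemma pf_step_kernel:
  assumes t: "Suc t \<le> T" and N: "N > 0"
  shows "pf_step N t \<in> path_space N t \<rightarrow>\<^sub>M prob_algebra (path_space N (Suc t))"
  unfolding pf_step_def
proof (rule measurable_distr_prob_space2[OF _ fun_upd_meas])
  show "(\<lambda>X. pf_next mu a b y N (Suc t) (X t)) \<in> path_space N t \<rightarrow>\<^sub>M prob_algebra (gen_space N)"
    using t N by (intro measurable_compose[OF component_meas pf_next_kernel]) auto
qed

lemma pf_Suc: "pf N (Suc t) = pf N t \<bind> pf_step N t"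
  by (simp add: pf_step_def[abs_def] path_space_def gen_space_def)

lemma prob_initial: "prob_space (density mu (\<lambda>x. ennreal (a0 x)))"
proof (rule prob_spaceI)
  have [measurable]: "a0 \<in> borel_measurable borel" using model by (simp add: hmm_model_def)
  have "emeasure (density mu (\<lambda>x. ennreal (a0 x))) UNIV = (\<integral>\<^sup>+x. ennreal (a0 x) \<partial>mu)"
    by (subst emeasure_density) (auto simp: sets_mu)
  then show "emeasure (density mu (\<lambda>x. ennreal (a0 x))) (space (density mu (\<lambda>x. ennreal (a0 x)))) = 1"
    using model by (simp add: hmm_model_def)
qed

lemma init_meas: "(\<lambda>x. \<lambda>s\<in>{..0}. x) \<in> pf_gen0 mu a0 N \<rightarrow>\<^sub>M path_space N 0"
proof -
  have "sets (pf_gen0 mu a0 N) = sets (gen_space N)"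
    unfolding pf_gen0_def gen_space_def by (intro sets_PiM_cong) (auto simp: sets_mu)
  then show ?thesis unfolding path_space_def
    by (intro measurable_restrict) (simp cong: measurable_cong_sets)
qed

lemma pf_0: "pf N 0 = distr (pf_gen0 mu a0 N) (path_space N 0) (\<lambda>x. \<lambda>s\<in>{..0}. x)"
  by (simp add: path_space_def gen_space_def)

lemma pf_in_prob_algebra:
  assumes "t \<le> T" "N > 0"
  shows "pf N t \<in> space (prob_algebra (path_space N t))"
  using assms(1)
proof (induction t)
  case 0
  have "prob_space (pf_gen0 mu a0 N)" unfolding pf_gen0_def by (intro prob_space_PiM prob_initial)
  then show ?case
    unfolding pf_0 space_prob_algebra using prob_space.prob_space_distr[OF _ init_meas] by simp
next
  case (Suc t)
  then have "pf N t \<in> space (prob_algebra (path_space N t))" by simp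
  from prob_space_bind'[OF this pf_step_kernel[OF Suc.prems assms(2)]]
    sets_bind'[OF this pf_step_kernel[OF Suc.prems assms(2)]]
  show ?case unfolding pf_Suc space_prob_algebra by simp
qed

lemma sets_pf: "t \<le> T \<Longrightarrow> N > 0 \<Longrightarrow> sets (pf N t) = sets (path_space N t)"
  using pf_in_prob_algebra by (simp add: space_prob_algebra)

lemma prob_pf: "t \<le> T \<Longrightarrow> N > 0 \<Longrightarrow> prob_space (pf N t)"
  using pf_in_prob_algebra by (simp add: space_prob_algebra)

lemma pf_0_nn_integral:
  assumes F: "F \<in> borel_measurable (path_space N 0)"
    and g: "bounded_measurable g" "\<And>x. 0 \<le> g x"
    and FG: "\<And>X. F X = ennreal (\<Prod>i<N. g (X 0 i))"
  shows "(\<integral>\<^sup>+X. F X \<partial>pf N 0) = ennreal (m 0 g ^ N)"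
proof -
  note [measurable] = bounded_measurableD[OF g(1)]
  have [measurable]: "a0 \<in> borel_measurable borel" and a0: "\<And>x. 0 \<le> a0 x" using model by (auto simp: hmm_model_def)
  interpret product_prob_space "\<lambda>i. density mu (\<lambda>x. ennreal (a0 x))" "{..<N}"
    by (rule product_prob_spaceI) (rule prob_initial)
  have one: "(\<integral>\<^sup>+x. ennreal (g x) \<partial>density mu (\<lambda>x. ennreal (a0 x))) = ennreal (m 0 g)"
  proof -
    have "(\<integral>\<^sup>+x. ennreal (g x) \<partial>density mu (\<lambda>x. ennreal (a0 x))) = (\<integral>\<^sup>+x. ennreal (a0 x) * ennreal (g x) \<partial>mu)"
      by (intro nn_integral_density) measurable
    also have "\<dots> = (\<integral>\<^sup>+x. ennreal (g x * f 0 x) \<partial>mu)"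
      using a0 g by (simp add: mult.commute flip: ennreal_mult)
    also have "\<dots> = ennreal (m 0 g)"
      unfolding mt_def using a0 g by (intro nn_integral_eq_integral m_integrable) auto
    finally show ?thesis .
  qed
  have "(\<integral>\<^sup>+X. F X \<partial>pf N 0) = (\<integral>\<^sup>+x. F (\<lambda>s\<in>{..0}. x) \<partial>pf_gen0 mu a0 N)"
    unfolding pf_0 by (rule nn_integral_distr[OF init_meas]) (simp add: F)
  also have "\<dots> = (\<integral>\<^sup>+x. (\<Prod>i<N. ennreal (g (x i))) \<partial>pf_gen0 mu a0 N)"
    using g by (simp add: FG prod_ennreal)
  also have "\<dots> = (\<Prod>i<N. ennreal (m 0 g))"
    unfolding pf_gen0_def one[symmetric] by (rule product_nn_integral_prod) (auto simp: measurable_cong_sets[OF sets_mu refl])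
  also have "\<dots> = ennreal (m 0 g ^ N)"
    using m_mono[of 0 "\<lambda>_. 0" g] m_const[of 0 0] g by (simp add: ennreal_power)
  finally show ?thesis .
qed

text \<open>Given the past, the \<open>N\<close> new particles are i.i.d., so the integral of the
  product is the \<open>N\<close>-th power of a single ratio. With \<open>g\<close> constantly 1 the
  ratio is 1 and the last generation is simply integrated out.\<close>

lemma pf_Suc_nn_integral:
  assumes t: "Suc t \<le> T" and N: "N > 0"
    and F: "F \<in> borel_measurable (path_space N (Suc t))"
    and g: "bounded_measurable g" "\<And>x. 0 \<le> g x"
    and FG: "\<And>X x. F (X(Suc t := x)) = G X * ennreal (\<Prod>i<N. g (x i))"
  shows "(\<integral>\<^sup>+X. F X \<partial>pf N (Suc t)) =
    (\<integral>\<^sup>+X. G X * ennreal (((\<Sum>i<N. L (Suc t) g (X t i)) / (\<Sum>i<N. L (Suc t) (\<lambda>_. 1) (X t i))) ^ N) \<partial>pf N t)"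
proof -
  note [measurable] = bounded_measurableD[OF g(1)]
  have tT: "Suc t \<in> {1..T}" using t by simp
  have "(\<integral>\<^sup>+X. F X \<partial>pf N (Suc t)) = (\<integral>\<^sup>+X. (\<integral>\<^sup>+Z. F Z \<partial>pf_step N t X) \<partial>pf N t)"
    unfolding pf_Suc
  proof (rule nn_integral_bind[OF F])
    show "pf_step N t \<in> pf N t \<rightarrow>\<^sub>M subprob_algebra (path_space N (Suc t))"
      using measurable_prob_algebraD[OF pf_step_kernel[OF t N]] t N
      by (simp cong: measurable_cong_sets add: sets_pf)
  qed
  also have "\<dots> = (\<integral>\<^sup>+X. G X * ennreal (((\<Sum>i<N. L (Suc t) g (X t i)) / (\<Sum>i<N. L (Suc t) (\<lambda>_. 1) (X t i))) ^ N) \<partial>pf N t)"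
  proof (rule nn_integral_cong)
    fix X assume "X \<in> space (pf N t)"
    then have X: "X \<in> space (path_space N t)" using sets_eq_imp_space_eq[OF sets_pf[of t N]] t N by simp
    interpret product_prob_space "\<lambda>i. particle_law N (Suc t) (X t)" "{..<N}"
      by (rule product_particle_law[OF tT N])
    have "sets (pf_next mu a b y N (Suc t) (X t)) = sets (gen_space N)"
      unfolding pf_next_eq gen_space_def by (intro sets_PiM_cong) auto
    then have "(\<lambda>x. X(Suc t := x)) \<in> pf_next mu a b y N (Suc t) (X t) \<rightarrow>\<^sub>M path_space N (Suc t)"
      using measurable_Pair2[OF fun_upd_meas X] by (simp cong: measurable_cong_sets)
    then have "(\<integral>\<^sup>+Z. F Z \<partial>pf_step N t X) = (\<integral>\<^sup>+x. F (X(Suc t := x)) \<partial>pf_next mu a b y N (Suc t) (X t))"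
      unfolding pf_step_def by (rule nn_integral_distr) (simp add: F)
    also have "\<dots> = (\<integral>\<^sup>+x. G X * (\<Prod>i<N. ennreal (g (x i))) \<partial>pf_next mu a b y N (Suc t) (X t))"
      using g by (simp add: FG prod_ennreal)
    also have "\<dots> = G X * (\<integral>\<^sup>+x. (\<Prod>i<N. ennreal (g (x i))) \<partial>pf_next mu a b y N (Suc t) (X t))"
      unfolding pf_next_eq by (intro nn_integral_cmult) measurable
    also have "(\<integral>\<^sup>+x. (\<Prod>i<N. ennreal (g (x i))) \<partial>pf_next mu a b y N (Suc t) (X t)) =
        (\<Prod>i<N. \<integral>\<^sup>+x. ennreal (g x) \<partial>particle_law N (Suc t) (X t))"
      unfolding pf_next_eq by (rule product_nn_integral_prod) auto
    also have "\<dots> = ennreal (((\<Sum>i<N. L (Suc t) g (X t i)) / (\<Sum>i<N. L (Suc t) (\<lambda>_. 1) (X t i))) ^ N)"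
      unfolding particle_nn_integral[OF tT N g] 
      using sum_L1_pos[OF N tT, of "X t"] L_nonneg[OF tT g]
      by (simp add: ennreal_power sum_nonneg less_imp_le)
    finally show "(\<integral>\<^sup>+Z. F Z \<partial>pf_step N t X) = G X * ennreal (((\<Sum>i<N. L (Suc t) g (X t i)) / (\<Sum>i<N. L (Suc t) (\<lambda>_. 1) (X t i))) ^ N)" .
  qed
  finally show ?thesis .
qed

end

section \<open>Exponential estimates for one generation\<close>

text \<open>The Taylor remainder is at most
  \<open>exp \<bar>u\<bar> * \<bar>u\<bar> ^ 3 / 2\<close>, and
  \<open>exp \<bar>u\<bar> \<le> 3 \<le> 4\<close>.\<close>

lemma exp_taylor2:
  fixes u :: real
  assumes "\<bar>u\<bar> \<le> 1"
  shows "\<bar>exp u - (1 + u + u\<^sup>2 / 2)\<bar> \<le> 2 * \<bar>u\<bar> ^ 3"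
proof -
  have "norm (exp u - (\<Sum>i\<le>2. u ^ i / fact i)) \<le> exp (norm u) * (norm u ^ Suc 2) / fact 2"
    by (rule Taylor_exp_field)
  moreover have "(\<Sum>i\<le>2. u ^ i / fact i) = 1 + u + u\<^sup>2 / 2"
    by (simp add: numeral_2_eq_2)
  moreover have "exp \<bar>u\<bar> * \<bar>u\<bar> ^ 3 \<le> 4 * \<bar>u\<bar> ^ 3"
  proof (rule mult_right_mono)
    have "exp \<bar>u\<bar> \<le> exp 1" using assms by simp
    also have "exp 1 \<le> (3::real)" by (rule exp_le)
    finally show "exp \<bar>u\<bar> \<le> 4" by simp
  qed simp
  ultimately show ?thesis by (simp add: numeral_3_eq_3 numeral_2_eq_2)
qed

text \<open>Two averages need the same expansion: the filter mean \<open>m t\<close> and the ratio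
  of empirical means that describes a new particle. Affine compatibility (which contains
  \<open>E 1 = 1\<close>) and monotonicity suffice for it, so the ratio can be treated without being
  written as an integral.\<close>

definition mean_functional :: "(('a::topological_space \<Rightarrow> real) \<Rightarrow> real) \<Rightarrow> bool" where
  "mean_functional E \<longleftrightarrow>
    (\<forall>f g c c1 c2. bounded_measurable f \<longrightarrow> bounded_measurable g \<longrightarrow>
       E (\<lambda>x. c + c1 * f x + c2 * g x) = c + c1 * E f + c2 * E g) \<and>
    (\<forall>f g. bounded_measurable f \<longrightarrow> bounded_measurable g \<longrightarrow> (\<forall>x. f x \<le> g x) \<longrightarrow> E f \<le> E g)"

text \<open>The pointwise Taylor expansion passes through \<open>E\<close> by monotonicity and
  linearity. The third bound is a coarser form for Chernoff estimates:
  \<open>(\<theta> * C) ^ 3 \<le> (\<theta> * C)\<^sup>2\<close>, and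
  \<open>1/2 + 2 \<le> 3\<close>.\<close>

lemma mean_functional_exp:
  assumes E: "mean_functional E" and \<phi>: "bounded_measurable \<phi>" and C: "\<And>x. \<bar>\<phi> x\<bar> \<le> C"
    and \<theta>: "0 \<le> \<theta>" "\<theta> * C \<le> 1"
  shows "\<bar>E (\<lambda>x. exp (\<theta> * \<phi> x)) - (1 + \<theta> * E \<phi> + \<theta>\<^sup>2 / 2 * E (\<lambda>x. (\<phi> x)\<^sup>2))\<bar> \<le> 2 * (\<theta> * C) ^ 3"
    and "\<bar>E (\<lambda>x. (\<phi> x)\<^sup>2)\<bar> \<le> C\<^sup>2"
    and "E (\<lambda>x. exp (\<theta> * \<phi> x)) \<le> 1 + \<theta> * E \<phi> + 3 * (\<theta> * C)\<^sup>2"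
proof -
  have lin: "E (\<lambda>x. c + c1 * f x + c2 * g x) = c + c1 * E f + c2 * E g"
    if "bounded_measurable f" "bounded_measurable g" for f g c c1 c2
    using E that unfolding mean_functional_def by blast
  have mono: "E f \<le> E g" if "bounded_measurable f" "bounded_measurable g" "\<And>x. f x \<le> g x" for f g
    using E that unfolding mean_functional_def by blast
  have const: "E (\<lambda>x. c) = c" for c using lin[of "\<lambda>_. 0" "\<lambda>_. 0" c 0 0] by simp
  have C0: "0 \<le> C" using C[of undefined] by linarith
  have b2: "bounded_measurable (\<lambda>x. (\<phi> x)\<^sup>2)" using \<phi> by (intro bounded_measurable_power)
  have be: "bounded_measurable (\<lambda>x. exp (\<theta> * \<phi> x))" using \<phi> by (intro bounded_measurable_exp bounded_measurable_mult) auto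
  have bl: "bounded_measurable (\<lambda>x. c + \<theta> * \<phi> x + \<theta>\<^sup>2 / 2 * (\<phi> x)\<^sup>2)" for c
    using \<phi> b2 by (intro bounded_measurable_add bounded_measurable_mult) auto
  have pt: "\<bar>exp (\<theta> * \<phi> x) - (1 + \<theta> * \<phi> x + \<theta>\<^sup>2 / 2 * (\<phi> x)\<^sup>2)\<bar> \<le> 2 * (\<theta> * C) ^ 3" for x
  proof -
    have u: "\<bar>\<theta> * \<phi> x\<bar> \<le> \<theta> * C" using C[of x] \<theta> by (simp add: abs_mult mult_left_mono)
    then have "\<bar>exp (\<theta> * \<phi> x) - (1 + \<theta> * \<phi> x + (\<theta> * \<phi> x)\<^sup>2 / 2)\<bar> \<le> 2 * \<bar>\<theta> * \<phi> x\<bar> ^ 3"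
      using \<theta> by (intro exp_taylor2) simp
    also have "\<dots> \<le> 2 * (\<theta> * C) ^ 3" using u by (simp add: power_mono)
    finally show ?thesis by (simp add: power_mult_distrib)
  qed
  have "E (\<lambda>x. exp (\<theta> * \<phi> x)) \<le> E (\<lambda>x. (1 + 2 * (\<theta> * C) ^ 3) + \<theta> * \<phi> x + \<theta>\<^sup>2 / 2 * (\<phi> x)\<^sup>2)"
    by (intro mono be bl) (use pt in \<open>smt (verit)\<close>)
  moreover have "E (\<lambda>x. (1 - 2 * (\<theta> * C) ^ 3) + \<theta> * \<phi> x + \<theta>\<^sup>2 / 2 * (\<phi> x)\<^sup>2) \<le> E (\<lambda>x. exp (\<theta> * \<phi> x))"
    by (intro mono be bl) (use pt in \<open>smt (verit)\<close>)
  ultimately show 1: "\<bar>E (\<lambda>x. exp (\<theta> * \<phi> x)) - (1 + \<theta> * E \<phi> + \<theta>\<^sup>2 / 2 * E (\<lambda>x. (\<phi> x)\<^sup>2))\<bar> \<le> 2 * (\<theta> * C) ^ 3"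
    unfolding lin[OF \<phi> b2] by linarith
  have "(\<phi> x)\<^sup>2 \<le> C\<^sup>2" for x using C[of x] C0 by (simp add: abs_le_square_iff[symmetric])
  then have "E (\<lambda>x. (\<phi> x)\<^sup>2) \<le> E (\<lambda>x. C\<^sup>2)" "E (\<lambda>x. 0) \<le> E (\<lambda>x. (\<phi> x)\<^sup>2)"
    by (intro mono b2; simp)+
  then show 2: "\<bar>E (\<lambda>x. (\<phi> x)\<^sup>2)\<bar> \<le> C\<^sup>2" by (simp add: const)
  have "\<theta>\<^sup>2 / 2 * E (\<lambda>x. (\<phi> x)\<^sup>2) \<le> \<theta>\<^sup>2 / 2 * C\<^sup>2" using 2 by (intro mult_left_mono) auto
  moreover have "(\<theta> * C) ^ 3 \<le> (\<theta> * C)\<^sup>2"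
    using power_decreasing[of 2 3 "\<theta> * C"] \<theta> C0 by simp
  moreover have "0 \<le> (\<theta> * C)\<^sup>2" by simp
  ultimately show "E (\<lambda>x. exp (\<theta> * \<phi> x)) \<le> 1 + \<theta> * E \<phi> + 3 * (\<theta> * C)\<^sup>2"
    using 1 by (simp add: power_mult_distrib) 
qed

text \<open>The mean \<open>A\<close> is small but not of order \<theta>, so the term
  \<open>\<theta> * A\<close> is kept exactly. With \<open>z = r - 1\<close> one has
  \<open>\<bar>z\<bar> \<le> \<theta> * \<epsilon> / 2\<close>. Three errors add up to
  \<open>\<theta>\<^sup>2 * \<epsilon>\<close>: one half for \<open>ln (1 + z)\<close> against
  \<open>z\<close>, one quarter for the cubic remainder, one quarter for \<open>v\<close> in place
  of \<open>B\<close>.\<close>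

lemma log_estimate:
  fixes \<theta> :: real
  assumes \<theta>: "0 < \<theta>" "\<theta> \<le> 1/2" "\<theta> * C \<le> 1" "3 * (\<theta> * C\<^sup>2) \<le> \<epsilon> / 4" "2 * (\<theta> * C ^ 3) \<le> \<epsilon> / 4"
    and C: "0 < C" and \<epsilon>: "0 < \<epsilon>" "\<epsilon> \<le> 1"
    and A: "\<bar>A\<bar> \<le> \<epsilon> / 4" and B: "\<bar>B - v\<bar> \<le> \<epsilon> / 2" "\<bar>B\<bar> \<le> C\<^sup>2"
    and r: "\<bar>r - (1 + \<theta> * A + \<theta>\<^sup>2 / 2 * B)\<bar> \<le> 2 * (\<theta> * C) ^ 3"
  shows "0 < r" "\<bar>ln r - (\<theta> * A + \<theta>\<^sup>2 / 2 * v)\<bar> \<le> \<theta>\<^sup>2 * \<epsilon>"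
proof -
  define z where "z = r - 1"
  have c3: "(\<theta> * C) ^ 3 \<le> \<theta> * (\<theta> * C\<^sup>2)"
  proof -
    have "(\<theta> * C) ^ 3 = (\<theta> * C) * (\<theta> * (\<theta> * C\<^sup>2))" by (simp add: power3_eq_cube power2_eq_square)
    also have "\<dots> \<le> 1 * (\<theta> * (\<theta> * C\<^sup>2))" using \<theta> C by (intro mult_right_mono) auto
    finally show ?thesis by simp
  qed
  have "\<bar>z\<bar> \<le> \<bar>\<theta> * A\<bar> + \<bar>\<theta>\<^sup>2 / 2 * B\<bar> + 2 * (\<theta> * C) ^ 3" using r unfolding z_def by linarith
  also have "\<bar>\<theta> * A\<bar> \<le> \<theta> * (\<epsilon> / 4)" using A \<theta> by (simp add: abs_mult)
  also have "\<bar>\<theta>\<^sup>2 / 2 * B\<bar> \<le> \<theta> * (\<theta> * C\<^sup>2)"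
  proof -
    have "\<bar>\<theta>\<^sup>2 / 2 * B\<bar> = \<theta>\<^sup>2 * \<bar>B\<bar> / 2" by (simp add: abs_mult)
    also have "\<dots> \<le> \<theta>\<^sup>2 * C\<^sup>2" using mult_left_mono[OF B(2), of "\<theta>\<^sup>2"] 
      by (simp add: field_simps) (smt (verit, best) zero_le_power2 mult_nonneg_nonneg)
    finally show ?thesis by (simp add: power2_eq_square)
  qed
  finally have "\<bar>z\<bar> \<le> \<theta> * (\<epsilon> / 4) + \<theta> * (3 * (\<theta> * C\<^sup>2))" using c3 by simp
  also have "\<dots> \<le> \<theta> * (\<epsilon> / 4) + \<theta> * (\<epsilon> / 4)" using \<theta> by (intro add_left_mono mult_left_mono) auto
  finally have z: "\<bar>z\<bar> \<le> \<theta> * (\<epsilon> / 2)" by (simp add: mult.commute)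
  have "\<theta> * (\<epsilon> / 2) \<le> (1/2) * (1/2)" using \<theta> \<epsilon> by (intro mult_mono) auto
  then have z2: "\<bar>z\<bar> \<le> 1/2" using z by linarith
  then show "0 < r" unfolding z_def by linarith
  have "\<bar>ln (1 + z) - z\<bar> \<le> 2 * z\<^sup>2" by (rule abs_ln_one_plus_x_minus_x_bound[OF z2])
  also have "z\<^sup>2 \<le> (\<theta> * (\<epsilon> / 2))\<^sup>2" using z \<theta> \<epsilon> by (simp add: abs_le_square_iff[symmetric])
  also have "2 * (\<theta> * (\<epsilon> / 2))\<^sup>2 = \<theta>\<^sup>2 * (\<epsilon> * \<epsilon> / 2)" by (simp add: power2_eq_square)
  also have "\<dots> \<le> \<theta>\<^sup>2 * (\<epsilon> / 2)" using \<epsilon> by (intro mult_left_mono) auto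
  finally have l: "\<bar>ln (1 + z) - z\<bar> \<le> \<theta>\<^sup>2 * (\<epsilon> / 2)" by simp
  have q: "\<bar>z - (\<theta> * A + \<theta>\<^sup>2 / 2 * B)\<bar> \<le> \<theta>\<^sup>2 * (\<epsilon> / 4)"
  proof -
    have "\<bar>z - (\<theta> * A + \<theta>\<^sup>2 / 2 * B)\<bar> \<le> 2 * (\<theta> * C) ^ 3" using r unfolding z_def by linarith
    also have "\<dots> = \<theta>\<^sup>2 * (2 * (\<theta> * C ^ 3))" by (simp add: power2_eq_square power3_eq_cube)
    also have "\<dots> \<le> \<theta>\<^sup>2 * (\<epsilon> / 4)" using \<theta> by (intro mult_left_mono) auto
    finally show ?thesis .
  qed
  have p: "\<bar>\<theta>\<^sup>2 / 2 * B - \<theta>\<^sup>2 / 2 * v\<bar> \<le> \<theta>\<^sup>2 * (\<epsilon> / 4)"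
  proof -
    have "\<bar>\<theta>\<^sup>2 / 2 * B - \<theta>\<^sup>2 / 2 * v\<bar> = \<theta>\<^sup>2 / 2 * \<bar>B - v\<bar>"
      unfolding right_diff_distrib[symmetric] abs_mult by simp
    also have "\<dots> \<le> \<theta>\<^sup>2 / 2 * (\<epsilon> / 2)" using B by (intro mult_left_mono) auto
    finally show ?thesis by simp
  qed
  have "ln r = ln (1 + z)" by (simp add: z_def)
  moreover have "\<theta>\<^sup>2 * (\<epsilon> / 2) = \<theta>\<^sup>2 * \<epsilon> / 2" "\<theta>\<^sup>2 * (\<epsilon> / 4) = \<theta>\<^sup>2 * \<epsilon> / 4" by auto
  ultimately show "\<bar>ln r - (\<theta> * A + \<theta>\<^sup>2 / 2 * v)\<bar> \<le> \<theta>\<^sup>2 * \<epsilon>"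
    using l q p by linarith
qed

lemma small_theta:
  fixes C \<epsilon> :: real
  assumes "0 < C" "0 < \<epsilon>"
  obtains \<eta> where "\<eta> > 0" "\<And>\<theta>. 0 < \<theta> \<Longrightarrow> \<theta> \<le> \<eta> \<Longrightarrow>
     \<theta> \<le> 1/2 \<and> \<theta> * C \<le> 1 \<and> 3 * (\<theta> * C\<^sup>2) \<le> \<epsilon> / 4 \<and> 2 * (\<theta> * C ^ 3) \<le> \<epsilon> / 4"
proof (rule that[of "min (min (1/2) (1/C)) (min (\<epsilon> / (12 * C\<^sup>2)) (\<epsilon> / (8 * C ^ 3)))"])
  show "0 < min (min (1/2) (1/C)) (min (\<epsilon> / (12 * C\<^sup>2)) (\<epsilon> / (8 * C ^ 3)))"
    using assms by simp
qed (use assms in \<open>auto simp: pos_le_divide_eq mult_ac\<close>)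

section \<open>Expansion of the one-step factor\<close>

context hidden_markov_filter
begin

lemma mean_functional_m:
  assumes "t \<le> T"
  shows "mean_functional (m t)"
  unfolding mean_functional_def
proof (intro conjI allI impI)
  fix f g :: "real^'d \<Rightarrow> real" and c c1 c2
  assume "bounded_measurable f" "bounded_measurable g"
  moreover from this have "bounded_measurable (\<lambda>x. c + c1 * f x)" "bounded_measurable (\<lambda>x. c1 * f x)" "bounded_measurable (\<lambda>x. c2 * g x)"
    by (intro bounded_measurable_add bounded_measurable_mult; simp)+
  ultimately show "m t (\<lambda>x. c + c1 * f x + c2 * g x) = c + c1 * m t f + c2 * m t g"
    using assms by (simp add: m_add m_cmult m_const)
qed (use assms m_mono in blast)

lemma mean_functional_particles:
  assumes t: "t \<in> {1..T}" and N: "(N::nat) > 0"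
  shows "mean_functional (\<lambda>g. (\<Sum>i<N. L t g (xs i)) / (\<Sum>i<N. L t (\<lambda>_. 1) (xs i)))"
  unfolding mean_functional_def
proof (intro conjI allI impI)
  fix f g :: "real^'d \<Rightarrow> real" and c c1 c2
  assume fg: "bounded_measurable f" "bounded_measurable g"
  then have b: "bounded_measurable (\<lambda>x. c + c1 * f x)" "bounded_measurable (\<lambda>x. c1 * f x)" "bounded_measurable (\<lambda>x. c2 * g x)"
    by (intro bounded_measurable_add bounded_measurable_mult; simp)+
  have "L t (\<lambda>x. c + c1 * f x + c2 * g x) z = c * L t (\<lambda>_. 1) z + c1 * L t f z + c2 * L t g z" for z
    using t b by (simp add: L_add L_cmult L_const[of t c])
  then show "(\<Sum>i<N. L t (\<lambda>x. c + c1 * f x + c2 * g x) (xs i)) / (\<Sum>i<N. L t (\<lambda>_. 1) (xs i)) =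
     c + c1 * ((\<Sum>i<N. L t f (xs i)) / (\<Sum>i<N. L t (\<lambda>_. 1) (xs i))) + c2 * ((\<Sum>i<N. L t g (xs i)) / (\<Sum>i<N. L t (\<lambda>_. 1) (xs i)))"
    using sum_L1_pos[OF N t, of xs]
    by (simp add: sum.distrib sum_distrib_left[symmetric] add_divide_distrib)
next
  fix f g :: "real^'d \<Rightarrow> real"
  assume fg: "bounded_measurable f" "bounded_measurable g" "\<forall>x. f x \<le> g x"
  then show "(\<Sum>i<N. L t f (xs i)) / (\<Sum>i<N. L t (\<lambda>_. 1) (xs i)) \<le> (\<Sum>i<N. L t g (xs i)) / (\<Sum>i<N. L t (\<lambda>_. 1) (xs i))"
    using sum_L1_pos[OF N t, of xs] by (intro divide_right_mono sum_mono L_mono[OF t]) auto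
qed

text \<open>The fluctuation without scaling: \<open>MN\<close> is \<open>dev\<close> divided by
  \<open>bN N / sqrt N\<close>. The good events bound \<open>dev\<close> itself by a
  constant.\<close>

definition dev :: "nat \<Rightarrow> nat \<Rightarrow> (real^'d \<Rightarrow> real) \<Rightarrow> (nat \<Rightarrow> nat \<Rightarrow> real^'d) \<Rightarrow> real" where
  "dev N t g X = (\<Sum>i<N. g (X t i)) / real N - m t g"

lemma dev_cmult: "dev N t (\<lambda>x. c * g x) X = c * dev N t g X"
  by (simp add: dev_def m_cmult right_diff_distrib flip: sum_distrib_left)

lemma dev_add:
  assumes "t \<le> T" "bounded_measurable g" "bounded_measurable h"
  shows "dev N t (\<lambda>x. g x + h x) X = dev N t g X + dev N t h X"
  using assms by (simp add: dev_def m_add sum.distrib add_divide_distrib)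

lemma dev_meas:
  assumes "s \<le> t" "bounded_measurable g"
  shows "dev N s g \<in> borel_measurable (path_space N t)"
  unfolding dev_def
  by (intro borel_measurable_diff borel_measurable_divide borel_measurable_sum borel_measurable_const
      measurable_compose[OF coordinate_meas bounded_measurableD[OF assms(2)]] assms(1)) auto

lemma dev_bound:
  assumes "t \<le> T" "bounded_measurable g" "\<And>x. \<bar>g x\<bar> \<le> C" "N > 0"
  shows "\<bar>dev N t g X\<bar> \<le> 2 * C"
proof -
  have "\<bar>\<Sum>i<N. g (X t i)\<bar> \<le> (\<Sum>i<N. C)" by (intro order_trans[OF sum_abs] sum_mono assms)
  then have "\<bar>(\<Sum>i<N. g (X t i)) / real N\<bar> \<le> C" using assms(4) by (simp add: abs_divide field_simps)
  moreover have "m t (\<lambda>_. - C) \<le> m t g" "m t g \<le> m t (\<lambda>_. C)"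
    using assms(3) by (intro m_mono assms(1,2) bounded_measurable_const; meson abs_le_D1 abs_le_D2 minus_le_iff)+
  then have "\<bar>m t g\<bar> \<le> C" using assms(1) by (simp add: m_const)
  ultimately show ?thesis unfolding dev_def by linarith
qed

lemma dev_L:
  assumes t: "Suc t \<le> T" and g: "bounded_measurable g"
  shows "(\<Sum>i<N. L (Suc t) g (X t i)) / real N = dev N t (L (Suc t) g) X + \<kappa> (Suc t) * m (Suc t) g"
  using m_Suc[OF t g] by (simp add: dev_def)

lemma particle_mean_eq:
  assumes t: "Suc t \<le> T" and N: "N > 0" and g: "bounded_measurable g"
  shows "(\<Sum>i<N. L (Suc t) g (X t i)) / (\<Sum>i<N. L (Suc t) (\<lambda>_. 1) (X t i)) =
    (dev N t (L (Suc t) g) X + \<kappa> (Suc t) * m (Suc t) g) / (dev N t (L (Suc t) (\<lambda>_. 1)) X + \<kappa> (Suc t))"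
proof -
  have "(\<Sum>i<N. L (Suc t) g (X t i)) / (\<Sum>i<N. L (Suc t) (\<lambda>_. 1) (X t i)) =
      ((\<Sum>i<N. L (Suc t) g (X t i)) / real N) / ((\<Sum>i<N. L (Suc t) (\<lambda>_. 1) (X t i)) / real N)"
    using N by simp
  then show ?thesis
    unfolding dev_L[OF t g] dev_L[OF t bounded_measurable_const] using t by (simp add: m_const)
qed

text \<open>Let \<open>dc\<close> and \<open>d1\<close> be the deviations of \<open>L c\<close> and
  \<open>L 1\<close>, and \<open>k = \<kappa> (Suc t)\<close>. A new particle gives \<open>c\<close>
  the mean \<open>dc / (d1 + k)\<close>, while the pullback has deviation \<open>dc / k\<close>;
  their relative difference is at most \<open>\<bar>d1 / (d1 + k)\<bar> \<le> \<epsilon>\<close>.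
  The error is thus proportional to the deviation itself, which explains the last term of the bound.
  The third function controls the conditional second moment of \<open>c\<close>.\<close>

lemma step_log_estimate:
  assumes t: "Suc t \<le> T" and \<phi>: "bounded_measurable \<phi>" and \<epsilon>: "0 < \<epsilon>" "\<epsilon> \<le> 1"
    and c_def: "c = ctr (Suc t) \<phi>" and v_def: "v = sigma2 mu a0 a b y (Suc t) \<phi>"
  obtains \<delta> \<eta> where "\<delta> > 0" "\<eta> > 0" "\<And>\<theta> N X. 0 < \<theta> \<Longrightarrow> \<theta> \<le> \<eta> \<Longrightarrow> N > 0 \<Longrightarrow>
     \<forall>g\<in>{L (Suc t) c, L (Suc t) (\<lambda>_. 1), L (Suc t) (\<lambda>x. (c x)\<^sup>2)}. \<bar>dev N t g X\<bar> < \<delta> \<Longrightarrow>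
     0 < (\<Sum>i<N. L (Suc t) (\<lambda>x. exp (\<theta> * c x)) (X t i)) / (\<Sum>i<N. L (Suc t) (\<lambda>_. 1) (X t i)) \<and>
     \<bar>ln ((\<Sum>i<N. L (Suc t) (\<lambda>x. exp (\<theta> * c x)) (X t i)) / (\<Sum>i<N. L (Suc t) (\<lambda>_. 1) (X t i)))
       - (\<theta> * dev N t (pullback t \<phi>) X + \<theta>\<^sup>2 / 2 * v)\<bar> \<le> \<theta>\<^sup>2 * \<epsilon> + \<epsilon> * (\<theta> * \<bar>dev N t (pullback t \<phi>) X\<bar>)"
proof -
  have tT: "Suc t \<in> {1..T}" using t by simp
  have c: "bounded_measurable c" unfolding c_def by (intro ctr_bounded_measurable \<phi>)
  have c2: "bounded_measurable (\<lambda>x. (c x)\<^sup>2)" by (intro bounded_measurable_power c)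
  obtain C where C: "C > 0" "\<And>x. \<bar>c x\<bar> \<le> C" using c by (metis bounded_measurableE)
  obtain \<eta> where \<eta>: "\<eta> > 0" "\<And>\<theta>. 0 < \<theta> \<Longrightarrow> \<theta> \<le> \<eta> \<Longrightarrow>
     \<theta> \<le> 1/2 \<and> \<theta> * C \<le> 1 \<and> 3 * (\<theta> * C\<^sup>2) \<le> \<epsilon> / 4 \<and> 2 * (\<theta> * C ^ 3) \<le> \<epsilon> / 4"
    using small_theta[OF C(1) \<epsilon>(1)] by metis
  define k where "k = \<kappa> (Suc t)"
  have k: "k > 0" unfolding k_def by (rule kappa_pos[OF t])
  have mc: "m (Suc t) c = 0" unfolding c_def using m_centered[OF t \<phi>] .
  have mc2: "m (Suc t) (\<lambda>x. (c x)\<^sup>2) = v" by (simp add: c_def v_def sigma2_eq power2_eq_square)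
  have v: "0 \<le> v" unfolding mc2[symmetric] using m_mono[OF t bounded_measurable_const[of 0] c2] t by (simp add: m_const)
  \<comment> \<open>Chosen so that \<open>\<delta> * (1 + v) = \<epsilon> * k / 8\<close>. This
    bounds \<open>\<bar>d2 - v * d1\<bar>\<close> in the second moment, keeps the denominator above
    \<open>k / 2\<close>, and makes the conditional mean at most
    \<open>\<epsilon> / 4\<close>.\<close>
  define \<delta> where "\<delta> = \<epsilon> * k / (8 * (1 + v))"
  have \<delta>: "\<delta> > 0" using \<epsilon> k v by (simp add: \<delta>_def)
  have \<delta>v: "\<delta> * (1 + v) = \<epsilon> * k / 8" using v by (simp add: \<delta>_def field_simps)
  have "\<delta> \<le> \<delta> * (1 + v)" using \<delta> v by (simp add: distrib_left)
  then have \<delta>k: "\<delta> \<le> \<epsilon> * k / 8" using \<delta>v by simp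
  have ek: "\<epsilon> * k \<le> k" using \<epsilon> k by (simp add: mult_left_le_one_le)
  then have \<delta>k2: "\<delta> \<le> k / 2" using \<delta>k k ek by linarith
  show ?thesis
  proof (rule that[OF \<delta> \<eta>(1)], goal_cases)
    case (1 \<theta> N X)
    let ?d1 = "dev N t (L (Suc t) (\<lambda>_. 1)) X" and ?dc = "dev N t (L (Suc t) c) X" and ?d2 = "dev N t (L (Suc t) (\<lambda>x. (c x)\<^sup>2)) X"
    define E where "E = (\<lambda>g. (\<Sum>i<N. L (Suc t) g (X t i)) / (\<Sum>i<N. L (Suc t) (\<lambda>_. 1) (X t i)))"
    have E: "mean_functional E" unfolding E_def by (rule mean_functional_particles[OF tT 1(3)])
    have d: "\<bar>?d1\<bar> < \<delta>" "\<bar>?dc\<bar> < \<delta>" "\<bar>?d2\<bar> < \<delta>" using 1(4) by auto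
    have Eq: "E g = (dev N t (L (Suc t) g) X + k * m (Suc t) g) / (?d1 + k)" if g: "bounded_measurable g" for g
      unfolding E_def k_def by (rule particle_mean_eq[OF t 1(3) g])
    have den: "?d1 + k \<ge> k / 2" using d \<delta>k2 by linarith
    have den0: "?d1 + k > 0" using den k by linarith
    have quot: "\<bar>z / (?d1 + k)\<bar> \<le> q" if "\<bar>z\<bar> \<le> q * (k / 2)" "0 \<le> q" for z q
    proof -
      have "\<bar>z\<bar> \<le> q * (?d1 + k)" using that mult_left_mono[OF den that(2)] by linarith
      then show ?thesis using den0 by (simp add: abs_divide pos_divide_le_eq)
    qed
    have A: "\<bar>E c\<bar> \<le> \<epsilon> / 4" unfolding Eq[OF c] mc
      using d \<delta>k \<epsilon> by (intro quot) auto
    have "E (\<lambda>x. (c x)\<^sup>2) - v = (?d2 - v * ?d1) / (?d1 + k)"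
      unfolding Eq[OF c2] mc2 using den0 by (simp add: field_simps)
    also have "\<bar>\<dots>\<bar> \<le> \<epsilon> / 2"
    proof (rule quot)
      have "\<bar>?d2 - v * ?d1\<bar> \<le> \<bar>?d2\<bar> + v * \<bar>?d1\<bar>" using v abs_triangle_ineq4[of ?d2 "v * ?d1"] by (simp add: abs_mult)
      also have "\<dots> \<le> \<delta> + v * \<delta>" using d v by (intro add_mono mult_left_mono) auto
      also have "\<dots> = \<epsilon> * k / 8" using \<delta>v by (simp add: algebra_simps)
      finally show "\<bar>?d2 - v * ?d1\<bar> \<le> \<epsilon> / 2 * (k / 2)" using mult_pos_pos[OF \<epsilon>(1) k] by simp
    qed (use \<epsilon> in simp)
    finally have B: "\<bar>E (\<lambda>x. (c x)\<^sup>2) - v\<bar> \<le> \<epsilon> / 2" .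
    have \<theta>: "\<theta> \<le> 1/2" "\<theta> * C \<le> 1" "3 * (\<theta> * C\<^sup>2) \<le> \<epsilon> / 4" "2 * (\<theta> * C ^ 3) \<le> \<epsilon> / 4"
      using \<eta>(2)[OF 1(1,2)] by auto
    note mf = mean_functional_exp[OF E c C(2) less_imp_le[OF 1(1)] \<theta>(2)]
    note le = log_estimate[OF 1(1) \<theta> C(1) \<epsilon> A B mf(2) mf(1)]
    have DH: "dev N t (pullback t \<phi>) X = ?dc / k"
      using dev_cmult[of N t "1 / k" "L (Suc t) c" X] by (simp add: pullback_def c_def k_def)
    have "\<bar>E c - dev N t (pullback t \<phi>) X\<bar> \<le> \<epsilon> * \<bar>dev N t (pullback t \<phi>) X\<bar>"
    proof -
      have "E c - dev N t (pullback t \<phi>) X = dev N t (pullback t \<phi>) X * (- (?d1 / (?d1 + k)))"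
        unfolding Eq[OF c] mc DH using den0 k by (simp add: field_simps)
      moreover have "\<bar>?d1 / (?d1 + k)\<bar> \<le> \<epsilon>" using d \<delta>k \<epsilon> k by (intro quot) (auto simp: field_simps intro: order_trans)
      then have "\<bar>dev N t (pullback t \<phi>) X * (- (?d1 / (?d1 + k)))\<bar> \<le> \<epsilon> * \<bar>dev N t (pullback t \<phi>) X\<bar>"
        unfolding abs_mult abs_minus_cancel by (subst mult.commute) (intro mult_right_mono, auto)
      ultimately show ?thesis by simp
    qed
    then have "\<bar>\<theta> * E c - \<theta> * dev N t (pullback t \<phi>) X\<bar> \<le> \<epsilon> * (\<theta> * \<bar>dev N t (pullback t \<phi>) X\<bar>)"
      using mult_left_mono[of "\<bar>E c - dev N t (pullback t \<phi>) X\<bar>" "\<epsilon> * \<bar>dev N t (pullback t \<phi>) X\<bar>" \<theta>] 1(1)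
      by (simp add: abs_mult mult.left_commute flip: right_diff_distrib)
    then have "\<bar>ln (E (\<lambda>x. exp (\<theta> * c x))) - (\<theta> * dev N t (pullback t \<phi>) X + \<theta>\<^sup>2 / 2 * v)\<bar> \<le> \<theta>\<^sup>2 * \<epsilon> + \<epsilon> * (\<theta> * \<bar>dev N t (pullback t \<phi>) X\<bar>)"
      using le(2) by linarith
    then show ?case using le(1) unfolding E_def by simp
  qed
qed

end

section \<open>Deviations of order one have exponentially small probability\<close>

definition exp_small :: "(nat \<Rightarrow> ennreal) \<Rightarrow> bool" where
  "exp_small p \<longleftrightarrow> (\<exists>c>0. rate_le real p (- c))"

lemma real_at_top: "filterlim real at_top sequentially"
  by (rule filterlim_real_sequentially)

lemma exp_small_mono:
  assumes "exp_small q" "\<forall>\<^sub>F N in sequentially. p N \<le> q N"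
  shows "exp_small p"
  using assms rate_le_mono[OF real_at_top _ assms(2) order_refl] unfolding exp_small_def by blast

lemma exp_small_add:
  assumes "exp_small p" "exp_small q"
  shows "exp_small (\<lambda>N. p N + q N)"
proof -
  obtain c d where c: "c > 0" "rate_le real p (- c)" and d: "d > 0" "rate_le real q (- d)"
    using assms by (auto simp: exp_small_def)
  have "rate_le real p (- min c d)" using c by (intro rate_le_mono[OF real_at_top c(2)]) auto
  moreover have "rate_le real q (- min c d)" using d by (intro rate_le_mono[OF real_at_top d(2)]) auto
  ultimately show ?thesis
    unfolding exp_small_def using c d by (intro exI[of _ "min c d"]) (auto intro: rate_le_add[OF real_at_top])
qed

lemma exp_small_exp: "c > 0 \<Longrightarrow> exp_small (\<lambda>N. ennreal (exp (- (c * real N))))"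
  unfolding exp_small_def rate_le_def by (intro exI[of _ c]) (auto simp: algebra_simps)

text \<open>Each factor satisfies \<open>r \<le> 1 + \<rho> * \<epsilon> / 2 \<le> exp (\<rho> *
  \<epsilon> / 2)\<close>, so half of the exponent \<open>\<rho> * \<epsilon>\<close>
  survives.\<close>

lemma chernoff_power:
  fixes r :: real
  assumes r: "0 \<le> r" "r \<le> 1 + \<rho> * A + 3 * (\<rho> * C)\<^sup>2" and A: "A \<le> \<epsilon> / 4" and \<rho>: "0 < \<rho>" "3 * (\<rho> * C\<^sup>2) \<le> \<epsilon> / 4"
  shows "exp (- (\<rho> * \<epsilon> * real N)) * r ^ N \<le> exp (- (\<rho> * \<epsilon> / 2 * real N))"
proof -
  have "r \<le> 1 + (\<rho> * A + \<rho> * (3 * (\<rho> * C\<^sup>2)))" using r(2) by (simp add: power2_eq_square mult_ac)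
  also have "\<dots> \<le> 1 + (\<rho> * (\<epsilon> / 4) + \<rho> * (\<epsilon> / 4))"
    using A \<rho> by (intro add_left_mono add_mono mult_left_mono) auto
  also have "\<dots> = 1 + \<rho> * \<epsilon> / 2" by simp
  also have "\<dots> \<le> exp (\<rho> * \<epsilon> / 2)" by (rule exp_ge_add_one_self)
  finally have "r ^ N \<le> exp (\<rho> * \<epsilon> / 2) ^ N" using r by (intro power_mono) auto
  then have "r ^ N \<le> exp (real N * (\<rho> * \<epsilon> / 2))" by (simp only: exp_of_nat_mult)
  then have "exp (- (\<rho> * \<epsilon> * real N)) * r ^ N \<le> exp (- (\<rho> * \<epsilon> * real N)) * exp (real N * (\<rho> * \<epsilon> / 2))"
    by (intro mult_left_mono) auto
  also have "\<dots> = exp (- (\<rho> * \<epsilon> / 2 * real N))" by (simp add: field_simps flip: exp_add)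
  finally show ?thesis .
qed

context hidden_markov_filter
begin

definition far where "far N t G \<delta> = {X. \<exists>g\<in>G. \<delta> \<le> \<bar>dev N t g X\<bar>}"

lemma far_meas:
  assumes "s \<le> t" "finite G" "\<And>g. g \<in> G \<Longrightarrow> bounded_measurable g"
  shows "far N s G \<delta> \<inter> space (path_space N t) \<in> sets (path_space N t)"
proof -
  have "{X \<in> space (path_space N t). \<exists>g\<in>G. \<delta> \<le> \<bar>dev N s g X\<bar>} \<in> sets (path_space N t)"
  proof (rule sets.sets_Collect_finite_Ex[OF _ assms(2)])
    fix g assume "g \<in> G"
    then have [measurable]: "dev N s g \<in> borel_measurable (path_space N t)" by (intro dev_meas assms)
    show "{X \<in> space (path_space N t). \<delta> \<le> \<bar>dev N s g X\<bar>} \<in> sets (path_space N t)" by measurable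
  qed
  moreover have "far N s G \<delta> \<inter> space (path_space N t) = {X \<in> space (path_space N t). \<exists>g\<in>G. \<delta> \<le> \<bar>dev N s g X\<bar>}"
    by (auto simp: far_def)
  ultimately show ?thesis by simp
qed

lemma far_indicator_meas:
  assumes "s \<le> t" "finite G" "\<And>g. g \<in> G \<Longrightarrow> bounded_measurable g"
  shows "(indicator (far N s G \<delta>) :: _ \<Rightarrow> ennreal) \<in> borel_measurable (path_space N t)"
  using far_meas[OF assms] by (simp add: borel_measurable_indicator_iff)

lemma upper_indicator_meas:
  assumes "s \<le> t" "bounded_measurable g"
  shows "(indicator {X. \<epsilon> \<le> dev N s g X} :: _ \<Rightarrow> ennreal) \<in> borel_measurable (path_space N t)"
proof -
  have [measurable]: "dev N s g \<in> borel_measurable (path_space N t)" by (intro dev_meas assms)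
  have "{X. \<epsilon> \<le> dev N s g X} \<inter> space (path_space N t) = {X \<in> space (path_space N t). \<epsilon> \<le> dev N s g X}" by auto
  also have "\<dots> \<in> sets (path_space N t)" by measurable
  finally show ?thesis by (simp add: borel_measurable_indicator_iff)
qed

text \<open>An integral of an indicator rather than \<open>emeasure\<close>: the event is not
  intersected with the space of \<open>pf N t\<close>, and \<open>emeasure\<close> is 0 by default
  on sets outside the sigma-algebra.\<close>

definition upper_tail where
  "upper_tail N t g \<epsilon> = (\<integral>\<^sup>+X. indicator {X. \<epsilon> \<le> dev N t g X} X \<partial>pf N t)"

definition far_prob where
  "far_prob N t G \<delta> = (\<integral>\<^sup>+X. indicator (far N t G \<delta>) X \<partial>pf N t)"

text \<open>A union bound over the finitely many functions and over both signs, a lower tail of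
  \<open>g\<close> being an upper tail of \<open>- g\<close>. The one-sided tails are a hypothesis
  because the lemma is applied inside the induction that proves them.\<close>

lemma exp_small_far:
  assumes t: "t \<le> T" and up: "\<And>g. bounded_measurable g \<Longrightarrow> exp_small (\<lambda>N. upper_tail N t g \<delta>)"
    and G: "finite G" "\<And>g. g \<in> G \<Longrightarrow> bounded_measurable g"
  shows "exp_small (\<lambda>N. far_prob N t G \<delta>)"
  using G
proof (induction G rule: finite_induct)
  case empty
  then show ?case
    by (intro exp_small_mono[OF exp_small_exp[OF zero_less_one]]) (auto simp: far_prob_def far_def)
next
  case (insert g G)
  let ?g' = "\<lambda>x. - 1 * g x"
  have g: "bounded_measurable g" "bounded_measurable ?g'"
    using insert bounded_measurable_mult[OF bounded_measurable_const[of "-1"], of g] by simp_all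
  have "exp_small (\<lambda>N. upper_tail N t g \<delta> + upper_tail N t ?g' \<delta> + far_prob N t G \<delta>)"
    using insert g by (intro exp_small_add up) auto
  then show ?case
  proof (rule exp_small_mono)
    show "\<forall>\<^sub>F N in sequentially. far_prob N t (insert g G) \<delta> \<le> upper_tail N t g \<delta> + upper_tail N t ?g' \<delta> + far_prob N t G \<delta>"
      using eventually_gt_at_top[of 0]
    proof eventually_elim
      case (elim N)
      note [measurable_cong] = sets_pf[OF t elim]
      have pf_m: "h \<in> borel_measurable (pf N t)" if "h \<in> borel_measurable (path_space N t)" for h :: "_ \<Rightarrow> ennreal"
        using that by (simp cong: measurable_cong_sets)
      note ind_m = upper_indicator_meas[OF order_refl g(1), THEN pf_m] upper_indicator_meas[OF order_refl g(2), THEN pf_m]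
        far_indicator_meas[OF order_refl, of G N t, THEN pf_m]
      have "far_prob N t (insert g G) \<delta> \<le>
        (\<integral>\<^sup>+X. (indicator {X. \<delta> \<le> dev N t g X} X + indicator {X. \<delta> \<le> dev N t ?g' X} X) + indicator (far N t G \<delta>) X \<partial>pf N t)"
        unfolding far_prob_def
      proof (rule nn_integral_mono)
        fix X
        show "indicator (far N t (insert g G) \<delta>) X \<le> ((indicator {X. \<delta> \<le> dev N t g X} X + indicator {X. \<delta> \<le> dev N t ?g' X} X) + indicator (far N t G \<delta>) X :: ennreal)"
        proof (cases "X \<in> far N t (insert g G) \<delta>")
          case True
          then have "\<delta> \<le> dev N t g X \<or> \<delta> \<le> dev N t ?g' X \<or> X \<in> far N t G \<delta>"
            unfolding dev_cmult by (auto simp: far_def)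
          then show ?thesis by (auto simp: indicator_def add_increasing add_increasing2)
        qed simp
      qed
      also have "\<dots> = upper_tail N t g \<delta> + upper_tail N t ?g' \<delta> + far_prob N t G \<delta>"
        unfolding upper_tail_def far_prob_def using ind_m insert
        by (simp add: nn_integral_add)
      finally show ?case .
    qed
  qed
qed

lemma sum_ctr:
  assumes "N > 0"
  shows "(\<Sum>i<N. ctr t g (X t i)) = real N * dev N t g X"
  using assms by (simp add: dev_def sum_subtractf field_simps)

lemma prod_exp_ctr:
  assumes "N > 0"
  shows "(\<Prod>i<N. exp (\<theta> * ctr t g (X t i))) = exp (real N * (\<theta> * dev N t g X))"
proof -
  have "(\<Prod>i<N. exp (\<theta> * ctr t g (X t i))) = exp (\<theta> * (\<Sum>i<N. ctr t g (X t i)))"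
    by (simp add: exp_sum sum_distrib_left)
  then show ?thesis using sum_ctr[OF assms, where t = t and g = g and X = X] by (simp add: mult.left_commute)
qed

text \<open>Induction over time, for all functions and thresholds at once. If the means of
  \<open>L c\<close> and \<open>L 1\<close> at time \<open>t\<close> are close to their limits, a
  new particle gives \<open>c\<close> a mean of at most \<open>\<epsilon> / 4\<close>, and
  Chernoff's bound with a fixed small \<rho> applies conditionally. Otherwise the induction
  hypothesis applies.\<close>

lemma exp_small_upper_tail:
  assumes "t \<le> T" "bounded_measurable g" "\<epsilon> > 0"
  shows "exp_small (\<lambda>N. upper_tail N t g \<epsilon>)"
  using assms
proof (induction t arbitrary: g \<epsilon>)
  case (0 g \<epsilon>)
  define c where "c = ctr 0 g"
  have c: "bounded_measurable c" unfolding c_def by (intro ctr_bounded_measurable 0)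
  obtain C where C: "C > 0" "\<And>x. \<bar>c x\<bar> \<le> C" using c by (metis bounded_measurableE)
  obtain \<rho> where \<rho>: "\<rho> > 0" "\<rho> * C \<le> 1" "3 * (\<rho> * C\<^sup>2) \<le> \<epsilon> / 4"
    using small_theta[OF C(1) 0(3)] by (metis order_refl)
  have e: "bounded_measurable (\<lambda>x. exp (\<rho> * c x))" using c by (intro bounded_measurable_exp bounded_measurable_mult) auto
  define r where "r = m 0 (\<lambda>x. exp (\<rho> * c x))"
  have r0: "0 \<le> r" unfolding r_def using m_mono[of 0 "\<lambda>_. 0", OF _ _ e] by (simp add: m_const)
  have mc: "m 0 c = 0" unfolding c_def using 0 by (intro m_centered) auto
  have r1: "r \<le> 1 + \<rho> * 0 + 3 * (\<rho> * C)\<^sup>2"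
    using mean_functional_exp(3)[OF mean_functional_m c C(2) less_imp_le[OF \<rho>(1)] \<rho>(2), of 0] by (simp add: r_def mc)
  show ?case
  proof (rule exp_small_mono)
    show "exp_small (\<lambda>N. ennreal (exp (- (\<rho> * \<epsilon> / 2 * real N))))"
      using \<rho> 0 by (intro exp_small_exp) simp
    show "\<forall>\<^sub>F N in sequentially. upper_tail N 0 g \<epsilon> \<le> ennreal (exp (- (\<rho> * \<epsilon> / 2 * real N)))"
      using eventually_gt_at_top[of 0]
    proof eventually_elim
      case (elim N)
      note [measurable_cong] = sets_pf[OF 0(1) elim]
      have [measurable]: "dev N 0 g \<in> borel_measurable (path_space N 0)" using 0 by (intro dev_meas) auto
      define F where "F X = ennreal (exp (real N * (\<rho> * dev N 0 g X)))" for X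
      have F [measurable]: "F \<in> borel_measurable (path_space N 0)" unfolding F_def by measurable
      have "upper_tail N 0 g \<epsilon> \<le> (\<integral>\<^sup>+X. ennreal (exp (- (\<rho> * \<epsilon> * real N))) * F X \<partial>pf N 0)"
        unfolding upper_tail_def
      proof (rule nn_integral_mono)
        fix X
        show "indicator {X. \<epsilon> \<le> dev N 0 g X} X \<le> ennreal (exp (- (\<rho> * \<epsilon> * real N))) * F X"
        proof (cases "\<epsilon> \<le> dev N 0 g X")
          case True
          then have "0 \<le> real N * (\<rho> * (dev N 0 g X - \<epsilon>))" using \<rho> by simp
          then have "1 \<le> ennreal (exp (real N * (\<rho> * (dev N 0 g X - \<epsilon>))))" by simp
          then show ?thesis using True by (simp add: F_def algebra_simps flip: ennreal_mult exp_add)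
        qed simp
      qed
      also have "\<dots> = ennreal (exp (- (\<rho> * \<epsilon> * real N))) * (\<integral>\<^sup>+X. F X \<partial>pf N 0)"
        by (rule nn_integral_cmult) measurable
      also have "(\<integral>\<^sup>+X. F X \<partial>pf N 0) = ennreal (r ^ N)"
        unfolding r_def by (intro pf_0_nn_integral F e) (auto simp: F_def c_def prod_exp_ctr[OF elim])
      also have "ennreal (exp (- (\<rho> * \<epsilon> * real N))) * ennreal (r ^ N) \<le> ennreal (exp (- (\<rho> * \<epsilon> / 2 * real N)))"
        using chernoff_power[OF r0 r1 _ \<rho>(1,3)] r0 0 by (simp flip: ennreal_mult)
      finally show ?case .
    qed
  qed
next
  case (Suc t g \<epsilon>)
  then have t: "Suc t \<le> T" "t \<le> T" and \<epsilon>: "\<epsilon> > 0" by auto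
  have tT: "Suc t \<in> {1..T}" using t by simp
  define c where "c = ctr (Suc t) g"
  have c: "bounded_measurable c" unfolding c_def by (intro ctr_bounded_measurable Suc)
  obtain C where C: "C > 0" "\<And>x. \<bar>c x\<bar> \<le> C" using c by (metis bounded_measurableE)
  obtain \<rho> where \<rho>: "\<rho> > 0" "\<rho> * C \<le> 1" "3 * (\<rho> * C\<^sup>2) \<le> \<epsilon> / 4"
    using small_theta[OF C(1) \<epsilon>] by (metis order_refl)
  have e: "bounded_measurable (\<lambda>x. exp (\<rho> * c x))" using c by (intro bounded_measurable_exp bounded_measurable_mult) auto
  define k where "k = \<kappa> (Suc t)"
  have k: "k > 0" unfolding k_def by (rule kappa_pos[OF t(1)])
  have mc: "m (Suc t) c = 0" unfolding c_def using Suc by (intro m_centered) auto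
  define G where "G = {L (Suc t) c, L (Suc t) (\<lambda>_. 1)}"
  \<comment> \<open>The first term keeps the denominator of the conditional mean above
    \<open>k / 2\<close>; the second then bounds the quotient by
    \<open>\<epsilon> / 4\<close>.\<close>
  define \<delta> where "\<delta> = min (k / 2) (\<epsilon> * k / 8)"
  have \<delta>: "\<delta> > 0" using k \<epsilon> by (simp add: \<delta>_def)
  have G: "finite G" "\<And>g. g \<in> G \<Longrightarrow> bounded_measurable g"
    using L_bounded_measurable[OF tT] c by (auto simp: G_def)
  have small: "exp_small (\<lambda>N. far_prob N t G \<delta>)"
    by (rule exp_small_far[OF t(2) _ G]) (rule Suc.IH[OF t(2) _ \<delta>])
  show ?case
  proof (rule exp_small_mono)
    show "exp_small (\<lambda>N. far_prob N t G \<delta> + ennreal (exp (- (\<rho> * \<epsilon> / 2 * real N))))"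
      using \<rho> \<epsilon> by (intro exp_small_exp exp_small_add small) simp
    show "\<forall>\<^sub>F N in sequentially. upper_tail N (Suc t) g \<epsilon> \<le> far_prob N t G \<delta> + ennreal (exp (- (\<rho> * \<epsilon> / 2 * real N)))"
      using eventually_gt_at_top[of 0]
    proof eventually_elim
      case (elim N)
      note [measurable_cong] = sets_pf[OF t(1) elim] sets_pf[OF t(2) elim]
      have [measurable]: "dev N (Suc t) g \<in> borel_measurable (path_space N (Suc t))" using Suc by (intro dev_meas) auto
      have far_m [measurable]: "(indicator (far N t G \<delta>) :: _ \<Rightarrow> ennreal) \<in> borel_measurable (path_space N (Suc t))"
        by (intro far_indicator_meas G) auto
      have far_m2 [measurable]: "(indicator (- far N t G \<delta>) :: _ \<Rightarrow> ennreal) \<in> borel_measurable (path_space N (Suc t))"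
      proof -
        have "- far N t G \<delta> \<inter> space (path_space N (Suc t)) =
            space (path_space N (Suc t)) - far N t G \<delta> \<inter> space (path_space N (Suc t))" by blast
        also have "\<dots> \<in> sets (path_space N (Suc t))" by (intro sets.compl_sets far_meas G) auto
        finally show ?thesis by (simp add: borel_measurable_indicator_iff)
      qed
      \<comment> \<open>Collects the good event and the Chernoff factor. It depends on the path only
        through generation \<open>t\<close>, hence is unchanged by \<open>X(Suc t := x)\<close>, as
        \<open>pf_Suc_nn_integral\<close> demands of the past factor.\<close>
      define W where "W X = indicator (- far N t G \<delta>) X * ennreal (exp (- (\<rho> * \<epsilon> * real N)))" for X
      define F where "F X = W X * ennreal (exp (real N * (\<rho> * dev N (Suc t) g X)))" for X
      have W [measurable]: "W \<in> borel_measurable (path_space N (Suc t))" unfolding W_def by measurable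
      have F [measurable]: "F \<in> borel_measurable (path_space N (Suc t))" unfolding F_def by measurable
      have far_upd: "X(Suc t := x) \<in> far N t G \<delta> \<longleftrightarrow> X \<in> far N t G \<delta>" for X x
        by (simp add: far_def dev_def)
      have "upper_tail N (Suc t) g \<epsilon> \<le> (\<integral>\<^sup>+X. indicator (far N t G \<delta>) X + F X \<partial>pf N (Suc t))"
        unfolding upper_tail_def
      proof (rule nn_integral_mono)
        fix X
        show "indicator {X. \<epsilon> \<le> dev N (Suc t) g X} X \<le> indicator (far N t G \<delta>) X + F X"
        proof (cases "\<epsilon> \<le> dev N (Suc t) g X \<and> X \<notin> far N t G \<delta>")
          case True
          then have "0 \<le> real N * (\<rho> * (dev N (Suc t) g X - \<epsilon>))" using \<rho> by simp
          then have "1 \<le> ennreal (exp (real N * (\<rho> * (dev N (Suc t) g X - \<epsilon>))))" by simp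
          then show ?thesis using True by (simp add: F_def W_def algebra_simps flip: ennreal_mult exp_add)
        qed (auto simp: indicator_def)
      qed
      also have "\<dots> = (\<integral>\<^sup>+X. indicator (far N t G \<delta>) X \<partial>pf N (Suc t)) + (\<integral>\<^sup>+X. F X \<partial>pf N (Suc t))"
        by (rule nn_integral_add) measurable
      \<comment> \<open>The bad event looks only at generation \<open>t\<close>; integrating out the
        newest generation with the function 1 leaves its probability at time
        \<open>t\<close>.\<close>
      also have "(\<integral>\<^sup>+X. indicator (far N t G \<delta>) X \<partial>pf N (Suc t)) = far_prob N t G \<delta>"
      proof -
        have "(\<integral>\<^sup>+X. indicator (far N t G \<delta>) X \<partial>pf N (Suc t)) =
          (\<integral>\<^sup>+X. indicator (far N t G \<delta>) X * ennreal (((\<Sum>i<N. L (Suc t) (\<lambda>_. 1) (X t i)) / (\<Sum>i<N. L (Suc t) (\<lambda>_. 1) (X t i))) ^ N) \<partial>pf N t)"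
          using far_upd by (intro pf_Suc_nn_integral[OF t(1) elim far_m]) (auto simp: indicator_def)
        also have "\<dots> = far_prob N t G \<delta>"
          unfolding far_prob_def using sum_L1_pos[OF elim tT] by (simp add: less_imp_neq[symmetric])
        finally show ?thesis .
      qed
      also have "(\<integral>\<^sup>+X. F X \<partial>pf N (Suc t)) = (\<integral>\<^sup>+X. W X * ennreal (((\<Sum>i<N. L (Suc t) (\<lambda>x. exp (\<rho> * c x)) (X t i)) / (\<Sum>i<N. L (Suc t) (\<lambda>_. 1) (X t i))) ^ N) \<partial>pf N t)"
      proof (rule pf_Suc_nn_integral[OF t(1) elim F e])
        fix X x
        have "W (X(Suc t := x)) = W X" by (simp add: W_def indicator_def far_upd)
        then show "F (X(Suc t := x)) = W X * ennreal (\<Prod>i<N. exp (\<rho> * c (x i)))"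
          using prod_exp_ctr[OF elim, where \<theta> = \<rho> and t = "Suc t" and g = g and X = "X(Suc t := x)"] by (simp add: F_def c_def)
      qed simp
      also have "\<dots> \<le> (\<integral>\<^sup>+X. ennreal (exp (- (\<rho> * \<epsilon> / 2 * real N))) \<partial>pf N t)"
      proof (rule nn_integral_mono)
        fix X
        define E where "E = (\<lambda>g. (\<Sum>i<N. L (Suc t) g (X t i)) / (\<Sum>i<N. L (Suc t) (\<lambda>_. 1) (X t i)))"
        have E: "mean_functional E" unfolding E_def by (rule mean_functional_particles[OF tT elim])
        show "W X * ennreal (((\<Sum>i<N. L (Suc t) (\<lambda>x. exp (\<rho> * c x)) (X t i)) / (\<Sum>i<N. L (Suc t) (\<lambda>_. 1) (X t i))) ^ N)
          \<le> ennreal (exp (- (\<rho> * \<epsilon> / 2 * real N)))"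
        proof (cases "X \<in> far N t G \<delta>")
          case False
          then have d: "\<bar>dev N t (L (Suc t) c) X\<bar> < \<delta>" "\<bar>dev N t (L (Suc t) (\<lambda>_. 1)) X\<bar> < \<delta>"
            by (auto simp: far_def G_def not_le)
          have den: "dev N t (L (Suc t) (\<lambda>_. 1)) X + k \<ge> k / 2" using d(2) unfolding \<delta>_def by linarith
          have "E c = dev N t (L (Suc t) c) X / (dev N t (L (Suc t) (\<lambda>_. 1)) X + k)"
            unfolding E_def k_def particle_mean_eq[OF t(1) elim c] by (simp add: mc)
          also have "\<dots> \<le> \<epsilon> / 4"
          proof -
            have "dev N t (L (Suc t) c) X \<le> \<epsilon> / 4 * (k / 2)" using d(1) unfolding \<delta>_def by linarith
            also have "\<dots> \<le> \<epsilon> / 4 * (dev N t (L (Suc t) (\<lambda>_. 1)) X + k)" using den \<epsilon> by (intro mult_left_mono) auto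
            finally show ?thesis using den k by (simp add: pos_divide_le_eq)
          qed
          finally have A: "E c \<le> \<epsilon> / 4" .
          have r0: "0 \<le> E (\<lambda>x. exp (\<rho> * c x))"
            unfolding E_def using L_nonneg[OF tT e]
            by (intro divide_nonneg_nonneg sum_nonneg less_imp_le[OF L1_pos[OF tT]]) auto
          note r1 = mean_functional_exp(3)[OF E c C(2) less_imp_le[OF \<rho>(1)] \<rho>(2)]
          from chernoff_power[OF r0 r1 A \<rho>(1,3)] r0 show ?thesis
            using False by (simp add: W_def E_def flip: ennreal_mult)
        qed (simp add: W_def)
      qed
      also have "\<dots> = ennreal (exp (- (\<rho> * \<epsilon> / 2 * real N)))"
        using prob_space.emeasure_space_1[OF prob_pf[OF t(2) elim]] by simp
      finally show ?case by (simp add: add_left_mono)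
    qed
  qed
qed

lemma exp_small_far_prob:
  assumes "t \<le> T" "\<delta> > 0" "finite G" "\<And>g. g \<in> G \<Longrightarrow> bounded_measurable g"
  shows "exp_small (\<lambda>N. far_prob N t G \<delta>)"
  using assms by (intro exp_small_far exp_small_upper_tail)

end

section \<open>The Laplace limit\<close>

locale moderate_deviations = hidden_markov_filter mu nu a0 a b y T
  for mu :: "(real^'d) measure" and nu :: "(real^'m) measure"
    and a0 :: "real^'d \<Rightarrow> real"
    and a :: "nat \<Rightarrow> real^'d \<Rightarrow> real^'d \<Rightarrow> real"
    and b :: "nat \<Rightarrow> real^'d \<Rightarrow> real^'m \<Rightarrow> real"
    and y :: "nat \<Rightarrow> real^'m"
    and T :: nat +
  fixes bN :: "nat \<Rightarrow> real"
  assumes bN_pos: "\<And>N. bN N > 0"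
    and bN_lim: "filterlim bN at_top sequentially"
    and bN_sqrt: "filterlim (\<lambda>N. sqrt (real N) / bN N) at_top sequentially"
begin

text \<open>The tilt per particle: the squared \<open>bN N\<close> times \<open>MN\<close> is
  \<open>N * \<theta> N * dev\<close>. Its convergence to 0 permits the second-order expansion at
  each particle.\<close>

definition \<theta> where "\<theta> N = bN N / sqrt (real N)"

abbreviation speed where "speed N \<equiv> (bN N)\<^sup>2"

lemma speed_at_top: "filterlim speed at_top sequentially"
  using bN_lim by (intro filterlim_pow_at_top) auto

lemma theta_pos: "N > 0 \<Longrightarrow> \<theta> N > 0"
  using bN_pos by (simp add: \<theta>_def)

lemma speed_eq: "N > 0 \<Longrightarrow> speed N = real N * (\<theta> N)\<^sup>2"
  by (simp add: \<theta>_def power_divide)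

lemma theta_tendsto: "\<theta> \<longlonglongrightarrow> 0"
proof -
  have "(\<lambda>N. inverse (sqrt (real N) / bN N)) \<longlonglongrightarrow> 0"
    using bN_sqrt by (rule tendsto_inverse_0_at_top)
  then show ?thesis by (simp add: \<theta>_def[abs_def])
qed

lemma eventually_theta:
  assumes "\<eta> > 0"
  shows "\<forall>\<^sub>F N in sequentially. N > 0 \<and> 0 < \<theta> N \<and> \<theta> N \<le> \<eta>"
  using order_tendstoD(2)[OF theta_tendsto assms] eventually_gt_at_top[of 0]
  by eventually_elim (auto simp: theta_pos)

text \<open>Since \<theta> tends to 0, both \<open>N * \<theta> N\<close> and the speed
  \<open>N * (\<theta> N)\<^sup>2\<close> are of smaller order than \<open>N\<close>. An
  exponentially small probability therefore beats the factor and has every rate \<open>c\<close>,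
  however negative.\<close>

lemma superexponential:
  assumes "exp_small p"
  shows "rate_le speed (\<lambda>N. ennreal (exp (K * (real N * \<theta> N))) * p N) c"
  unfolding rate_le_def
proof (intro allI impI)
  fix e :: real assume "e > 0"
  obtain d where d: "d > 0" "rate_le real p (- d)" using assms by (auto simp: exp_small_def)
  have "(\<lambda>N. (c + e) * (\<theta> N)\<^sup>2 - K * \<theta> N) \<longlonglongrightarrow> (c + e) * 0\<^sup>2 - K * 0"
    by (intro tendsto_intros theta_tendsto)
  then have "\<forall>\<^sub>F N in sequentially. - d / 2 < (c + e) * (\<theta> N)\<^sup>2 - K * \<theta> N"
    using d by (intro order_tendstoD) auto
  moreover have "\<forall>\<^sub>F N in sequentially. p N \<le> ennreal (exp (real N * (- d + d / 2)))"
    using d by (intro rate_leD) auto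
  ultimately show "\<forall>\<^sub>F N in sequentially. ennreal (exp (K * (real N * \<theta> N))) * p N \<le> ennreal (exp (speed N * (c + e)))"
    using eventually_gt_at_top[of 0]
  proof eventually_elim
    case (elim N)
    have "ennreal (exp (K * (real N * \<theta> N))) * p N \<le> ennreal (exp (K * (real N * \<theta> N))) * ennreal (exp (real N * (- d + d / 2)))"
      using elim by (intro mult_left_mono) auto
    also have "\<dots> = ennreal (exp (real N * (K * \<theta> N - d / 2)))"
      by (simp add: algebra_simps flip: ennreal_mult exp_add)
    also have "\<dots> \<le> ennreal (exp (real N * ((c + e) * (\<theta> N)\<^sup>2)))"
      using elim by (intro ennreal_leI) (simp add: mult_left_mono)
    also have "\<dots> = ennreal (exp (speed N * (c + e)))"
      unfolding speed_eq[OF elim(3)] by (simp add: mult_ac)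
    finally show ?case .
  qed
qed

definition Z where "Z N t \<psi> X = real N * \<theta> N * (\<Sum>s\<le>t. dev N s (\<psi> s) X)"

definition lap where "lap N t \<psi> = (\<integral>\<^sup>+X. ennreal (exp (Z N t \<psi> X)) \<partial>pf N t)"

lemma Z_meas:
  assumes "\<And>i. i \<le> t \<Longrightarrow> bounded_measurable (\<psi> i)"
  shows "(\<lambda>X. ennreal (exp (Z N t \<psi> X))) \<in> borel_measurable (path_space N t)"
proof -
  have "(\<lambda>X. Z N t \<psi> X) \<in> borel_measurable (path_space N t)" unfolding Z_def
    by (intro borel_measurable_times borel_measurable_const borel_measurable_sum dev_meas assms) auto
  then show ?thesis by measurable
qed

text \<open>A crude bound from boundedness of the test functions, to be used on the bad event only,
  where \<open>superexponential\<close> absorbs it.\<close>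

lemma Z_bound:
  assumes "t \<le> T" "\<And>i. i \<le> t \<Longrightarrow> bounded_measurable (\<psi> i)"
  shows "\<exists>K. \<forall>N X. N > 0 \<longrightarrow> Z N t \<psi> X \<le> K * (real N * \<theta> N)"
proof -
  have "\<forall>i. \<exists>C. i \<le> t \<longrightarrow> (\<forall>x. \<bar>\<psi> i x\<bar> \<le> C)" using assms(2) bounded_measurableE by metis
  then obtain C where C: "\<And>i x. i \<le> t \<Longrightarrow> \<bar>\<psi> i x\<bar> \<le> C i" by metis
  have "Z N t \<psi> X \<le> (\<Sum>s\<le>t. 2 * C s) * (real N * \<theta> N)" if "N > 0" for N X
  proof -
    have "dev N s (\<psi> s) X \<le> 2 * C s" if "s \<le> t" for s
      using dev_bound[OF _ assms(2)[OF that] C[OF that] \<open>N > 0\<close>, where t = s and X = X] that assms(1) by (auto dest: abs_le_D1)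
    then have "(\<Sum>s\<le>t. dev N s (\<psi> s) X) \<le> (\<Sum>s\<le>t. 2 * C s)" by (intro sum_mono) auto
    then have "real N * \<theta> N * (\<Sum>s\<le>t. dev N s (\<psi> s) X) \<le> real N * \<theta> N * (\<Sum>s\<le>t. 2 * C s)"
      using theta_pos[OF that] by (intro mult_left_mono) auto
    then show ?thesis by (simp add: Z_def mult.commute)
  qed
  then show ?thesis by blast
qed

lemma Z_update:
  assumes "t \<le> T" "\<And>i. i \<le> t \<Longrightarrow> bounded_measurable (\<psi> i)" "bounded_measurable h"
  shows "Z N t (\<psi>(t := \<lambda>x. \<psi> t x + c * h x)) X = Z N t \<psi> X + c * (real N * (\<theta> N * dev N t h X))"
proof -
  have "bounded_measurable (\<lambda>x. c * h x)" using assms(3) by (intro bounded_measurable_mult) auto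
  then have "dev N t (\<lambda>x. \<psi> t x + c * h x) X = dev N t (\<psi> t) X + c * dev N t h X"
    using assms by (simp add: dev_add dev_cmult)
  then show ?thesis
    by (simp add: Z_def lessThan_Suc_atMost[symmetric] algebra_simps)
qed

lemma lap_Suc:
  assumes t: "Suc t \<le> T" and N: "N > 0" and \<psi>: "\<And>i. i \<le> Suc t \<Longrightarrow> bounded_measurable (\<psi> i)"
  shows "lap N (Suc t) \<psi> = (\<integral>\<^sup>+X. ennreal (exp (Z N t \<psi> X)) *
    ennreal (((\<Sum>i<N. L (Suc t) (\<lambda>x. exp (\<theta> N * ctr (Suc t) (\<psi> (Suc t)) x)) (X t i)) /
      (\<Sum>i<N. L (Suc t) (\<lambda>_. 1) (X t i))) ^ N) \<partial>pf N t)"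
  unfolding lap_def
proof (rule pf_Suc_nn_integral[OF t N Z_meas[OF \<psi>]])
  show "0 \<le> exp (\<theta> N * ctr (Suc t) (\<psi> (Suc t)) x)" for x by (rule exp_ge_zero)
  show "bounded_measurable (\<lambda>x. exp (\<theta> N * ctr (Suc t) (\<psi> (Suc t)) x))"
    using \<psi>[of "Suc t"] by (intro bounded_measurable_exp bounded_measurable_mult ctr_bounded_measurable) auto
  fix X :: "nat \<Rightarrow> nat \<Rightarrow> real^'d" and x
  let ?X = "X(Suc t := x)"
  have "(\<Sum>s\<le>t. dev N s (\<psi> s) ?X) = (\<Sum>s\<le>t. dev N s (\<psi> s) X)"
    by (intro sum.cong refl) (auto simp: dev_def)
  then have "Z N (Suc t) \<psi> ?X = Z N t \<psi> X + real N * (\<theta> N * dev N (Suc t) (\<psi> (Suc t)) ?X)"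
    by (simp add: Z_def algebra_simps)
  then have "exp (Z N (Suc t) \<psi> ?X) = exp (Z N t \<psi> X) * (\<Prod>i<N. exp (\<theta> N * ctr (Suc t) (\<psi> (Suc t)) (x i)))"
    using prod_exp_ctr[OF N, where \<theta> = "\<theta> N" and t = "Suc t" and g = "\<psi> (Suc t)" and X = ?X]
    by (simp add: exp_add)
  then show "ennreal (exp (Z N (Suc t) \<psi> ?X)) = ennreal (exp (Z N t \<psi> X)) * ennreal (\<Prod>i<N. exp (\<theta> N * ctr (Suc t) (\<psi> (Suc t)) (x i)))"
    by (simp add: ennreal_mult prod_nonneg)
qed

text \<open>By bilinearity a polynomial in \<open>c\<close>. Its continuity at \<open>c = 1\<close>
  is what makes the perturbation of the last test function cheap.\<close>

lemma Q_perturbed: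
  assumes "t \<le> T" "\<And>i. i \<le> t \<Longrightarrow> bounded_measurable (\<psi> i)" "bounded_measurable h"
  shows "Q t (\<psi>(t := \<lambda>x. \<psi> t x + c * h x)) = Q t \<psi> + 2 * (c * (\<Sum>r\<le>t. V r t (\<psi> r) h)) + c * (c * cov t h h)"
proof -
  have b: "bounded_measurable (\<lambda>x. c * h x)" using assms(3) by (intro bounded_measurable_mult) auto
  have "(\<Sum>r\<le>t. V r t (\<psi> r) (\<lambda>x. c * h x)) = c * (\<Sum>r\<le>t. V r t (\<psi> r) h)"
    unfolding sum_distrib_left
  proof (rule sum.cong[OF refl])
    fix r assume "r \<in> {..t}"
    then show "V r t (\<psi> r) (\<lambda>x. c * h x) = c * V r t (\<psi> r) h"
      using V_cmult[of r t h "\<psi> r" 1 c] assms by simp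
  qed
  moreover have "cov t (\<lambda>x. c * h x) (\<lambda>x. c * h x) = c * (c * cov t h h)"
    by (simp only: cov_cmult cov_cmult_right)
  ultimately show ?thesis using Q_update[of t \<psi> "\<lambda>x. c * h x", OF assms(1,2) b] by simp
qed

text \<open>Generation 0 is i.i.d. with the exact filter law, so the transform is an
  \<open>N\<close>-th power and \<open>log_estimate\<close> applies with \<open>A = 0\<close> and
  \<open>B = v\<close>, without any bad event.\<close>

lemma laplace_0:
  assumes \<psi>: "bounded_measurable (\<psi> 0)"
  shows "rate_le speed (\<lambda>N. lap N 0 \<psi>) (Q 0 \<psi> / 2)" "rate_ge speed (\<lambda>N. lap N 0 \<psi>) (Q 0 \<psi> / 2)"
proof -
  define c where "c = ctr 0 (\<psi> 0)"
  have c: "bounded_measurable c" unfolding c_def by (intro ctr_bounded_measurable \<psi>)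
  have c2: "bounded_measurable (\<lambda>x. (c x)\<^sup>2)" by (intro bounded_measurable_power c)
  obtain C where C: "C > 0" "\<And>x. \<bar>c x\<bar> \<le> C" using c by (metis bounded_measurableE)
  define v where "v = m 0 (\<lambda>x. (c x)\<^sup>2)"
  have Q: "Q 0 \<psi> = v" using \<psi> by (simp add: Q_def V_same v_def c_def power2_eq_square)
  have mc: "m 0 c = 0" unfolding c_def using \<psi> by (intro m_centered) auto
  have main: "\<forall>\<^sub>F N in sequentially. ennreal (exp (speed N * (v / 2 - e))) \<le> lap N 0 \<psi> \<and> lap N 0 \<psi> \<le> ennreal (exp (speed N * (v / 2 + e)))"
    if "e > 0" for e :: real
  proof -
    define \<epsilon> where "\<epsilon> = min e 1"
    have \<epsilon>: "0 < \<epsilon>" "\<epsilon> \<le> 1" "\<epsilon> \<le> e" using that by (auto simp: \<epsilon>_def)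
    obtain \<eta> where \<eta>: "\<eta> > 0" "\<And>\<theta>. 0 < \<theta> \<Longrightarrow> \<theta> \<le> \<eta> \<Longrightarrow>
       \<theta> \<le> 1/2 \<and> \<theta> * C \<le> 1 \<and> 3 * (\<theta> * C\<^sup>2) \<le> \<epsilon> / 4 \<and> 2 * (\<theta> * C ^ 3) \<le> \<epsilon> / 4"
      using small_theta[OF C(1) \<epsilon>(1)] by metis
    show ?thesis using eventually_theta[OF \<eta>(1)]
    proof eventually_elim
      case (elim N)
      then have N: "N > 0" and \<theta>: "0 < \<theta> N" "\<theta> N \<le> 1/2" "\<theta> N * C \<le> 1" "3 * (\<theta> N * C\<^sup>2) \<le> \<epsilon> / 4" "2 * (\<theta> N * C ^ 3) \<le> \<epsilon> / 4"
        using \<eta>(2)[of "\<theta> N"] by auto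
      have e: "bounded_measurable (\<lambda>x. exp (\<theta> N * c x))" using c by (intro bounded_measurable_exp bounded_measurable_mult) auto
      define r where "r = m 0 (\<lambda>x. exp (\<theta> N * c x))"
      have lap: "lap N 0 \<psi> = ennreal (r ^ N)" unfolding lap_def r_def
        by (intro pf_0_nn_integral Z_meas e)
          (auto simp: \<psi> Z_def c_def prod_exp_ctr[OF N] mult.assoc)
      note mf = mean_functional_exp[OF mean_functional_m[of 0] c C(2) less_imp_le[OF \<theta>(1)] \<theta>(3), simplified]
      have "0 < r \<and> \<bar>ln r - (\<theta> N * 0 + (\<theta> N)\<^sup>2 / 2 * v)\<bar> \<le> (\<theta> N)\<^sup>2 * \<epsilon>"
        using log_estimate[OF \<theta> C(1) \<epsilon>(1,2), of 0 v v r] mf(1,2) \<epsilon> by (simp add: mc v_def r_def)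
      then have r: "0 < r" and lr: "\<bar>ln r - (\<theta> N)\<^sup>2 / 2 * v\<bar> \<le> (\<theta> N)\<^sup>2 * \<epsilon>" by auto
      have "\<bar>real N * ln r - speed N * (v / 2)\<bar> \<le> speed N * \<epsilon>"
      proof -
        have "real N * ln r - speed N * (v / 2) = real N * (ln r - (\<theta> N)\<^sup>2 / 2 * v)"
          unfolding speed_eq[OF N] by (simp add: algebra_simps)
        also have "\<bar>\<dots>\<bar> \<le> real N * ((\<theta> N)\<^sup>2 * \<epsilon>)" using lr by (simp add: abs_mult mult_left_mono)
        finally show ?thesis unfolding speed_eq[OF N] by (simp add: mult.assoc)
      qed
      moreover have "speed N * \<epsilon> \<le> speed N * e" using \<epsilon> by (intro mult_left_mono) auto
      ultimately have "speed N * (v / 2 - e) \<le> real N * ln r" "real N * ln r \<le> speed N * (v / 2 + e)"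
        by (simp_all add: algebra_simps abs_le_iff)
      moreover have "r ^ N = exp (real N * ln r)" using r by (simp add: exp_of_nat_mult)
      ultimately show ?case unfolding lap by simp
    qed
  qed
  show "rate_le speed (\<lambda>N. lap N 0 \<psi>) (Q 0 \<psi> / 2)"
    unfolding Q rate_le_def
  proof (intro allI impI)
    fix e :: real assume "e > 0"
    from main[OF this] show "\<forall>\<^sub>F N in sequentially. lap N 0 \<psi> \<le> ennreal (exp (speed N * (v / 2 + e)))"
      by (rule eventually_mono) simp
  qed
  show "rate_ge speed (\<lambda>N. lap N 0 \<psi>) (Q 0 \<psi> / 2)"
    unfolding Q rate_ge_def
  proof (intro allI impI)
    fix e :: real assume "e > 0"
    from main[OF this] show "\<forall>\<^sub>F N in sequentially. ennreal (exp (speed N * (v / 2 - e))) \<le> lap N 0 \<psi>"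
      by (rule eventually_mono) simp
  qed
qed

text \<open>
  On the good event the one-step factor is known up to a factor \<open>exp (\<epsilon> \<bar>u\<bar>)\<close> with \<open>u\<close> the linear
  term.  Since \<open>exp \<bar>z\<bar> \<le> exp z + exp (- z)\<close>, it costs for the upper bound only a perturbation of the
  last test function by the factors \<open>1 \<plusminus> \<epsilon>\<close>.  For the lower bound, the region where
  \<open>\<epsilon> \<bar>u\<bar>\<close> exceeds \<open>\<gamma>\<close> times the speed is negligible by the same perturbation.
\<close>

lemma laplace_Suc:
  assumes t: "Suc t \<le> T" and \<psi>: "\<And>i. i \<le> Suc t \<Longrightarrow> bounded_measurable (\<psi> i)"
    and IH: "\<And>\<psi>. (\<And>i. i \<le> t \<Longrightarrow> bounded_measurable (\<psi> i)) \<Longrightarrow>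
      rate_le speed (\<lambda>N. lap N t \<psi>) (Q t \<psi> / 2) \<and> rate_ge speed (\<lambda>N. lap N t \<psi>) (Q t \<psi> / 2)"
    and \<gamma>: "\<gamma> > 0"
  shows "rate_le speed (\<lambda>N. lap N (Suc t) \<psi>) (Q (Suc t) \<psi> / 2 + 2 * \<gamma>)"
    and "rate_ge speed (\<lambda>N. lap N (Suc t) \<psi>) (Q (Suc t) \<psi> / 2 - 2 * \<gamma>)"
proof -
  have tT: "Suc t \<in> {1..T}" "t \<le> T" using t by auto
  define h where "h = pullback t (\<psi> (Suc t))"
  have h: "bounded_measurable h" unfolding h_def using \<psi> by (intro pullback_bounded_measurable t) auto
  have \<psi>t: "\<And>i. i \<le> t \<Longrightarrow> bounded_measurable (\<psi> i)" using \<psi> by simp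
  define c where "c = ctr (Suc t) (\<psi> (Suc t))"
  have c: "bounded_measurable c" unfolding c_def using \<psi> by (intro ctr_bounded_measurable) auto
  define v where "v = sigma2 mu a0 a b y (Suc t) (\<psi> (Suc t))"
  \<comment> \<open>\<open>k = 1\<close> is the family of the limit;
    \<open>k = 1 + \<epsilon>\<close> and \<open>k = 1 - \<epsilon>\<close> are the perturbed
    families that absorb the error proportional to the linear term.\<close>
  define \<psi>' where "\<psi>' k = \<psi>(t := \<lambda>x. \<psi> t x + k * h x)" for k
  have \<psi>': "bounded_measurable (\<psi>' k i)" if "i \<le> t" for k i
    using \<psi>t[OF that] \<psi>t[of t] h by (auto simp: \<psi>'_def intro!: bounded_measurable_add bounded_measurable_mult)
  define q where "q k = Q t (\<psi>' k) / 2" for k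
  have Zk: "Z N t (\<psi>' k) X = Z N t \<psi> X + k * (real N * (\<theta> N * dev N t h X))" for N k X
    unfolding \<psi>'_def by (rule Z_update[OF tT(2) \<psi>t h])
  have QS: "Q (Suc t) \<psi> / 2 = v / 2 + q 1"
    using Q_Suc[OF t \<psi>] by (simp add: q_def \<psi>'_def v_def h_def add_divide_distrib)
  have lapk: "rate_le speed (\<lambda>N. lap N t (\<psi>' k)) (q k)" "rate_ge speed (\<lambda>N. lap N t (\<psi>' k)) (q k)" for k
    using IH[OF \<psi>'] by (auto simp: q_def)
  \<comment> \<open>\<open>q\<close> is a polynomial, hence continuous at 1. The upper bound will
    spend \<open>\<gamma> / 2 + \<epsilon>\<close> and the lower bound
    \<open>\<gamma> + \<epsilon>\<close>, both within \<open>2 * \<gamma>\<close>.\<close>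
  obtain \<epsilon> where \<epsilon>: "0 < \<epsilon>" "\<epsilon> \<le> 1" "\<epsilon> \<le> \<gamma>" "q (1 + \<epsilon>) \<le> q 1 + \<gamma> / 2" "q (1 - \<epsilon>) \<le> q 1 + \<gamma> / 2"
  proof -
    have "q = (\<lambda>k. (Q t \<psi> + 2 * (k * (\<Sum>r\<le>t. V r t (\<psi> r) h)) + k * (k * cov t h h)) / 2)"
      unfolding q_def[abs_def] \<psi>'_def using Q_perturbed[of t \<psi> h, OF tT(2) \<psi>t h] by simp
    then have "isCont q 1" by (auto intro!: continuous_intros)
    then obtain d where d: "d > 0" "\<And>k. \<bar>k - 1\<bar> < d \<Longrightarrow> \<bar>q k - q 1\<bar> < \<gamma> / 2"
      unfolding continuous_at_eps_delta dist_real_def using \<gamma> by (metis half_gt_zero)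
    define \<epsilon> where "\<epsilon> = min (d / 2) (min 1 \<gamma>)"
    have "0 < \<epsilon>" "\<epsilon> < d" "\<epsilon> \<le> 1" "\<epsilon> \<le> \<gamma>" using d(1) \<gamma> by (auto simp: \<epsilon>_def)
    moreover from this have "\<bar>q (1 + \<epsilon>) - q 1\<bar> < \<gamma> / 2" "\<bar>q (1 - \<epsilon>) - q 1\<bar> < \<gamma> / 2"
      using d(2)[of "1 + \<epsilon>"] d(2)[of "1 - \<epsilon>"] by auto
    then have "q (1 + \<epsilon>) \<le> q 1 + \<gamma> / 2" "q (1 - \<epsilon>) \<le> q 1 + \<gamma> / 2"
      by linarith+
    ultimately show ?thesis by (intro that[of \<epsilon>])
  qed
  define G where "G = {L (Suc t) c, L (Suc t) (\<lambda>_. 1), L (Suc t) (\<lambda>x. (c x)\<^sup>2)}"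
  have G: "finite G" "\<And>g. g \<in> G \<Longrightarrow> bounded_measurable g"
    using L_bounded_measurable[OF tT(1)] c bounded_measurable_power[OF c] by (auto simp: G_def)
  define r where "r N X = (\<Sum>i<N. L (Suc t) (\<lambda>x. exp (\<theta> N * c x)) (X t i)) / (\<Sum>i<N. L (Suc t) (\<lambda>_. 1) (X t i))"
    for N and X :: "nat \<Rightarrow> nat \<Rightarrow> real^'d"
  obtain \<delta> \<eta> where \<delta>: "\<delta> > 0" and \<eta>: "\<eta> > 0" and
    est: "\<And>N X. N > 0 \<Longrightarrow> \<theta> N \<le> \<eta> \<Longrightarrow> X \<notin> far N t G \<delta> \<Longrightarrow> 0 < r N X \<and>
      \<bar>ln (r N X) - (\<theta> N * dev N t h X + (\<theta> N)\<^sup>2 / 2 * v)\<bar> \<le> (\<theta> N)\<^sup>2 * \<epsilon> + \<epsilon> * (\<theta> N * \<bar>dev N t h X\<bar>)"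
  proof -
    have \<phi>: "bounded_measurable (\<psi> (Suc t))" using \<psi> by simp
    show ?thesis
    proof (rule step_log_estimate[OF t \<phi> \<epsilon>(1,2) c_def v_def, folded h_def G_def])
      fix \<delta> \<eta> assume \<delta>: "\<delta> > 0" and \<eta>: "\<eta> > 0" and *: "\<And>\<theta>' N X. 0 < \<theta>' \<Longrightarrow> \<theta>' \<le> \<eta> \<Longrightarrow> N > 0 \<Longrightarrow>
         \<forall>g\<in>G. \<bar>dev N t g X\<bar> < \<delta> \<Longrightarrow>
         0 < (\<Sum>i<N. L (Suc t) (\<lambda>x. exp (\<theta>' * c x)) (X t i)) / (\<Sum>i<N. L (Suc t) (\<lambda>_. 1) (X t i)) \<and>
         \<bar>ln ((\<Sum>i<N. L (Suc t) (\<lambda>x. exp (\<theta>' * c x)) (X t i)) / (\<Sum>i<N. L (Suc t) (\<lambda>_. 1) (X t i)))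
           - (\<theta>' * dev N t h X + \<theta>'\<^sup>2 / 2 * v)\<bar> \<le> \<theta>'\<^sup>2 * \<epsilon> + \<epsilon> * (\<theta>' * \<bar>dev N t h X\<bar>)"
      show ?thesis
      proof (rule that[OF \<delta> \<eta>])
        fix N and X :: "nat \<Rightarrow> nat \<Rightarrow> real^'d"
        assume N: "N > 0" "\<theta> N \<le> \<eta>" and X: "X \<notin> far N t G \<delta>"
        have "\<forall>g\<in>G. \<bar>dev N t g X\<bar> < \<delta>" using X by (auto simp: far_def not_le)
        from *[OF theta_pos[OF N(1)] N(2,1) this]
        show "0 < r N X \<and> \<bar>ln (r N X) - (\<theta> N * dev N t h X + (\<theta> N)\<^sup>2 / 2 * v)\<bar> \<le> (\<theta> N)\<^sup>2 * \<epsilon> + \<epsilon> * (\<theta> N * \<bar>dev N t h X\<bar>)"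
          unfolding r_def .
      qed
    qed
  qed
  define u where "u N X = real N * (\<theta> N * dev N t h X)" for N X
  have est2: "r N X ^ N = exp (real N * ln (r N X)) \<and>
      \<bar>real N * ln (r N X) - (u N X + speed N * (v / 2))\<bar> \<le> speed N * \<epsilon> + \<epsilon> * \<bar>u N X\<bar>"
    if "N > 0" "\<theta> N \<le> \<eta>" "X \<notin> far N t G \<delta>" for N X
  proof
    note e = est[OF that]
    then show "r N X ^ N = exp (real N * ln (r N X))" by (simp add: exp_of_nat_mult)
    have "real N * ln (r N X) - (u N X + speed N * (v / 2)) =
       real N * (ln (r N X) - (\<theta> N * dev N t h X + (\<theta> N)\<^sup>2 / 2 * v))"
      unfolding speed_eq[OF that(1)] u_def by (simp add: algebra_simps)
    also have "\<bar>\<dots>\<bar> \<le> real N * ((\<theta> N)\<^sup>2 * \<epsilon> + \<epsilon> * (\<theta> N * \<bar>dev N t h X\<bar>))"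
      unfolding abs_mult using e by (simp add: mult_left_mono)
    also have "\<dots> = speed N * \<epsilon> + \<epsilon> * \<bar>u N X\<bar>"
      unfolding speed_eq[OF that(1)] u_def using theta_pos[OF that(1)] by (simp add: abs_mult algebra_simps)
    finally show "\<bar>real N * ln (r N X) - (u N X + speed N * (v / 2))\<bar> \<le> speed N * \<epsilon> + \<epsilon> * \<bar>u N X\<bar>" .
  qed
  have ek: "bounded_measurable (\<lambda>x. exp (k * c x))" for k
    using c by (intro bounded_measurable_exp bounded_measurable_mult) auto
  \<comment> \<open>Bound for the bad event: \<open>r N X\<close> is an average of
    \<open>exp (\<theta> N * c x)\<close> with \<open>c\<close> bounded by \<open>C\<close>, so its
    \<open>N\<close>-th power is at most \<open>exp (C * (N * \<theta> N))\<close>.\<close>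
  obtain K1 where K1: "\<And>N X. N > 0 \<Longrightarrow> exp (Z N t \<psi> X) * r N X ^ N \<le> exp (K1 * (real N * \<theta> N))"
  proof -
    obtain K where K: "\<And>N X. N > 0 \<Longrightarrow> Z N t \<psi> X \<le> K * (real N * \<theta> N)" using Z_bound[of t \<psi>, OF tT(2) \<psi>t] by blast
    obtain C where C: "C > 0" "\<And>x. \<bar>c x\<bar> \<le> C" using c by (metis bounded_measurableE)
    show ?thesis
    proof (rule that)
      fix N :: nat and X :: "nat \<Rightarrow> nat \<Rightarrow> real^'d" assume N: "N > 0"
      have le: "exp (\<theta> N * c x) \<le> exp (\<theta> N * C)" for x
        using C(2)[of x] theta_pos[OF N] by (simp add: abs_le_iff)
      have "L (Suc t) (\<lambda>x. exp (\<theta> N * c x)) z \<le> exp (\<theta> N * C) * L (Suc t) (\<lambda>_. 1) z" for z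
        using L_mono[OF tT(1) ek bounded_measurable_const le, of z] by (simp add: L_const[of "Suc t" "exp (\<theta> N * C)"])
      then have "(\<Sum>i<N. L (Suc t) (\<lambda>x. exp (\<theta> N * c x)) (X t i)) \<le> exp (\<theta> N * C) * (\<Sum>i<N. L (Suc t) (\<lambda>_. 1) (X t i))"
        unfolding sum_distrib_left by (intro sum_mono)
      then have rle: "r N X \<le> exp (\<theta> N * C)"
        unfolding r_def using sum_L1_pos[OF N tT(1), of "X t"] by (simp add: pos_divide_le_eq)
      have "0 \<le> r N X" unfolding r_def
        by (intro divide_nonneg_nonneg sum_nonneg L_nonneg[OF tT(1) ek] less_imp_le[OF L1_pos[OF tT(1)]]) simp
      then have "r N X ^ N \<le> exp (\<theta> N * C) ^ N" using rle by (intro power_mono)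
      also have "\<dots> = exp (real N * (\<theta> N * C))" by (simp only: exp_of_nat_mult)
      finally have "exp (Z N t \<psi> X) * r N X ^ N \<le> exp (K * (real N * \<theta> N)) * exp (real N * (\<theta> N * C))"
        using K[OF N, of X] \<open>0 \<le> r N X\<close> by (intro mult_mono) auto
      then show "exp (Z N t \<psi> X) * r N X ^ N \<le> exp ((K + C) * (real N * \<theta> N))"
        by (simp add: algebra_simps flip: exp_add)
    qed
  qed
  obtain K2 where K2: "\<And>N X. N > 0 \<Longrightarrow> Z N t (\<psi>' 1) X \<le> K2 * (real N * \<theta> N)" using Z_bound[of t "\<psi>' 1", OF tT(2) \<psi>'] by blast
  have small: "exp_small (\<lambda>N. far_prob N t G \<delta>)"
    by (intro exp_small_far_prob tT \<delta> G)
  have r0: "0 \<le> r N X" for N X unfolding r_def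
    by (intro divide_nonneg_nonneg sum_nonneg L_nonneg[OF tT(1) ek] less_imp_le[OF L1_pos[OF tT(1)]]) simp
  define EZ where "EZ N k X = ennreal (exp (Z N t (\<psi>' k) X))" for N k X
  define R where "R N X = ennreal (exp (Z N t \<psi> X)) * ennreal (r N X ^ N)" for N X
  have lapS: "lap N (Suc t) \<psi> = (\<integral>\<^sup>+X. R N X \<partial>pf N t)" if "N > 0" for N
    using lap_Suc[of t N \<psi>, OF t that \<psi>] by (simp only: R_def r_def c_def)
  have lapE: "lap N t (\<psi>' k) = (\<integral>\<^sup>+X. EZ N k X \<partial>pf N t)" for N k
    unfolding lap_def EZ_def ..
  have pf_m: "g \<in> borel_measurable (pf N t)" if "g \<in> borel_measurable (path_space N t)" "N > 0" for g :: "_ \<Rightarrow> ennreal" and N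
    using that sets_pf[OF tT(2) that(2)] by (simp cong: measurable_cong_sets)
  have EZ_m: "EZ N k \<in> borel_measurable (pf N t)" if "N > 0" for N k
    unfolding EZ_def[abs_def] by (intro pf_m that Z_meas \<psi>')
  have far_m: "(indicator (far N t G \<delta>) :: _ \<Rightarrow> ennreal) \<in> borel_measurable (pf N t)" if "N > 0" for N
    by (intro pf_m that far_indicator_meas G) auto
  have R_m: "R N \<in> borel_measurable (pf N t)" if "N > 0" for N
  proof (rule pf_m[OF _ that])
    have "(\<lambda>X. r N X ^ N) \<in> borel_measurable (path_space N t)"
      unfolding r_def
      by (intro borel_measurable_power borel_measurable_divide borel_measurable_sum
          measurable_compose[OF coordinate_meas bounded_measurableD[OF L_bounded_measurable[OF tT(1) ek]]]
          measurable_compose[OF coordinate_meas bounded_measurableD[OF L_bounded_measurable[OF tT(1) bounded_measurable_const]]]) auto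
    then show "R N \<in> borel_measurable (path_space N t)"
      unfolding R_def[abs_def] by (intro borel_measurable_times_ennreal Z_meas[OF \<psi>t] measurable_compose[OF _ measurable_ennreal])
  qed
  show "rate_le speed (\<lambda>N. lap N (Suc t) \<psi>) (Q (Suc t) \<psi> / 2 + 2 * \<gamma>)"
  proof (rule rate_le_mono[OF speed_at_top])
    show "rate_le speed (\<lambda>N. ennreal (exp (K1 * (real N * \<theta> N))) * far_prob N t G \<delta> +
       ennreal (exp (speed N * (v / 2 + \<epsilon>))) * (lap N t (\<psi>' (1 + \<epsilon>)) + lap N t (\<psi>' (1 - \<epsilon>)))) (q 1 + \<gamma> / 2 + (v / 2 + \<epsilon>))"
      by (intro rate_le_add[OF speed_at_top] superexponential small rate_le_cmult
          rate_le_mono[OF speed_at_top lapk(1) _ \<epsilon>(4)] rate_le_mono[OF speed_at_top lapk(1) _ \<epsilon>(5)]) auto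
    show "q 1 + \<gamma> / 2 + (v / 2 + \<epsilon>) \<le> Q (Suc t) \<psi> / 2 + 2 * \<gamma>"
      unfolding QS using \<epsilon>(3) \<gamma> by simp
    show "\<forall>\<^sub>F N in sequentially. lap N (Suc t) \<psi> \<le> ennreal (exp (K1 * (real N * \<theta> N))) * far_prob N t G \<delta> +
       ennreal (exp (speed N * (v / 2 + \<epsilon>))) * (lap N t (\<psi>' (1 + \<epsilon>)) + lap N t (\<psi>' (1 - \<epsilon>)))"
      using eventually_theta[OF \<eta>]
    proof eventually_elim
      case (elim N)
      then have N: "N > 0" "\<theta> N \<le> \<eta>" by auto
      have "lap N (Suc t) \<psi> \<le> (\<integral>\<^sup>+X. ennreal (exp (K1 * (real N * \<theta> N))) * indicator (far N t G \<delta>) X +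
          ennreal (exp (speed N * (v / 2 + \<epsilon>))) * (EZ N (1 + \<epsilon>) X + EZ N (1 - \<epsilon>) X) \<partial>pf N t)"
        unfolding lapS[OF N(1)]
      proof (rule nn_integral_mono)
        fix X
        show "R N X \<le> ennreal (exp (K1 * (real N * \<theta> N))) * indicator (far N t G \<delta>) X +
          ennreal (exp (speed N * (v / 2 + \<epsilon>))) * (EZ N (1 + \<epsilon>) X + EZ N (1 - \<epsilon>) X)"
        proof (cases "X \<in> far N t G \<delta>")
          case True
          have "R N X = ennreal (exp (Z N t \<psi> X) * r N X ^ N)" unfolding R_def using r0 by (simp add: ennreal_mult)
          also have "\<dots> \<le> ennreal (exp (K1 * (real N * \<theta> N)))" using K1[OF N(1)] by (intro ennreal_leI)
          finally show ?thesis using True by (simp add: add_increasing2)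
        next
          case False
          note e = est2[OF N False]
          \<comment> \<open>The modulus is resolved by the sign of \<open>u\<close>. As the sign
            depends on \<open>X\<close>, the integrand is afterwards bounded by the sum over both
            values of \<open>k\<close>.\<close>
          define k where "k = (if u N X \<ge> 0 then 1 + \<epsilon> else 1 - \<epsilon>)"
          have ku: "u N X + \<epsilon> * \<bar>u N X\<bar> = k * u N X" by (simp add: k_def algebra_simps)
          have "real N * ln (r N X) \<le> speed N * (v / 2 + \<epsilon>) + k * u N X"
            using e unfolding ku[symmetric] by (simp add: algebra_simps abs_le_iff)
          then have "exp (Z N t \<psi> X) * r N X ^ N \<le> exp (speed N * (v / 2 + \<epsilon>)) * exp (Z N t (\<psi>' k) X)"
            using e unfolding Zk u_def[symmetric] by (simp flip: exp_add)
          then have "R N X \<le> ennreal (exp (speed N * (v / 2 + \<epsilon>))) * EZ N k X"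
            unfolding R_def EZ_def using r0 by (simp flip: ennreal_mult)
          also have "\<dots> \<le> ennreal (exp (speed N * (v / 2 + \<epsilon>))) * (EZ N (1 + \<epsilon>) X + EZ N (1 - \<epsilon>) X)"
            by (intro mult_left_mono) (auto simp: k_def add_increasing add_increasing2)
          finally show ?thesis by (simp add: add_increasing)
        qed
      qed
      also have "\<dots> = ennreal (exp (K1 * (real N * \<theta> N))) * far_prob N t G \<delta> +
          ennreal (exp (speed N * (v / 2 + \<epsilon>))) * (lap N t (\<psi>' (1 + \<epsilon>)) + lap N t (\<psi>' (1 - \<epsilon>)))"
        unfolding lapE far_prob_def using EZ_m[OF N(1)] far_m[OF N(1)]
        by (simp add: nn_integral_add nn_integral_cmult)
      finally show ?case .
    qed
  qed
  \<comment> \<open>The quantity of known lower rate is \<open>lap N t (\<psi>' 1)\<close>. Where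
    \<open>\<epsilon> * \<bar>u N X\<bar>\<close> is at most \<open>speed N * \<gamma>\<close>, the
    estimate \<open>est2\<close> read backwards bounds its integrand by that of
    \<open>lap N (Suc t) \<psi>\<close> times the displayed exponential. The remaining parts have
    rate at most \<open>q 1 - \<gamma> / 2\<close> and are cancelled.\<close>
  have "rate_ge speed (\<lambda>N. ennreal (exp (speed N * (\<gamma> + \<epsilon> - v / 2))) * lap N (Suc t) \<psi>) (q 1)"
  proof (rule rate_ge_cancel[OF speed_at_top lapk(2)])
    show "rate_le speed (\<lambda>N. ennreal (exp (speed N * (- \<gamma>))) * (lap N t (\<psi>' (1 + \<epsilon>)) + lap N t (\<psi>' (1 - \<epsilon>))) +
        ennreal (exp (K2 * (real N * \<theta> N))) * far_prob N t G \<delta>) (q 1 + \<gamma> / 2 + - \<gamma>)"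
      by (intro rate_le_add[OF speed_at_top] superexponential small rate_le_cmult
          rate_le_mono[OF speed_at_top lapk(1) _ \<epsilon>(4)] rate_le_mono[OF speed_at_top lapk(1) _ \<epsilon>(5)]) auto
    show "q 1 + \<gamma> / 2 + - \<gamma> < q 1" using \<gamma> by simp
    show "\<forall>\<^sub>F N in sequentially. lap N t (\<psi>' 1) \<le> ennreal (exp (speed N * (\<gamma> + \<epsilon> - v / 2))) * lap N (Suc t) \<psi> +
       (ennreal (exp (speed N * (- \<gamma>))) * (lap N t (\<psi>' (1 + \<epsilon>)) + lap N t (\<psi>' (1 - \<epsilon>))) +
        ennreal (exp (K2 * (real N * \<theta> N))) * far_prob N t G \<delta>)"
      using eventually_theta[OF \<eta>]
    proof eventually_elim
      case (elim N)
      then have N: "N > 0" "\<theta> N \<le> \<eta>" by auto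
      have "lap N t (\<psi>' 1) \<le> (\<integral>\<^sup>+X. ennreal (exp (speed N * (\<gamma> + \<epsilon> - v / 2))) * R N X +
         (ennreal (exp (speed N * (- \<gamma>))) * (EZ N (1 + \<epsilon>) X + EZ N (1 - \<epsilon>) X) +
          ennreal (exp (K2 * (real N * \<theta> N))) * indicator (far N t G \<delta>) X) \<partial>pf N t)"
        unfolding lapE
      proof (rule nn_integral_mono)
        fix X
        show "EZ N 1 X \<le> ennreal (exp (speed N * (\<gamma> + \<epsilon> - v / 2))) * R N X +
         (ennreal (exp (speed N * (- \<gamma>))) * (EZ N (1 + \<epsilon>) X + EZ N (1 - \<epsilon>) X) +
          ennreal (exp (K2 * (real N * \<theta> N))) * indicator (far N t G \<delta>) X)"
        proof (cases "X \<in> far N t G \<delta>")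
          case True
          have "EZ N 1 X \<le> ennreal (exp (K2 * (real N * \<theta> N)))"
            unfolding EZ_def using K2[OF N(1)] by (intro ennreal_leI) simp
          then show ?thesis using True by (simp add: add_increasing)
        next
          case False
          note e = est2[OF N False]
          show ?thesis
          proof (cases "\<epsilon> * \<bar>u N X\<bar> \<le> speed N * \<gamma>")
            case True
            then have "u N X \<le> speed N * (\<gamma> + \<epsilon> - v / 2) + real N * ln (r N X)"
              using e by (simp add: algebra_simps abs_le_iff)
            then have "exp (Z N t (\<psi>' 1) X) \<le> exp (speed N * (\<gamma> + \<epsilon> - v / 2)) * (exp (Z N t \<psi> X) * r N X ^ N)"
              using e unfolding Zk u_def[symmetric] by (simp flip: exp_add)
            then have "EZ N 1 X \<le> ennreal (exp (speed N * (\<gamma> + \<epsilon> - v / 2))) * R N X"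
              unfolding R_def EZ_def using r0 by (simp flip: ennreal_mult)
            then show ?thesis by (simp add: add_increasing2)
          next
            case large: False
            define k where "k = (if u N X \<ge> 0 then 1 + \<epsilon> else 1 - \<epsilon>)"
            have ku: "u N X + \<epsilon> * \<bar>u N X\<bar> = k * u N X" by (simp add: k_def algebra_simps)
            have "u N X \<le> speed N * (- \<gamma>) + k * u N X" using large unfolding ku[symmetric] by simp
            then have "exp (Z N t (\<psi>' 1) X) \<le> exp (speed N * (- \<gamma>)) * exp (Z N t (\<psi>' k) X)"
              unfolding Zk u_def[symmetric] by (simp flip: exp_add)
            then have "EZ N 1 X \<le> ennreal (exp (speed N * (- \<gamma>))) * EZ N k X"
              unfolding EZ_def by (simp flip: ennreal_mult)
            also have "\<dots> \<le> ennreal (exp (speed N * (- \<gamma>))) * (EZ N (1 + \<epsilon>) X + EZ N (1 - \<epsilon>) X)"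
              by (intro mult_left_mono) (auto simp: k_def add_increasing add_increasing2)
            finally show ?thesis by (simp add: add_increasing add_increasing2)
          qed
        qed
      qed
      also have "\<dots> = ennreal (exp (speed N * (\<gamma> + \<epsilon> - v / 2))) * lap N (Suc t) \<psi> +
         (ennreal (exp (speed N * (- \<gamma>))) * (lap N t (\<psi>' (1 + \<epsilon>)) + lap N t (\<psi>' (1 - \<epsilon>))) +
          ennreal (exp (K2 * (real N * \<theta> N))) * far_prob N t G \<delta>)"
        unfolding lapE far_prob_def lapS[OF N(1)] using EZ_m[OF N(1)] far_m[OF N(1)] R_m[OF N(1)]
        by (simp add: nn_integral_add nn_integral_cmult)
      finally show ?case .
    qed
  qed
  from rate_ge_cmult[OF this, of "- (\<gamma> + \<epsilon> - v / 2)"]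
  have "rate_ge speed (\<lambda>N. lap N (Suc t) \<psi>) (q 1 + - (\<gamma> + \<epsilon> - v / 2))"
    by (simp add: mult.assoc[symmetric] flip: ennreal_mult exp_add distrib_left)
  then show "rate_ge speed (\<lambda>N. lap N (Suc t) \<psi>) (Q (Suc t) \<psi> / 2 - 2 * \<gamma>)"
    by (rule rate_ge_weaken[OF speed_at_top]) (use QS \<epsilon>(3) \<gamma> in simp)
qed

text \<open>The induction covers all families at once, because one step calls its hypothesis for the
  three families with the last function changed by the factors \<open>1\<close>,
  \<open>1 + \<epsilon>\<close> and \<open>1 - \<epsilon>\<close> times the pullback. The remaining
  error is removed by \<open>rate_le_closed\<close> and \<open>rate_ge_closed\<close>.\<close>

theorem laplace_limit:
  assumes "t \<le> T" "\<And>i. i \<le> t \<Longrightarrow> bounded_measurable (\<psi> i)"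
  shows "rate_le speed (\<lambda>N. lap N t \<psi>) (Q t \<psi> / 2) \<and> rate_ge speed (\<lambda>N. lap N t \<psi>) (Q t \<psi> / 2)"
  using assms
proof (induction t arbitrary: \<psi>)
  case 0
  then show ?case using laplace_0[of \<psi>] by simp
next
  case (Suc t)
  have IH: "rate_le speed (\<lambda>N. lap N t \<psi>) (Q t \<psi> / 2) \<and> rate_ge speed (\<lambda>N. lap N t \<psi>) (Q t \<psi> / 2)"
    if "\<And>i. i \<le> t \<Longrightarrow> bounded_measurable (\<psi> i)" for \<psi>
    using Suc.IH[OF _ that] Suc.prems(1) by simp
  have "rate_le speed (\<lambda>N. lap N (Suc t) \<psi>) (Q (Suc t) \<psi> / 2 + e)"
    "rate_ge speed (\<lambda>N. lap N (Suc t) \<psi>) (Q (Suc t) \<psi> / 2 - e)" if "e > 0" for e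
    using laplace_Suc[OF Suc.prems IH, where \<gamma> = "e / 2"] that by simp_all
  then show ?case using rate_le_closed rate_ge_closed by blast
qed

end

section \<open>The moderate deviation principle for the particle filter\<close>

theorem theorem3p1:
  fixes mu :: "(real^'d) measure" and nu :: "(real^'m) measure"
    and a0 :: "real^'d \<Rightarrow> real"
    and a :: "nat \<Rightarrow> real^'d \<Rightarrow> real^'d \<Rightarrow> real"
    and b :: "nat \<Rightarrow> real^'d \<Rightarrow> real^'m \<Rightarrow> real"
    and y :: "nat \<Rightarrow> real^'m"
    and T :: nat
    and \<psi> :: "nat \<Rightarrow> real^'d \<Rightarrow> real"
    and bN :: "nat \<Rightarrow> real"
    and tm :: "'n::finite \<Rightarrow> nat"
  assumes model: "hmm_model mu nu a0 a b"
    and A0: "assumption_A0 mu a b y T"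
    and psi_meas: "\<And>t. t \<le> T \<Longrightarrow> \<psi> t \<in> borel_measurable borel"
    and psi_bdd: "\<And>t. t \<le> T \<Longrightarrow> bounded (range (\<psi> t))"
    and bN_pos: "\<And>N. bN N > 0"
    and bN_lim: "filterlim bN at_top sequentially"
    and bN_sqrt: "filterlim (\<lambda>N. sqrt (real N) / bN N) at_top sequentially"
    and tm_bij: "bij_betw tm UNIV {..T}"
  defines "I \<equiv> (\<lambda>x::real^'n. SUP l::real^'n. ereal (x \<bullet> l - 1/2 *
              (\<Sum>j\<in>UNIV. \<Sum>k\<in>UNIV. l$j * l$k *
                 Vst mu a0 a b y (tm j) (tm k) (\<psi> (tm j)) (\<psi> (tm k)))))"
    and "P \<equiv> (\<lambda>N \<Gamma>. measure (pf_law mu a0 a b y N T)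
                      {X \<in> space (pf_law mu a0 a b y N T).
                         ((\<chi> j. MN mu a0 a b y bN N (tm j) (\<psi> (tm j)) X) :: real^'n) \<in> \<Gamma>})"
  shows "good_rate_function I \<and>
    (\<forall>\<Gamma>\<in>sets borel.
       - (INF x\<in>interior \<Gamma>. I x) \<le> liminf (\<lambda>N. scaled_log ((bN N)\<^sup>2) (P N \<Gamma>)) \<and>
       liminf (\<lambda>N. scaled_log ((bN N)\<^sup>2) (P N \<Gamma>))
         \<le> limsup (\<lambda>N. scaled_log ((bN N)\<^sup>2) (P N \<Gamma>)) \<and>
       limsup (\<lambda>N. scaled_log ((bN N)\<^sup>2) (P N \<Gamma>)) \<le> - (INF x\<in>closure \<Gamma>. I x))"
proof -
  have psi: "bounded_measurable (\<psi> t)" if "t \<le> T" for t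
    using psi_meas[OF that] psi_bdd[OF that] by (simp add: bounded_measurable_def)
  interpret moderate_deviations mu nu a0 a b y T bN
    by unfold_locales (use model A0 bN_pos bN_lim bN_sqrt in auto)
  have tm: "tm j \<le> T" for j using tm_bij by (auto simp: bij_betw_def)
  have inj: "inj tm" using tm_bij by (simp add: bij_betw_def)
  define vec where "vec N X = ((\<chi> j. MN mu a0 a b y bN N (tm j) (\<psi> (tm j)) X) :: real^'n)" for N X
  define law where "law N = distr (pf N T) borel (vec N)" for N
  define S where "S l = ((\<chi> j. \<Sum>k\<in>UNIV. l $ k * V (tm j) (tm k) (\<psi> (tm j)) (\<psi> (tm k))) :: real^'n)" for l :: "real^'n"
  \<comment> \<open>The dual vector is absorbed into the test functions, so that the limit for
    arbitrary families yields the one for every \<open>l\<close>. \<open>tm\<close> enumerates the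
    times 0 to \<open>T\<close> by the index type of the vectors; \<open>inv tm\<close> finds the
    component that belongs to a given time.\<close>
  define \<phi> where "\<phi> l s = (\<lambda>x. l $ inv tm s * \<psi> s x)" for l :: "real^'n" and s
  have phi: "bounded_measurable (\<phi> l s)" if "s \<le> T" for l s
    unfolding \<phi>_def using psi[OF that] by (intro bounded_measurable_mult) auto
  have phi_tm: "\<phi> l (tm j) = (\<lambda>x. l $ j * \<psi> (tm j) x)" for l j
    by (simp add: \<phi>_def inv_f_f[OF inj])
  have quad: "(\<Sum>j\<in>UNIV. \<Sum>k\<in>UNIV. l $ j * l $ k * V (tm j) (tm k) (\<psi> (tm j)) (\<psi> (tm k))) = l \<bullet> S l" for l
    by (simp add: S_def inner_vec_def sum_distrib_left mult.assoc)
  have Q_phi: "Q T (\<phi> l) = l \<bullet> S l" for l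
  proof -
    have "Q T (\<phi> l) = (\<Sum>j\<in>UNIV. \<Sum>k\<in>UNIV. V (tm j) (tm k) (\<phi> l (tm j)) (\<phi> l (tm k)))"
      unfolding Q_def by (simp only: sum.reindex_bij_betw[OF tm_bij, symmetric])
    also have "\<dots> = (\<Sum>j\<in>UNIV. \<Sum>k\<in>UNIV. l $ j * l $ k * V (tm j) (tm k) (\<psi> (tm j)) (\<psi> (tm k)))"
      unfolding phi_tm using tm psi by (simp add: V_cmult)
    finally show ?thesis by (simp only: quad)
  qed
  have MN_eq: "MN mu a0 a b y bN N t (\<psi> t) X = dev N t (\<psi> t) X / \<theta> N" if "N > 0" for N t X
    using that bN_pos[of N] sum_ctr[OF that, where t = t and g = "\<psi> t" and X = X]
    by (simp add: MN_def \<theta>_def field_simps)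
  \<comment> \<open>The scalings match: \<open>MN\<close> is \<open>dev\<close> divided by
    \<open>\<theta> N\<close>, and the speed is \<open>N * (\<theta> N)\<^sup>2\<close>, so their
    product is \<open>N * \<theta> N * dev\<close>.\<close>
  have vec_inner: "speed N * (vec N X \<bullet> l) = Z N T (\<phi> l) X" if "N > 0" for N X l
  proof -
    have "Z N T (\<phi> l) X = real N * \<theta> N * (\<Sum>j\<in>UNIV. dev N (tm j) (\<phi> l (tm j)) X)"
      unfolding Z_def by (simp only: sum.reindex_bij_betw[OF tm_bij, symmetric])
    also have "\<dots> = (\<Sum>j\<in>UNIV. real N * \<theta> N * (l $ j * dev N (tm j) (\<psi> (tm j)) X))"
      unfolding phi_tm dev_cmult sum_distrib_left ..
    also have "\<dots> = (\<Sum>j\<in>UNIV. speed N * (dev N (tm j) (\<psi> (tm j)) X / \<theta> N * l $ j))"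
      unfolding speed_eq[OF that] using theta_pos[OF that]
      by (intro sum.cong refl) (simp add: power2_eq_square)
    also have "\<dots> = speed N * (vec N X \<bullet> l)"
      by (simp add: vec_def inner_vec_def MN_eq[OF that] sum_distrib_left)
    finally show ?thesis ..
  qed
  have vec_meas: "vec N \<in> borel_measurable (pf N T)" if "N > 0" for N
  proof -
    have "(\<lambda>X. vec N X \<bullet> i) \<in> borel_measurable (path_space N T)" if Basis: "i \<in> Basis" for i
    proof -
      obtain j where i: "i = axis j 1" using Basis by (auto simp: Basis_vec_def)
      have [measurable]: "dev N (tm j) (\<psi> (tm j)) \<in> borel_measurable (path_space N T)"
        by (intro dev_meas psi tm)
      show ?thesis unfolding i by (simp add: vec_def inner_axis MN_eq[OF \<open>N > 0\<close>])
    qed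
    then have "vec N \<in> borel_measurable (path_space N T)"
      by (subst borel_measurable_euclidean_space) blast
    then show ?thesis using sets_pf[OF order_refl that] by (simp cong: measurable_cong_sets)
  qed
  have law_laplace: "\<forall>\<^sub>F N in sequentially. (\<integral>\<^sup>+x. ennreal (exp (speed N * (x \<bullet> l))) \<partial>law N) = lap N T (\<phi> l)" for l
    using eventually_gt_at_top[of 0]
  proof eventually_elim
    case (elim N)
    show ?case unfolding law_def lap_def vec_inner[OF elim, symmetric]
      by (rule nn_integral_distr[OF vec_meas[OF elim]]) simp
  qed
  have laplace: "rate_le speed (\<lambda>N. lap N T (\<phi> l)) (l \<bullet> S l / 2)"
    "rate_ge speed (\<lambda>N. lap N T (\<phi> l)) (l \<bullet> S l / 2)" for l
    using laplace_limit[of T "\<phi> l", OF order_refl phi] unfolding Q_phi by simp_all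
  interpret limit: quadratic_rate law speed S
  proof (rule quadratic_rate.intro)
    show "sets (law N) = sets borel" for N by (simp add: law_def)
    show "\<forall>\<^sub>F N in sequentially. prob_space (law N)"
      using eventually_gt_at_top[of 0]
      by eventually_elim (simp add: law_def prob_space.prob_space_distr prob_pf vec_meas)
    show "filterlim speed at_top sequentially" by (rule speed_at_top)
    show "linear S"
      by (rule linearI) (simp_all add: S_def vec_eq_iff distrib_right sum.distrib sum_distrib_left mult.assoc)
    show "S x \<bullet> z = x \<bullet> S z" for x z
    proof -
      have "S x \<bullet> z = (\<Sum>j\<in>UNIV. \<Sum>k\<in>UNIV. x $ k * z $ j * V (tm j) (tm k) (\<psi> (tm j)) (\<psi> (tm k)))"
        by (simp add: S_def inner_vec_def sum_distrib_left sum_distrib_right mult_ac)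
      also have "\<dots> = (\<Sum>k\<in>UNIV. \<Sum>j\<in>UNIV. x $ k * z $ j * V (tm j) (tm k) (\<psi> (tm j)) (\<psi> (tm k)))"
        by (rule sum.swap)
      also have "\<dots> = (\<Sum>k\<in>UNIV. \<Sum>j\<in>UNIV. x $ k * z $ j * V (tm k) (tm j) (\<psi> (tm k)) (\<psi> (tm j)))"
        using V_sym[OF tm tm psi[OF tm] psi[OF tm]] by simp
      also have "\<dots> = x \<bullet> S z"
        by (simp add: S_def inner_vec_def sum_distrib_left sum_distrib_right mult_ac)
      finally show ?thesis .
    qed
    show "rate_le speed (\<lambda>N. \<integral>\<^sup>+x. ennreal (exp (speed N * (x \<bullet> l))) \<partial>law N) (l \<bullet> S l / 2)" for l
      by (rule rate_le_mono[OF speed_at_top laplace(1) _ order_refl])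
        (rule eventually_mono[OF law_laplace[of l]], simp)
    show "rate_ge speed (\<lambda>N. \<integral>\<^sup>+x. ennreal (exp (speed N * (x \<bullet> l))) \<partial>law N) (l \<bullet> S l / 2)" for l
      by (rule rate_ge_mono[OF laplace(2)]) (rule eventually_mono[OF law_laplace[of l]], simp)
  qed
  have I: "I = limit.rate_function"
    unfolding I_def limit.rate_function_def[abs_def] quad by simp
  \<comment> \<open>The equality is available for \<open>N > 0\<close>, where \<open>vec N\<close>
    is known to be measurable; limsup and liminf see only large \<open>N\<close>.\<close>
  have P: "\<forall>\<^sub>F N in sequentially. scaled_log (speed N) (P N \<Gamma>) = scaled_log (speed N) (measure (law N) \<Gamma>)"
    if "\<Gamma> \<in> sets borel" for \<Gamma>
    using eventually_gt_at_top[of 0]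
  proof eventually_elim
    case (elim N)
    have "vec N -` \<Gamma> \<inter> space (pf N T) = {X \<in> space (pf N T). vec N X \<in> \<Gamma>}" by auto
    then show ?case
      unfolding P_def law_def vec_def[symmetric] using measure_distr[OF vec_meas[OF elim] that] by simp
  qed
  show ?thesis
  proof (intro conjI ballI)
    show "good_rate_function I" unfolding I by (rule limit.good_rate)
    fix \<Gamma> :: "(real^'n) set" assume \<Gamma>: "\<Gamma> \<in> sets borel"
    show "- (INF x\<in>interior \<Gamma>. I x) \<le> liminf (\<lambda>N. scaled_log (speed N) (P N \<Gamma>))"
      unfolding I Liminf_eq[OF P[OF \<Gamma>]] by (rule limit.deviation_principle[OF \<Gamma>])
    show "limsup (\<lambda>N. scaled_log (speed N) (P N \<Gamma>)) \<le> - (INF x\<in>closure \<Gamma>. I x)"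
      unfolding I Limsup_eq[OF P[OF \<Gamma>]] by (rule limit.deviation_principle[OF \<Gamma>])
    show "liminf (\<lambda>N. scaled_log (speed N) (P N \<Gamma>)) \<le> limsup (\<lambda>N. scaled_log (speed N) (P N \<Gamma>))"
      by (rule Liminf_le_Limsup) simp
  qed
qed

end
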